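(* Let $w$ be a non-negative bounded (measurable) function on $\mathbb R_+=(0,\infty)$ with bounded support. Let $$\mathbf a(t)=\int_0^\infty t^{-\frac12-\lambda}w(\lambda)\,d\lambda,\qquad t\ge 1,$$ and let $a(j)=\mathbf a(j)$ for $j\in\mathbb N$. Then $M(a)\ge0$ and $\mathbf M(\mathbf a)\ge0$. Further, there exist self-adjoint operators $A$ and $B$ in $L^2(\mathbb R_+)$ such that $$M(a)\approx A,\qquad \mathbf M(\mathbf a)\approx B,\qquad A-B\in\mathbf S_0.$$
   Context: $\mathbb N=\{1,2,3,\dots\}$. For a sequence $a$, the Helson matrix $M(a)=\{a(jk)\}_{j,k=1}^\infty$ is considered as an operator on $\ell^2(\mathbb N)$. For a function $\mathbf a$ on $(1,\infty)$, the integral Helson operator $\mathbf M(\mathbf a)$ on $L^2(1,\infty)$ is $$(\mathbf M(\mathbf a)f)(t)=\int_1^\infty \mathbf a(ts)f(s)\,ds,\qquad t\ge1.$$ For a compact operator $T$, $\{s_n(T)\}_{n\ge1}$ is its non-increasing sequence of singular values; the Schatten class $\mathbf S_p$, $0<p<\infty$, consists of compact $T$ with $\sum_n s_n(T)^p<\infty$, and $\mathbf S_0=\bigcap_{p>0}\mathbf S_p$; equivalently, $T\in\mathbf S_0$ iff $s_n(T)=O(n^{-c})$ as $n\to\infty$ for every $c>0$. For bounded operators $A_1$, $A_2$ on Hilbert spaces $\mathcal H_1$, $\mathcal H_2$, $A_1\approx A_2$ (unitary equivalence modulo kernels) means that $A_1|_{(\operatorname{Ker}A_1)^\perp}$ and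 $A_2|_{(\operatorname{Ker}A_2)^\perp}$ are unitarily equivalent. $T\ge 0$ means that the operator $T$ is non-negative. *)

theory Defs
  imports "HOL-Analysis.Analysis"
begin

text \<open>
  The complex Hilbert space \<open>L\<^sup>2(M)\<close> is represented by the set of its representatives, i.e. the
  measurable square-integrable functions; two of them denote the same vector iff they agree
  \<open>M\<close>-almost everywhere. Only the values on \<open>space M\<close> matter. Accordingly, an operator is a map on
  representatives, and every identity between vectors is an identity almost everywhere.
\<close>

definition L2 :: "'a measure \<Rightarrow> ('a \<Rightarrow> complex) set" where
  "L2 M = {f \<in> borel_measurable M. integrable M (\<lambda>x. (cmod (f x))\<^sup>2)}"

definition L2_inner :: "'a measure \<Rightarrow> ('a \<Rightarrow> complex) \<Rightarrow> ('a \<Rightarrow> complex) \<Rightarrow> complex" where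
  "L2_inner M f g = (LINT x|M. f x * cnj (g x))"

definition L2_norm :: "'a measure \<Rightarrow> ('a \<Rightarrow> complex) \<Rightarrow> real" where
  "L2_norm M f = sqrt (LINT x|M. (cmod (f x))\<^sup>2)"

abbreviation ell2_measure :: "nat measure" where
  "ell2_measure \<equiv> count_space {1..}"

text \<open>\<open>L\<^sup>2(c,\<infinity>)\<close>; every class modulo null sets of Lebesgue measurable functions contains a Borel
  function, so Borel representatives suffice.\<close>

abbreviation ray_measure :: "real \<Rightarrow> real measure" where
  "ray_measure c \<equiv> restrict_space lborel {c<..}"

definition L2_linear_on ::
    "'a measure \<Rightarrow> ('a \<Rightarrow> complex) set \<Rightarrow> 'b measure \<Rightarrow> (('a \<Rightarrow> complex) \<Rightarrow> ('b \<Rightarrow> complex)) \<Rightarrow> bool" where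
  "L2_linear_on M S N T \<longleftrightarrow>
     (\<forall>f\<in>S. \<forall>g\<in>S. \<forall>c d.
        AE x in N. T (\<lambda>y. c * f y + d * g y) x = c * T f x + d * T g x)"

text \<open>Linearity and boundedness force \<open>T\<close> to respect equality almost everywhere, so \<open>T\<close> induces a
  bounded operator on the space of classes; conversely every bounded operator arises this way.\<close>

definition L2_bounded_op :: "'a measure \<Rightarrow> (('a \<Rightarrow> complex) \<Rightarrow> ('a \<Rightarrow> complex)) \<Rightarrow> bool" where
  "L2_bounded_op M T \<longleftrightarrow>
     (\<forall>f\<in>L2 M. T f \<in> L2 M) \<and>
     L2_linear_on M (L2 M) M T \<and>
     (\<exists>C. \<forall>f\<in>L2 M. L2_norm M (T f) \<le> C * L2_norm M f)"

definition L2_selfadjoint :: "'a measure \<Rightarrow> (('a \<Rightarrow> complex) \<Rightarrow> ('a \<Rightarrow> complex)) \<Rightarrow> bool" where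
  "L2_selfadjoint M T \<longleftrightarrow>
     L2_bounded_op M T \<and>
     (\<forall>f\<in>L2 M. \<forall>g\<in>L2 M. L2_inner M (T f) g = L2_inner M f (T g))"

definition L2_nonneg :: "'a measure \<Rightarrow> (('a \<Rightarrow> complex) \<Rightarrow> ('a \<Rightarrow> complex)) \<Rightarrow> bool" where
  "L2_nonneg M T \<longleftrightarrow>
     L2_bounded_op M T \<and> (\<forall>f\<in>L2 M. L2_inner M (T f) f \<in> \<real>\<^sub>\<ge>\<^sub>0)"

definition L2_adjoint ::
    "'a measure \<Rightarrow> (('a \<Rightarrow> complex) \<Rightarrow> ('a \<Rightarrow> complex)) \<Rightarrow> (('a \<Rightarrow> complex) \<Rightarrow> ('a \<Rightarrow> complex))" where
  "L2_adjoint M T =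
     (SOME S. L2_bounded_op M S \<and>
        (\<forall>f\<in>L2 M. \<forall>g\<in>L2 M. L2_inner M (T f) g = L2_inner M f (S g)))"

definition L2_compact_op :: "'a measure \<Rightarrow> (('a \<Rightarrow> complex) \<Rightarrow> ('a \<Rightarrow> complex)) \<Rightarrow> bool" where
  "L2_compact_op M T \<longleftrightarrow>
     L2_bounded_op M T \<and>
     (\<forall>f :: nat \<Rightarrow> 'a \<Rightarrow> complex. (\<forall>n. f n \<in> L2 M \<and> L2_norm M (f n) \<le> 1) \<longrightarrow>
        (\<exists>g\<in>L2 M. \<exists>r :: nat \<Rightarrow> nat. strict_mono r \<and>
           (\<lambda>n. L2_norm M (\<lambda>x. T (f (r n)) x - g x)) \<longlonglongrightarrow> 0))"

definition L2_orthonormal :: "'a measure \<Rightarrow> nat \<Rightarrow> (nat \<Rightarrow> 'a \<Rightarrow> complex) \<Rightarrow> bool" where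
  "L2_orthonormal M n e \<longleftrightarrow>
     (\<forall>i<n. e i \<in> L2 M) \<and>
     (\<forall>i<n. \<forall>j<n. L2_inner M (e i) (e j) = (if i = j then 1 else 0))"

text \<open>
  The singular values of a compact \<open>T\<close> are the eigenvalues \<open>\<tau> > 0\<close> of \<open>\<surd>(T\<^sup>* T)\<close>, i.e. the numbers with
  \<open>T\<^sup>* T e = \<tau>\<^sup>2 e\<close> for some \<open>e \<noteq> 0\<close>, listed in non-increasing order with multiplicity and continued by
  zeros. Hence the \<open>n\<close>-th one, \<open>n \<ge> 1\<close>, is the largest \<open>\<sigma> > 0\<close> such that at least \<open>n\<close> of the eigenvalues,
  counted with multiplicity, are \<open>\<ge> \<sigma>\<close>, and it is \<open>0\<close> if no such \<open>\<sigma>\<close> exists. Multiplicities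
  are counted by orthonormal eigenvectors; for distinct eigenvalues these are automatically orthogonal.
\<close>

definition singular_value :: "'a measure \<Rightarrow> (('a \<Rightarrow> complex) \<Rightarrow> ('a \<Rightarrow> complex)) \<Rightarrow> nat \<Rightarrow> real" where
  "singular_value M T n =
     Sup ({0} \<union> {\<sigma>. \<sigma> > 0 \<and>
       (\<exists>e \<tau>. L2_orthonormal M n e \<and>
          (\<forall>i<n. \<tau> i \<ge> \<sigma> \<and>
             (AE x in M. L2_adjoint M T (T (e i)) x = complex_of_real ((\<tau> i)\<^sup>2) * e i x)))})"

definition schatten :: "'a measure \<Rightarrow> real \<Rightarrow> (('a \<Rightarrow> complex) \<Rightarrow> ('a \<Rightarrow> complex)) set" where
  "schatten M p =
     {T. L2_compact_op M T \<and> summable (\<lambda>n. singular_value M T (Suc n) powr p)}"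

definition schatten0 :: "'a measure \<Rightarrow> (('a \<Rightarrow> complex) \<Rightarrow> ('a \<Rightarrow> complex)) set" where
  "schatten0 M = (\<Inter>p\<in>{0<..}. schatten M p)"

definition L2_ker :: "'a measure \<Rightarrow> (('a \<Rightarrow> complex) \<Rightarrow> ('a \<Rightarrow> complex)) \<Rightarrow> ('a \<Rightarrow> complex) set" where
  "L2_ker M T = {f \<in> L2 M. AE x in M. T f x = 0}"

definition L2_perp :: "'a measure \<Rightarrow> ('a \<Rightarrow> complex) set \<Rightarrow> ('a \<Rightarrow> complex) set" where
  "L2_perp M S = {f \<in> L2 M. \<forall>g\<in>S. L2_inner M f g = 0}"

text \<open>
  \<open>U\<close> is a unitary map between the subspaces \<open>H1\<close> and \<open>H2\<close> (surjective modulo null sets and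
  preserving inner products, hence also respecting equality almost everywhere).
\<close>

definition L2_unitary_between ::
    "'a measure \<Rightarrow> ('a \<Rightarrow> complex) set \<Rightarrow> 'b measure \<Rightarrow> ('b \<Rightarrow> complex) set \<Rightarrow>
     (('a \<Rightarrow> complex) \<Rightarrow> ('b \<Rightarrow> complex)) \<Rightarrow> bool" where
  "L2_unitary_between M1 H1 M2 H2 U \<longleftrightarrow>
     (\<forall>f\<in>H1. U f \<in> H2) \<and>
     L2_linear_on M1 H1 M2 U \<and>
     (\<forall>f\<in>H1. \<forall>g\<in>H1. L2_inner M2 (U f) (U g) = L2_inner M1 f g) \<and>
     (\<forall>h\<in>H2. \<exists>f\<in>H1. AE x in M2. U f x = h x)"

text \<open>
  Unitary equivalence modulo kernels. For the two restrictions to be operators in the subspaces, these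
  have to be invariant, which is automatic for self-adjoint operators.
\<close>

definition unitarily_equiv_mod_ker ::
    "'a measure \<Rightarrow> (('a \<Rightarrow> complex) \<Rightarrow> ('a \<Rightarrow> complex)) \<Rightarrow>
     'b measure \<Rightarrow> (('b \<Rightarrow> complex) \<Rightarrow> ('b \<Rightarrow> complex)) \<Rightarrow> bool" where
  "unitarily_equiv_mod_ker M1 A1 M2 A2 \<longleftrightarrow>
     (let H1 = L2_perp M1 (L2_ker M1 A1); H2 = L2_perp M2 (L2_ker M2 A2) in
        (\<forall>f\<in>H1. A1 f \<in> H1) \<and> (\<forall>g\<in>H2. A2 g \<in> H2) \<and>
        (\<exists>U. L2_unitary_between M1 H1 M2 H2 U \<and>
             (\<forall>f\<in>H1. AE x in M2. U (A1 f) x = A2 (U f) x)))"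

definition helson_matrix :: "(nat \<Rightarrow> complex) \<Rightarrow> (nat \<Rightarrow> complex) \<Rightarrow> (nat \<Rightarrow> complex)" where
  "helson_matrix a f = (\<lambda>j. \<Sum>\<^sub>\<infinity>k\<in>{1..}. a (j * k) * f k)"

definition integral_helson :: "(real \<Rightarrow> complex) \<Rightarrow> (real \<Rightarrow> complex) \<Rightarrow> (real \<Rightarrow> complex)" where
  "integral_helson a f = (\<lambda>t. LINT s:{1<..}|lborel. a (t * s) * f s)"

end

(*
  Write v for the square root of w and N for the operator from L^2(0,infinity) to l^2 or L^2(1,infinity) with
  kernel v(x) t^(-1/2-x), where t runs through the positive integers or through (1,infinity). Then N N^* is the
  Helson operator, and N^* N is the operator in L^2(0,infinity) with kernel v(x) k(x+y) v(y), where
  k(s) = zeta(1+s) in the discrete case and k(s) = 1/s in the continuous case. N is bounded by a Schur test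
  that reduces to the Carleman kernel 1/(x+y), and the polar decomposition of N gives N N^* ~ N^* N. The
  difference of the two operators N^* N has the kernel v(x) h(x+y) v(y) with h(s) = zeta(1+s) - 1/s. By
  Euler-Maclaurin summation h is approximated by polynomials of degree r up to an error that decays
  geometrically in r; such polynomials give operators of rank at most r+1, so the singular values decay
  geometrically as well.

  The unitary part of N is obtained without functional calculus. If N is a contraction, D = 1 - N^* N and
  b_n are the Taylor coefficients of (1-x)^(-1/2), it is the strong limit of the sums of b_n N D^n. All
  numbers <N D^i f, N D^j f> are non-negative and depend on i+j only, hence the squared norms of the partial
  sums increase, and the increments control the distances.
*)

theory Submission
  imports Defs "HOL-Complex_Analysis.Great_Picard"
begin

section \<open>The space \<open>L\<^sup>2\<close> of representatives\<close>

text \<open>Both kernels \<open>k\<close> behave like 1/s at 0, so neither Gram operator has a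
  smooth kernel; since the two factorizations share the same \<open>v\<close>, both operators act in
  one space and the singular parts cancel. As \<open>v\<close> vanishes beyond \<open>R\<close>,
  only s = x + y in [0, 2R] matters. Expanding around the right endpoint S = 2R keeps every term
  non-negative, and the error, which is computable at s = 0, gives the ratio S / (1 + S). Schur
  weights: on (0, infinity) it is l powr (-1/2), for which the Carleman kernel integral is explicit.
  On the other side it is the image of that weight under the kernel with \<open>v\<close> replaced
  by its upper bound \<open>V\<close>, which makes one Schur inequality immediate and turns the
  other into the Carleman integral. For the partial isometry, the coefficients b_n convolved with
  themselves give 1. Double sums over triangles i + j <= n therefore telescope, and squares lie
  between two triangles, which pins the limit of the squared norms. It equals the squared norm of f
  when the moments of 1 - N^* N at f tend to 0, as they do for f orthogonal to the kernel. Running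
  the construction for the adjoint gives surjectivity.\<close>

lemma L2_measurable [measurable_dest]: "f \<in> L2 M \<Longrightarrow> f \<in> borel_measurable M"
  by (simp add: L2_def)

lemma L2_integrable_sq: "f \<in> L2 M \<Longrightarrow> integrable M (\<lambda>x. (cmod (f x))\<^sup>2)"
  by (simp add: L2_def)

lemma L2_iff_nn:
  "f \<in> L2 M \<longleftrightarrow> f \<in> borel_measurable M \<and> (\<integral>\<^sup>+x. ennreal ((cmod (f x))\<^sup>2) \<partial>M) < \<infinity>"
  unfolding L2_def by (auto simp: integrable_iff_bounded)

lemma L2_norm_nonneg [simp]: "0 \<le> L2_norm M f"
  by (simp add: L2_norm_def)

lemma L2_norm_sq: "(L2_norm M f)\<^sup>2 = (LINT x|M. (cmod (f x))\<^sup>2)"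
  by (simp add: L2_norm_def)

lemma L2_norm_nn:
  "f \<in> L2 M \<Longrightarrow> ennreal ((L2_norm M f)\<^sup>2) = (\<integral>\<^sup>+x. ennreal ((cmod (f x))\<^sup>2) \<partial>M)"
  by (simp add: L2_norm_sq L2_integrable_sq nn_integral_eq_integral)

lemma L2_norm_le_nn:
  assumes "f \<in> borel_measurable M" "(\<integral>\<^sup>+x. ennreal ((cmod (f x))\<^sup>2) \<partial>M) \<le> ennreal (c\<^sup>2)" "0 \<le> c"
  shows "f \<in> L2 M" "L2_norm M f \<le> c"
proof -
  show *: "f \<in> L2 M"
    using assms by (auto simp: L2_iff_nn intro: le_less_trans)
  have "ennreal ((L2_norm M f)\<^sup>2) \<le> ennreal (c\<^sup>2)"
    using assms(2) by (simp add: L2_norm_nn[OF *])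
  then have "(L2_norm M f)\<^sup>2 \<le> c\<^sup>2" by simp
  then show "L2_norm M f \<le> c" using assms(3) by (rule power2_le_imp_le)
qed

lemma L2_prod_integrable:
  assumes [measurable_dest]: "f \<in> L2 M" "g \<in> L2 M"
  shows "integrable M (\<lambda>x. f x * g x)"
proof (rule Bochner_Integration.integrable_bound)
  show "integrable M (\<lambda>x. (cmod (f x))\<^sup>2 + (cmod (g x))\<^sup>2)"
    using assms by (intro Bochner_Integration.integrable_add L2_integrable_sq)
  have [measurable]: "f \<in> borel_measurable M" "g \<in> borel_measurable M"
    using assms by (auto simp: L2_def)
  show "(\<lambda>x. f x * g x) \<in> borel_measurable M" by measurable
  have "cmod (f x * g x) \<le> (cmod (f x))\<^sup>2 + (cmod (g x))\<^sup>2" for x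
  proof -
    have "0 \<le> cmod (f x) * cmod (g x)" by simp
    moreover have "2 * (cmod (f x) * cmod (g x)) \<le> (cmod (f x))\<^sup>2 + (cmod (g x))\<^sup>2"
      using sum_squares_bound[of "cmod (f x)" "cmod (g x)"] by (simp add: mult.assoc)
    ultimately show ?thesis unfolding norm_mult by linarith
  qed
  then show "AE x in M. cmod (f x * g x) \<le> norm ((cmod (f x))\<^sup>2 + (cmod (g x))\<^sup>2)"
    by auto
qed

lemma borel_measurable_cnj [measurable]:
  "f \<in> borel_measurable M \<Longrightarrow> (\<lambda>x. cnj (f x)) \<in> borel_measurable M"
  by (rule borel_measurable_continuous_on[of cnj]) (auto intro: continuous_intros)

lemma L2_cnj: "f \<in> L2 M \<Longrightarrow> (\<lambda>x. cnj (f x)) \<in> L2 M"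
  by (auto simp: L2_def intro: borel_measurable_cnj)

lemma L2_inner_integrable:
  "f \<in> L2 M \<Longrightarrow> g \<in> L2 M \<Longrightarrow> integrable M (\<lambda>x. f x * cnj (g x))"
  by (intro L2_prod_integrable L2_cnj)

lemma L2_lincomb [intro]:
  assumes "f \<in> L2 M" "g \<in> L2 M"
  shows "(\<lambda>x. c * f x + d * g x) \<in> L2 M"
proof -
  have [measurable]: "f \<in> borel_measurable M" "g \<in> borel_measurable M"
    using assms by (auto simp: L2_def)
  have "integrable M (\<lambda>x. (cmod (c * f x + d * g x))\<^sup>2)"
  proof (rule Bochner_Integration.integrable_bound)
    show "integrable M (\<lambda>x. 2 * ((cmod c)\<^sup>2 * (cmod (f x))\<^sup>2) + 2 * ((cmod d)\<^sup>2 * (cmod (g x))\<^sup>2))"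
      using assms by (intro Bochner_Integration.integrable_add integrable_mult_right L2_integrable_sq)
    have "(cmod (c * f x + d * g x))\<^sup>2
        \<le> 2 * ((cmod c)\<^sup>2 * (cmod (f x))\<^sup>2) + 2 * ((cmod d)\<^sup>2 * (cmod (g x))\<^sup>2)" for x
    proof -
      have "(cmod (c * f x + d * g x))\<^sup>2 \<le> (cmod (c * f x) + cmod (d * g x))\<^sup>2"
        by (intro power_mono norm_triangle_ineq) auto
      also have "\<dots> \<le> 2 * (cmod (c * f x))\<^sup>2 + 2 * (cmod (d * g x))\<^sup>2"
        using sum_squares_bound[of "cmod (c * f x)" "cmod (d * g x)"]
        unfolding power2_sum by linarith
      finally show ?thesis by (simp add: norm_mult power_mult_distrib)
    qed
    then show "AE x in M. norm ((cmod (c * f x + d * g x))\<^sup>2)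
        \<le> norm (2 * ((cmod c)\<^sup>2 * (cmod (f x))\<^sup>2) + 2 * ((cmod d)\<^sup>2 * (cmod (g x))\<^sup>2))"
      by (intro AE_I2) (auto intro: order_trans[OF _ abs_ge_self])
  qed measurable
  then show ?thesis by (simp add: L2_def)
qed

lemma L2_scale [intro]: "f \<in> L2 M \<Longrightarrow> (\<lambda>x. c * f x) \<in> L2 M"
  using L2_lincomb[of f M f c 0] by simp

lemma L2_add [intro]: "f \<in> L2 M \<Longrightarrow> g \<in> L2 M \<Longrightarrow> (\<lambda>x. f x + g x) \<in> L2 M"
  using L2_lincomb[of f M g 1 1] by simp

lemma L2_diff [intro]: "f \<in> L2 M \<Longrightarrow> g \<in> L2 M \<Longrightarrow> (\<lambda>x. f x - g x) \<in> L2 M"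
  using L2_lincomb[of f M g 1 "-1"] by simp

lemma L2_zero [intro, simp]: "(\<lambda>x. 0) \<in> L2 M"
  by (simp add: L2_def)

lemma L2_sum [intro]:
  assumes "\<And>i. i \<in> I \<Longrightarrow> f i \<in> L2 M"
  shows "(\<lambda>x. \<Sum>i\<in>I. c i * f i x) \<in> L2 M"
  using assms
proof (induction I rule: infinite_finite_induct)
  case (insert i I)
  then show ?case
    using L2_lincomb[of "f i" M "\<lambda>x. \<Sum>i\<in>I. c i * f i x" "c i" 1] by simp
qed simp_all

lemma L2_inner_lincomb:
  assumes "f \<in> L2 M" "g \<in> L2 M" "h \<in> L2 M"
  shows "L2_inner M (\<lambda>x. c * f x + d * g x) h = c * L2_inner M f h + d * L2_inner M g h"
proof -
  have "L2_inner M (\<lambda>x. c * f x + d * g x) h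
      = (LINT x|M. c * (f x * cnj (h x)) + d * (g x * cnj (h x)))"
    unfolding L2_inner_def by (intro Bochner_Integration.integral_cong) (auto simp: algebra_simps)
  also have "\<dots> = c * L2_inner M f h + d * L2_inner M g h"
    unfolding L2_inner_def using assms
    by (subst Bochner_Integration.integral_add) (auto intro!: L2_inner_integrable integrable_mult_right)
  finally show ?thesis .
qed

lemma L2_inner_commute: "L2_inner M g f = cnj (L2_inner M f g)"
  unfolding L2_inner_def
  using Bochner_Integration.integral_cnj[of M "\<lambda>x. f x * cnj (g x)"] by (simp add: mult.commute)

lemma L2_inner_lincomb_right:
  assumes "f \<in> L2 M" "g \<in> L2 M" "h \<in> L2 M"
  shows "L2_inner M h (\<lambda>x. c * f x + d * g x) = cnj c * L2_inner M h f + cnj d * L2_inner M h g"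
  by (subst L2_inner_commute)
     (simp add: L2_inner_lincomb assms L2_inner_commute[of M h])

lemma L2_inner_zero [simp]: "L2_inner M (\<lambda>x. 0) f = 0" "L2_inner M f (\<lambda>x. 0) = 0"
  by (simp_all add: L2_inner_def)

lemma L2_inner_diff:
  assumes "f \<in> L2 M" "g \<in> L2 M" "h \<in> L2 M"
  shows "L2_inner M (\<lambda>x. f x - g x) h = L2_inner M f h - L2_inner M g h"
    and "L2_inner M h (\<lambda>x. f x - g x) = L2_inner M h f - L2_inner M h g"
  using L2_inner_lincomb[of f M g h 1 "-1"] L2_inner_lincomb_right[of f M g h 1 "-1"] assms
  by simp_all

lemma L2_inner_scale:
  assumes "f \<in> L2 M" "h \<in> L2 M"
  shows "L2_inner M (\<lambda>x. c * f x) h = c * L2_inner M f h"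
    and "L2_inner M h (\<lambda>x. c * f x) = cnj c * L2_inner M h f"
  using L2_inner_lincomb[of f M f h c 0] L2_inner_lincomb_right[of f M f h c 0] assms
  by simp_all

lemma L2_inner_sum:
  assumes "\<And>i. i \<in> I \<Longrightarrow> f i \<in> L2 M" "h \<in> L2 M"
  shows "L2_inner M (\<lambda>x. \<Sum>i\<in>I. c i * f i x) h = (\<Sum>i\<in>I. c i * L2_inner M (f i) h)"
  using assms(1)
proof (induction I rule: infinite_finite_induct)
  case (insert i I)
  have "L2_inner M (\<lambda>x. c i * f i x + 1 * (\<Sum>i\<in>I. c i * f i x)) h
      = c i * L2_inner M (f i) h + 1 * L2_inner M (\<lambda>x. \<Sum>i\<in>I. c i * f i x) h"
    using insert assms(2) by (intro L2_inner_lincomb) auto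
  with insert show ?case by simp
qed simp_all

lemma L2_inner_sum_right:
  assumes "\<And>i. i \<in> I \<Longrightarrow> f i \<in> L2 M" "h \<in> L2 M"
  shows "L2_inner M h (\<lambda>x. \<Sum>i\<in>I. c i * f i x) = (\<Sum>i\<in>I. cnj (c i) * L2_inner M h (f i))"
  by (subst L2_inner_commute)
     (simp add: L2_inner_sum assms L2_inner_commute[of M h])

lemma L2_inner_self: "L2_inner M f f = complex_of_real ((L2_norm M f)\<^sup>2)"
proof -
  have "(LINT x|M. f x * cnj (f x)) = (LINT x|M. complex_of_real ((cmod (f x))\<^sup>2))"
    by (intro Bochner_Integration.integral_cong refl) (simp add: complex_norm_square[symmetric])
  then show ?thesis
    by (simp only: L2_inner_def L2_norm_sq integral_complex_of_real)
qed

lemma L2_norm_cong_AE: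
  assumes "AE x in M. f x = g x" "f \<in> L2 M" "g \<in> L2 M"
  shows "L2_norm M f = L2_norm M g"
proof -
  have [measurable]: "f \<in> borel_measurable M" "g \<in> borel_measurable M"
    using assms by (auto simp: L2_def)
  show ?thesis
    unfolding L2_norm_def using assms(1)
    by (intro arg_cong[where f=sqrt] integral_cong_AE) (measurable, auto)
qed

lemma L2_inner_cong_AE:
  assumes "AE x in M. f x = f' x" "AE x in M. g x = g' x"
    and "f \<in> L2 M" "f' \<in> L2 M" "g \<in> L2 M" "g' \<in> L2 M"
  shows "L2_inner M f g = L2_inner M f' g'"
proof -
  have [measurable]: "f \<in> borel_measurable M" "g \<in> borel_measurable M"
     "f' \<in> borel_measurable M" "g' \<in> borel_measurable M"
    using assms by (auto simp: L2_def)
  show ?thesis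
    unfolding L2_inner_def using assms(1,2)
    by (intro integral_cong_AE) (measurable, auto)
qed

lemma L2_norm_eq_0_iff:
  assumes "f \<in> L2 M"
  shows "L2_norm M f = 0 \<longleftrightarrow> (AE x in M. f x = 0)"
proof -
  have "L2_norm M f = 0 \<longleftrightarrow> (LINT x|M. (cmod (f x))\<^sup>2) = 0"
    by (simp add: L2_norm_def)
  also have "\<dots> \<longleftrightarrow> (AE x in M. (cmod (f x))\<^sup>2 = 0)"
    using assms by (intro integral_nonneg_eq_0_iff_AE L2_integrable_sq) auto
  finally show ?thesis by simp
qed

lemma L2_ext:
  assumes "f \<in> L2 M" "g \<in> L2 M" "\<And>h. h \<in> L2 M \<Longrightarrow> L2_inner M f h = L2_inner M g h"
  shows "AE x in M. f x = g x"
proof -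
  have d: "(\<lambda>x. f x - g x) \<in> L2 M" using assms by auto
  have "L2_inner M (\<lambda>x. f x - g x) (\<lambda>x. f x - g x) = 0"
    using assms(3)[OF d] by (simp add: L2_inner_diff(1)[OF assms(1,2) d])
  then have "L2_norm M (\<lambda>x. f x - g x) = 0"
    by (simp add: L2_inner_self)
  then show ?thesis using L2_norm_eq_0_iff[OF d] by simp
qed

section \<open>Cauchy-Schwarz, triangle inequality, completeness and limits\<close>

lemma L2_Cauchy_Schwarz:
  assumes "f \<in> L2 M" "g \<in> L2 M"
  shows "cmod (L2_inner M f g) \<le> L2_norm M f * L2_norm M g"
proof -
  have [measurable]: "f \<in> borel_measurable M" "g \<in> borel_measurable M"
    using assms by (auto simp: L2_def)
  have "ennreal ((cmod (L2_inner M f g))\<^sup>2) = (ennreal (cmod (L2_inner M f g)))\<^sup>2"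
    by (simp add: ennreal_power)
  also have "\<dots> \<le> (\<integral>\<^sup>+x. ennreal (cmod (f x * cnj (g x))) \<partial>M)\<^sup>2"
    unfolding L2_inner_def using L2_inner_integrable[OF assms]
    by (intro power_mono_ennreal integral_norm_bound_ennreal)
  also have "\<dots> = (\<integral>\<^sup>+x. ennreal (cmod (f x)) * ennreal (cmod (g x)) \<partial>M)\<^sup>2"
    by (simp add: norm_mult ennreal_mult)
  also have "\<dots> \<le> (\<integral>\<^sup>+x. ennreal (cmod (f x)) ^ 2 \<partial>M) * (\<integral>\<^sup>+x. ennreal (cmod (g x)) ^ 2 \<partial>M)"
    by (rule Cauchy_Schwarz_nn_integral) measurable
  also have "\<dots> = ennreal ((L2_norm M f * L2_norm M g)\<^sup>2)"
    by (simp add: ennreal_power L2_norm_nn[OF assms(1), symmetric] L2_norm_nn[OF assms(2), symmetric]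
        ennreal_mult[symmetric] power_mult_distrib)
  finally have "(cmod (L2_inner M f g))\<^sup>2 \<le> (L2_norm M f * L2_norm M g)\<^sup>2" by simp
  then show ?thesis by (rule power2_le_imp_le) simp
qed

lemma L2_norm_scale: "f \<in> L2 M \<Longrightarrow> L2_norm M (\<lambda>x. c * f x) = cmod c * L2_norm M f"
  by (simp add: L2_norm_def norm_mult power_mult_distrib real_sqrt_mult)

lemma L2_norm_triangle:
  assumes "f \<in> L2 M" "g \<in> L2 M"
  shows "L2_norm M (\<lambda>x. f x + g x) \<le> L2_norm M f + L2_norm M g"
proof (rule power2_le_imp_le)
  let ?s = "\<lambda>x. 1 * f x + 1 * g x"
  have "complex_of_real ((L2_norm M ?s)\<^sup>2) = L2_inner M ?s ?s"
    by (simp only: L2_inner_self)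
  also have "\<dots> = L2_inner M f f + L2_inner M f g + L2_inner M g f + L2_inner M g g"
    using assms by (simp only: L2_inner_lincomb L2_inner_lincomb_right L2_lincomb) simp
  also have "\<dots> = complex_of_real ((L2_norm M f)\<^sup>2 + (L2_norm M g)\<^sup>2 + 2 * Re (L2_inner M f g))"
    by (simp add: L2_inner_self L2_inner_commute[of M g f] complex_eq_iff)
  finally have "(L2_norm M ?s)\<^sup>2 = (L2_norm M f)\<^sup>2 + (L2_norm M g)\<^sup>2 + 2 * Re (L2_inner M f g)"
    by (simp only: of_real_eq_iff)
  also have "\<dots> \<le> (L2_norm M f + L2_norm M g)\<^sup>2"
    using order_trans[OF complex_Re_le_cmod L2_Cauchy_Schwarz[OF assms]]
    by (simp add: power2_sum)
  finally show "(L2_norm M (\<lambda>x. f x + g x))\<^sup>2 \<le> (L2_norm M f + L2_norm M g)\<^sup>2" by simp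
qed simp

lemma L2_norm_minus_commute: "L2_norm M (\<lambda>x. f x - g x) = L2_norm M (\<lambda>x. g x - f x)"
  by (simp add: L2_norm_def norm_minus_commute)

lemma L2_norm_triangle_diff:
  assumes "f \<in> L2 M" "g \<in> L2 M" "h \<in> L2 M"
  shows "L2_norm M (\<lambda>x. f x - h x) \<le> L2_norm M (\<lambda>x. f x - g x) + L2_norm M (\<lambda>x. g x - h x)"
  using L2_norm_triangle[of "\<lambda>x. f x - g x" M "\<lambda>x. g x - h x"] assms by (simp add: L2_diff)

text \<open>Riesz-Fischer: a fast subsequence converges almost everywhere, and Fatou's lemma
  transfers the Cauchy estimate to the pointwise limit.\<close>

lemma L2_complete:
  fixes u :: "nat \<Rightarrow> 'a \<Rightarrow> complex"
  assumes u: "\<And>n. u n \<in> L2 M"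
    and Cau: "\<And>e. e > 0 \<Longrightarrow> \<exists>N. \<forall>m\<ge>N. \<forall>n\<ge>N. L2_norm M (\<lambda>x. u m x - u n x) < e"
  shows "\<exists>f\<in>L2 M. (\<lambda>n. L2_norm M (\<lambda>x. u n x - f x)) \<longlonglongrightarrow> 0"
proof -
  have um [measurable]: "u n \<in> borel_measurable M" for n using u by (auto simp: L2_def)
  have "\<exists>N. \<forall>m\<ge>N. \<forall>n\<ge>N. L2_norm M (\<lambda>x. u m x - u n x) < (1/2)^k" for k
    using Cau by simp
  then obtain N where N: "\<And>k m n. m \<ge> N k \<Longrightarrow> n \<ge> N k \<Longrightarrow> L2_norm M (\<lambda>x. u m x - u n x) < (1/2)^k"
    by metis
  \<comment> \<open>Adding \<open>k\<close> makes \<open>r\<close> strictly increasing; summing all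
    earlier thresholds makes it exceed each \<open>N k\<close>.\<close>
  define r where "r k = k + (\<Sum>i\<le>k. N i)" for k
  have rN: "N k \<le> r k" for k
    unfolding r_def by (rule trans_le_add2) (rule member_le_sum, auto)
  have rmono: "r k < r (Suc k)" for k by (simp add: r_def)
  have rs: "strict_mono r" by (rule strict_monoI_Suc) (rule rmono)
  define d where "d k x = cmod (u (r (Suc k)) x - u (r k) x)" for k x
  have dL: "L2_norm M (\<lambda>x. u (r (Suc k)) x - u (r k) x) < (1/2)^k" for k
    using rN[of k] rmono[of k] by (intro N) auto
  have [measurable]: "d k \<in> borel_measurable M" for k unfolding d_def by measurable
  \<comment> \<open>The increments have squared norm below 4^(-k), so the weight 2^k still leaves a
    convergent series. It is needed below, where 2 d <= 2^(-k) + 2^k d^2 yields pointwise absolute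
    convergence.\<close>
  have "(\<integral>\<^sup>+x. (\<Sum>k. ennreal (2^k * (d k x)\<^sup>2)) \<partial>M) = (\<Sum>k. \<integral>\<^sup>+x. ennreal (2^k * (d k x)\<^sup>2) \<partial>M)"
    by (rule nn_integral_suminf) measurable
  also have "\<dots> \<le> (\<Sum>k. ennreal ((1/2)^k))"
  proof (rule suminf_le)
    fix k
    have "(\<integral>\<^sup>+x. ennreal (2^k * (d k x)\<^sup>2) \<partial>M) = ennreal (2^k) * (\<integral>\<^sup>+x. ennreal ((d k x)\<^sup>2) \<partial>M)"
      by (simp add: ennreal_mult nn_integral_cmult)
    also have "\<dots> = ennreal (2^k) * ennreal ((L2_norm M (\<lambda>x. u (r (Suc k)) x - u (r k) x))\<^sup>2)"
      unfolding d_def by (subst L2_norm_nn) (use u in auto)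
    also have "\<dots> \<le> ennreal (2^k) * ennreal (((1/2)^k)\<^sup>2)"
      using dL[of k] by (intro mult_left_mono ennreal_leI power_mono) auto
    also have "\<dots> = ennreal ((1/2)^k)"
      by (simp add: ennreal_mult[symmetric] power2_eq_square power_mult_distrib[symmetric] field_simps)
    finally show "(\<integral>\<^sup>+x. ennreal (2^k * (d k x)\<^sup>2) \<partial>M) \<le> ennreal ((1/2)^k)" .
  qed auto
  also have "\<dots> < \<infinity>"
    by (subst suminf_ennreal2) (auto intro: summable_geometric)
  finally have "AE x in M. (\<Sum>k. ennreal (2^k * (d k x)\<^sup>2)) \<noteq> \<infinity>"
    by (intro nn_integral_PInf_AE) auto
  moreover have "Cauchy (\<lambda>k. u (r k) x)" if "(\<Sum>k. ennreal (2^k * (d k x)\<^sup>2)) \<noteq> \<infinity>" for x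
  proof -
    have s: "summable (\<lambda>k. 2^k * (d k x)\<^sup>2)"
      using that by (intro summable_suminf_not_top) auto
    have "summable (\<lambda>k. d k x)"
    proof (rule summable_comparison_test')
      show "summable (\<lambda>k. (1/2)^k + 2^k * (d k x)\<^sup>2)"
        using s by (intro summable_add summable_geometric) auto
      fix k
      have "2 * (d k x) \<le> (1/2)^k + 2^k * (d k x)\<^sup>2"
      proof -
        have "sqrt ((1/2)^k) * sqrt (2^k) = 1"
          by (simp add: real_sqrt_mult[symmetric] power_mult_distrib[symmetric])
        then have "2 * sqrt ((1/2)^k) * (sqrt (2^k) * d k x) = 2 * d k x"
          by (metis mult.assoc mult.left_neutral)
        from sum_squares_bound[of "sqrt ((1/2)^k)" "sqrt (2^k) * d k x", unfolded this]
        show ?thesis by (simp add: power_mult_distrib)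
      qed
      moreover have "0 \<le> d k x" by (simp add: d_def)
      ultimately show "norm (d k x) \<le> (1/2)^k + 2^k * (d k x)\<^sup>2" by simp
    qed
    then have "summable (\<lambda>k. u (r (Suc k)) x - u (r k) x)"
      unfolding d_def by (rule summable_norm_cancel)
    then have "convergent (\<lambda>n. u (r 0) x + (\<Sum>k<n. u (r (Suc k)) x - u (r k) x))"
      by (intro convergent_add convergent_const) (simp add: summable_iff_convergent)
    then have "convergent (\<lambda>n. u (r n) x)"
      using sum_lessThan_telescope[of "\<lambda>k. u (r k) x"] by simp
    then show ?thesis by (rule convergent_Cauchy)
  qed
  ultimately have conv: "AE x in M. convergent (\<lambda>k. u (r k) x)"
    by (auto simp: Cauchy_convergent_iff)
  define f where "f x = lim (\<lambda>k. u (r k) x)" for x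
  have [measurable]: "f \<in> borel_measurable M"
    unfolding f_def by measurable
  \<comment> \<open>Fatou along the subsequence, with the index \<open>m\<close> kept fixed.\<close>
  have bd: "(\<integral>\<^sup>+x. ennreal ((cmod (u m x - f x))\<^sup>2) \<partial>M) \<le> ennreal (e\<^sup>2)"
    if "0 < e" "\<forall>l\<ge>L. \<forall>n\<ge>L. L2_norm M (\<lambda>x. u l x - u n x) < e" "m \<ge> L" for e L m
  proof -
    have "(\<integral>\<^sup>+x. ennreal ((cmod (u m x - f x))\<^sup>2) \<partial>M)
        = (\<integral>\<^sup>+x. liminf (\<lambda>k. ennreal ((cmod (u m x - u (r k) x))\<^sup>2)) \<partial>M)"
    proof (rule nn_integral_cong_AE, use conv in eventually_elim)
      case (elim x)
      then have "(\<lambda>k. u (r k) x) \<longlonglongrightarrow> f x" by (simp add: f_def convergent_LIMSEQ_iff)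
      then have "(\<lambda>k. ennreal ((cmod (u m x - u (r k) x))\<^sup>2)) \<longlonglongrightarrow> ennreal ((cmod (u m x - f x))\<^sup>2)"
        by (intro tendsto_ennrealI tendsto_intros)
      then show ?case by (intro lim_imp_Liminf[symmetric]) auto
    qed
    also have "\<dots> \<le> liminf (\<lambda>k. \<integral>\<^sup>+x. ennreal ((cmod (u m x - u (r k) x))\<^sup>2) \<partial>M)"
      by (rule nn_integral_liminf) measurable
    also have "\<dots> \<le> limsup (\<lambda>k. \<integral>\<^sup>+x. ennreal ((cmod (u m x - u (r k) x))\<^sup>2) \<partial>M)"
      by (rule Liminf_le_Limsup) auto
    also have "\<dots> \<le> ennreal (e\<^sup>2)"
    proof (rule Limsup_bounded)
      have "\<forall>\<^sub>F k in sequentially. r k \<ge> L"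
        using filterlim_subseq[OF rs] by (auto simp: filterlim_at_top)
      then show "\<forall>\<^sub>F k in sequentially. (\<integral>\<^sup>+x. ennreal ((cmod (u m x - u (r k) x))\<^sup>2) \<partial>M) \<le> ennreal (e\<^sup>2)"
      proof eventually_elim
        case (elim k)
        have "ennreal ((L2_norm M (\<lambda>x. u m x - u (r k) x))\<^sup>2) \<le> ennreal (e\<^sup>2)"
          using that elim by (intro ennreal_leI power_mono) (auto intro: less_imp_le)
        then show ?case by (subst (asm) L2_norm_nn) (use u in auto)
      qed
    qed
    finally show ?thesis .
  qed
  have key: "(\<lambda>x. u m x - f x) \<in> L2 M \<and> L2_norm M (\<lambda>x. u m x - f x) \<le> e"
    if "0 < e" "\<forall>l\<ge>L. \<forall>n\<ge>L. L2_norm M (\<lambda>x. u l x - u n x) < e" "m \<ge> L" for e L m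
    using L2_norm_le_nn[OF _ bd[OF that]] that(1) by auto
  obtain L where L: "\<forall>l\<ge>L. \<forall>n\<ge>L. L2_norm M (\<lambda>x. u l x - u n x) < 1" using Cau[of 1] by auto
  have "f \<in> L2 M"
    using L2_diff[OF u[of L] conjunct1[OF key[OF zero_less_one L order_refl]]] by simp
  moreover have "(\<lambda>n. L2_norm M (\<lambda>x. u n x - f x)) \<longlonglongrightarrow> 0"
  proof (rule LIMSEQ_I)
    fix e :: real assume "0 < e"
    then obtain L where "\<forall>l\<ge>L. \<forall>n\<ge>L. L2_norm M (\<lambda>x. u l x - u n x) < e/2" using Cau[of "e/2"] by auto
    from key[OF _ this] \<open>0 < e\<close> show "\<exists>L. \<forall>n\<ge>L. norm (L2_norm M (\<lambda>x. u n x - f x) - 0) < e"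
      by (intro exI[of _ L]) fastforce
  qed
  ultimately show ?thesis by blast
qed

lemma L2_inner_tendsto:
  assumes "\<And>n. u n \<in> L2 M" "f \<in> L2 M" "(\<lambda>n. L2_norm M (\<lambda>x. u n x - f x)) \<longlonglongrightarrow> 0" "h \<in> L2 M"
  shows "(\<lambda>n. L2_inner M (u n) h) \<longlonglongrightarrow> L2_inner M f h"
proof (rule LIM_zero_cancel, rule Lim_null_comparison)
  show "\<forall>\<^sub>F n in sequentially. norm (L2_inner M (u n) h - L2_inner M f h)
      \<le> L2_norm M (\<lambda>x. u n x - f x) * L2_norm M h"
    using assms by (auto simp: L2_inner_diff(1)[symmetric] intro!: always_eventually L2_Cauchy_Schwarz)
  show "(\<lambda>n. L2_norm M (\<lambda>x. u n x - f x) * L2_norm M h) \<longlonglongrightarrow> 0"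
    using tendsto_mult_right[OF assms(3), of "L2_norm M h"] by simp
qed

lemma L2_norm_tendsto:
  assumes "\<And>n. u n \<in> L2 M" "f \<in> L2 M" "(\<lambda>n. L2_norm M (\<lambda>x. u n x - f x)) \<longlonglongrightarrow> 0"
  shows "(\<lambda>n. L2_norm M (u n)) \<longlonglongrightarrow> L2_norm M f"
proof (rule LIM_zero_cancel, rule Lim_null_comparison[OF _ assms(3)])
  have "\<bar>L2_norm M (u n) - L2_norm M f\<bar> \<le> L2_norm M (\<lambda>x. u n x - f x)" for n
    using L2_norm_triangle_diff[OF assms(1,2) L2_zero, of n]
      L2_norm_triangle_diff[OF assms(2) assms(1)[of n] L2_zero]
      L2_norm_minus_commute[of M f "u n"] by simp
  then show "\<forall>\<^sub>F n in sequentially. norm (L2_norm M (u n) - L2_norm M f) \<le> L2_norm M (\<lambda>x. u n x - f x)"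
    by simp
qed

section \<open>Polar decomposition of a contraction\<close>

text \<open>The coefficient of x^n in (1 - x)^(-1/2), that is, the central binomial coefficient
  divided by 4^n.\<close>

definition isqrt_coeff :: "nat \<Rightarrow> real" where
  "isqrt_coeff n = pochhammer (1/2) n / fact n"

lemma isqrt_coeff_nonneg: "0 \<le> isqrt_coeff n"
  by (simp add: isqrt_coeff_def pochhammer_nonneg)

text \<open>The coefficient form of ((1 - x)^(-1/2))^2 = 1 / (1 - x), obtained from Vandermonde's
  identity with both upper arguments equal to -1/2.\<close>

lemma isqrt_coeff_convolution: "(\<Sum>i\<le>k. isqrt_coeff i * isqrt_coeff (k - i)) = 1"
proof -
  have eq: "isqrt_coeff n = (-1)^n * ((-1/2) gchoose n)" for n
    by (simp add: isqrt_coeff_def gbinomial_pochhammer)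
  have "(\<Sum>i\<le>k. isqrt_coeff i * isqrt_coeff (k - i))
      = (\<Sum>i\<le>k. (-1)^k * (((-1/2) gchoose i) * ((-1/2) gchoose (k - i))))"
  proof (intro sum.cong refl)
    fix i assume "i \<in> {..k}"
    then have k: "i + (k - i) = k" by simp
    have "isqrt_coeff i * isqrt_coeff (k - i)
        = ((-1)^i * (-1)^(k - i)) * (((-1/2) gchoose i) * ((-1/2) gchoose (k - i)))"
      by (simp only: eq mult_ac)
    also have "(-1)^i * (-1)^(k - i) = ((-1)^(i + (k - i)) :: real)" by (simp only: power_add)
    finally show "isqrt_coeff i * isqrt_coeff (k - i)
        = (-1)^k * (((-1/2) gchoose i) * ((-1/2) gchoose (k - i)))"
      unfolding k .
  qed
  also have "\<dots> = (-1)^k * (\<Sum>i=0..k. ((-1/2) gchoose i) * ((-1/2) gchoose (k - i)))"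
    by (simp add: sum_distrib_left atMost_atLeast0)
  also have "\<dots> = (-1)^k * ((-1) gchoose k :: real)"
    by (simp add: gbinomial_Vandermonde)
  also have "((-1) gchoose k :: real) = (-1)^k"
    using gbinomial_pochhammer[of "-1 :: real" k]
    unfolding minus_minus pochhammer_fact[of k, symmetric] by simp
  finally show ?thesis by (simp add: power_add[symmetric])
qed

text \<open>The terms are non-negative and the square of side \<open>m\<close> lies between the
  triangles i + j <= m and i + j <= 2m. On a triangle the convolution identity collapses the sum to
  a telescoping one.\<close>

lemma isqrt_double_sum_bounds:
  fixes \<mu> :: "nat \<Rightarrow> real"
  assumes "\<And>n. \<mu> (Suc n) \<le> \<mu> n" "\<And>n. 0 \<le> \<mu> n"
  shows "(\<Sum>i\<le>m. \<Sum>j\<le>m. isqrt_coeff i * isqrt_coeff j * (\<mu> (i+j) - \<mu> (Suc (i+j)))) \<le> \<mu> 0"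
    and "\<mu> 0 - \<mu> (Suc m) \<le> (\<Sum>i\<le>m. \<Sum>j\<le>m. isqrt_coeff i * isqrt_coeff j * (\<mu> (i+j) - \<mu> (Suc (i+j))))"
proof -
  let ?g = "\<lambda>i j. isqrt_coeff i * isqrt_coeff j * (\<mu> (i+j) - \<mu> (Suc (i+j)))"
  have nn: "0 \<le> ?g i j" for i j using assms(1)[of "i+j"] by (simp add: isqrt_coeff_nonneg)
  have tri: "(\<Sum>(i,j)\<in>{(i,j). i+j \<le> n}. ?g i j) = \<mu> 0 - \<mu> (Suc n)" for n
  proof -
    have "(\<Sum>(i,j)\<in>{(i,j). i+j \<le> n}. ?g i j) = (\<Sum>k\<le>n. \<Sum>i\<le>k. ?g i (k - i))"
      by (rule sum.triangle_reindex_eq)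
    also have "\<dots> = (\<Sum>k\<le>n. (\<Sum>i\<le>k. isqrt_coeff i * isqrt_coeff (k - i)) * (\<mu> k - \<mu> (Suc k)))"
      by (intro sum.cong refl) (simp add: sum_distrib_right)
    also have "\<dots> = (\<Sum>k\<le>n. \<mu> k - \<mu> (Suc k))"
      by (simp add: isqrt_coeff_convolution)
    also have "\<dots> = \<mu> 0 - \<mu> (Suc n)" by (induction n) auto
    finally show ?thesis .
  qed
  have sq: "(\<Sum>i\<le>m. \<Sum>j\<le>m. ?g i j) = (\<Sum>(i,j)\<in>{..m}\<times>{..m}. ?g i j)"
    by (simp add: sum.cartesian_product)
  have fin: "finite {(i,j). i+j \<le> n}" for n :: nat
    by (rule finite_subset[of _ "{..n}\<times>{..n}"]) auto
  have "(\<Sum>(i,j)\<in>{..m}\<times>{..m}. ?g i j) \<le> (\<Sum>(i,j)\<in>{(i,j). i+j \<le> 2*m}. ?g i j)"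
    using nn by (intro sum_mono2 fin) auto
  then show "(\<Sum>i\<le>m. \<Sum>j\<le>m. ?g i j) \<le> \<mu> 0"
    unfolding sq tri using assms(2)[of "Suc (2*m)"] by simp
  have "(\<Sum>(i,j)\<in>{(i,j). i+j \<le> m}. ?g i j) \<le> (\<Sum>(i,j)\<in>{..m}\<times>{..m}. ?g i j)"
    using nn by (intro sum_mono2) auto
  then show "\<mu> 0 - \<mu> (Suc m) \<le> (\<Sum>i\<le>m. \<Sum>j\<le>m. ?g i j)"
    unfolding sq tri .
qed

text \<open>The adjoint is part of the data, so no existence theorem for adjoints is invoked.
  Linearity up to null sets is contained in \<open>adj\<close>.\<close>

locale L2_contraction_pair =
  fixes M1 :: "'a measure" and M2 :: "'b measure"
    and N :: "('a \<Rightarrow> complex) \<Rightarrow> 'b \<Rightarrow> complex" and Ns :: "('b \<Rightarrow> complex) \<Rightarrow> 'a \<Rightarrow> complex"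
  assumes N_L2: "\<And>f. f \<in> L2 M1 \<Longrightarrow> N f \<in> L2 M2"
    and Ns_L2: "\<And>g. g \<in> L2 M2 \<Longrightarrow> Ns g \<in> L2 M1"
    and adj: "\<And>f g. f \<in> L2 M1 \<Longrightarrow> g \<in> L2 M2 \<Longrightarrow> L2_inner M2 (N f) g = L2_inner M1 f (Ns g)"
    and contr: "\<And>f. f \<in> L2 M1 \<Longrightarrow> L2_norm M2 (N f) \<le> L2_norm M1 f"
begin

lemma adj': "f \<in> L2 M1 \<Longrightarrow> g \<in> L2 M2 \<Longrightarrow> L2_inner M2 g (N f) = L2_inner M1 (Ns g) f"
  by (metis L2_inner_commute adj)

text \<open>The contraction bound passes to the adjoint by |Ns g|^2 = <N (Ns g), g> <= |Ns g| |g|.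
  Hence everything proved for \<open>N\<close> also holds for \<open>Ns\<close>.\<close>

lemma flip: "L2_contraction_pair M2 M1 Ns N"
proof
  fix g assume g: "g \<in> L2 M2"
  have "(L2_norm M1 (Ns g))\<^sup>2 = cmod (L2_inner M1 (Ns g) (Ns g))"
    by (simp add: L2_inner_self norm_power)
  also have "\<dots> = cmod (L2_inner M2 (N (Ns g)) g)"
    by (simp add: adj g Ns_L2)
  also have "\<dots> \<le> L2_norm M1 (Ns g) * L2_norm M2 g"
    using L2_Cauchy_Schwarz[OF N_L2[OF Ns_L2[OF g]] g] contr[OF Ns_L2[OF g]]
      mult_right_mono[OF contr[OF Ns_L2[OF g]], of "L2_norm M2 g"] by simp
  finally have "L2_norm M1 (Ns g) * L2_norm M1 (Ns g) \<le> L2_norm M1 (Ns g) * L2_norm M2 g"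
    by (simp add: power2_eq_square)
  then show "L2_norm M1 (Ns g) \<le> L2_norm M2 g"
    using L2_norm_nonneg[of M1 "Ns g"] L2_norm_nonneg[of M2 g] by (smt (verit) mult_le_cancel_left)
qed (simp_all add: N_L2 Ns_L2 adj')

definition D :: "('a \<Rightarrow> complex) \<Rightarrow> 'a \<Rightarrow> complex" where
  "D f = (\<lambda>x. f x - Ns (N f) x)"

abbreviation F :: "nat \<Rightarrow> ('a \<Rightarrow> complex) \<Rightarrow> 'a \<Rightarrow> complex" where
  "F n \<equiv> D ^^ n"

text \<open>Indexing by a set lets one norm formula cover both the partial sums and their
  differences.\<close>

definition W :: "nat set \<Rightarrow> ('a \<Rightarrow> complex) \<Rightarrow> 'b \<Rightarrow> complex" where
  "W I f = (\<lambda>x. \<Sum>n\<in>I. complex_of_real (isqrt_coeff n) * N (F n f) x)"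

text \<open>Formally N (N^* N)^(-1/2). The limit is unique only up to null sets, whence the
  choice.\<close>

definition U :: "('a \<Rightarrow> complex) \<Rightarrow> 'b \<Rightarrow> complex" where
  "U f = (SOME u. u \<in> L2 M2 \<and> (\<lambda>m. L2_norm M2 (\<lambda>x. W {..m} f x - u x)) \<longlonglongrightarrow> 0)"

section \<open>Moments of D and convergence of the series for U\<close>

lemma D_L2: "f \<in> L2 M1 \<Longrightarrow> D f \<in> L2 M1"
  unfolding D_def by (intro L2_diff Ns_L2 N_L2)

lemma F_L2: "f \<in> L2 M1 \<Longrightarrow> F n f \<in> L2 M1"
  by (induction n) (auto intro: D_L2)

lemma W_L2: "f \<in> L2 M1 \<Longrightarrow> W I f \<in> L2 M2"
  unfolding W_def by (intro L2_sum N_L2 F_L2)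

lemma D_inner:
  assumes "f \<in> L2 M1" "g \<in> L2 M1"
  shows "L2_inner M1 (D f) g = L2_inner M1 f g - L2_inner M2 (N f) (N g)"
    and "L2_inner M1 f (D g) = L2_inner M1 f g - L2_inner M2 (N f) (N g)"
  unfolding D_def using assms by (simp_all add: L2_inner_diff N_L2 Ns_L2 adj adj'[symmetric])

lemma F_inner:
  assumes "f \<in> L2 M1" "g \<in> L2 M1"
  shows "L2_inner M1 (F n f) g = L2_inner M1 f (F n g)"
  using assms(2)
proof (induction n arbitrary: g)
  case (Suc n)
  then have "L2_inner M1 (F (Suc n) f) g = L2_inner M1 (F n f) (D g)"
    using assms(1) by (simp add: D_inner F_L2)
  also have "\<dots> = L2_inner M1 f (F n (D g))" using Suc by (simp add: D_L2)
  finally show ?case by (simp add: funpow_swap1)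
qed simp

text \<open>\<open>Ns\<close> after \<open>N\<close> is 1 - D, and \<open>D\<close> is symmetric, so
  all powers of \<open>D\<close> can be moved to one side.\<close>

lemma NF_inner:
  assumes "f \<in> L2 M1" "g \<in> L2 M1"
  shows "L2_inner M2 (N (F i f)) (N (F j g))
    = L2_inner M1 (F (i + j) f) g - L2_inner M1 (F (Suc (i + j)) f) g"
proof -
  have "L2_inner M2 (N (F i f)) (N (F j g))
      = L2_inner M1 (F i f) (F j g) - L2_inner M1 (D (F i f)) (F j g)"
    using assms by (simp add: D_inner F_L2)
  also have "L2_inner M1 (F i f) (F j g) = L2_inner M1 (F (i + j) f) g"
    using assms by (simp add: F_inner[symmetric] F_L2 funpow_add[of j i] add.commute[of i])
  also have "L2_inner M1 (D (F i f)) (F j g) = L2_inner M1 (F (Suc (i + j)) f) g"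
    using assms F_inner[of "D (F i f)" g j, symmetric] funpow_add[of j "Suc i" D]
    by (simp add: D_L2 F_L2 add.commute[of i])
  finally show ?thesis .
qed

text \<open>The moments of the spectral measure of \<open>D\<close> at \<open>f\<close>. They
  replace functional calculus: of 0 <= D <= 1 only their sign and monotonicity are used.\<close>

definition \<mu> :: "('a \<Rightarrow> complex) \<Rightarrow> nat \<Rightarrow> real" where
  "\<mu> f n = Re (L2_inner M1 (F n f) f)"

lemma \<mu>_even: "f \<in> L2 M1 \<Longrightarrow> \<mu> f (i + i) = (L2_norm M1 (F i f))\<^sup>2"
  using F_inner[of "F i f" f i] by (simp add: \<mu>_def funpow_add F_L2 L2_inner_self)

lemma \<mu>_diff_inner:
  assumes "f \<in> L2 M1"
  shows "Re (L2_inner M2 (N (F i f)) (N (F j f))) = \<mu> f (i + j) - \<mu> f (Suc (i + j))"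
  using assms by (simp add: NF_inner \<mu>_def)

lemma \<mu>_odd:
  assumes f: "f \<in> L2 M1"
  shows "\<mu> f (Suc (i + i)) = (L2_norm M1 (F i f))\<^sup>2 - (L2_norm M2 (N (F i f)))\<^sup>2"
  using \<mu>_diff_inner[OF f, of i i] \<mu>_even[OF f, of i] by (simp add: L2_inner_self)

lemma norm_sq_mono: "f \<in> L2 M1 \<Longrightarrow> (L2_norm M2 (N f))\<^sup>2 \<le> (L2_norm M1 f)\<^sup>2"
  by (intro power_mono contr) auto

text \<open>Even moments are squared norms. Odd ones are |g|^2 - |N g|^2 with g = D^i f, and
  \<open>N\<close> is a contraction.\<close>

lemma \<mu>_nonneg:
  assumes f: "f \<in> L2 M1"
  shows "0 \<le> \<mu> f n"
proof (cases "even n")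
  case True
  then obtain i where "n = i + i" unfolding dvd_def mult_2 by blast
  then show ?thesis using \<mu>_even[OF f] by simp
next
  case False
  then obtain i where "n = Suc (i + i)" by (auto simp: mult_2 elim!: oddE)
  then show ?thesis using \<mu>_odd[OF f, of i] norm_sq_mono[OF F_L2[OF f], of i] by simp
qed

text \<open>With g = D^i f, the drop after an even index is |N g|^2, and after an odd index it is |N
  g|^2 - |Ns (N g)|^2. The latter is non-negative because \<open>Ns\<close> is a contraction
  too.\<close>

lemma \<mu>_decreasing:
  assumes f: "f \<in> L2 M1"
  shows "\<mu> f (Suc n) \<le> \<mu> f n"
proof (cases "even n")
  case True
  then obtain i where "n = i + i" unfolding dvd_def mult_2 by blast
  then show ?thesis using \<mu>_even[OF f, of i] \<mu>_odd[OF f, of i] by simp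
next
  case False
  then obtain i where n: "n = Suc (i + i)" by (auto simp: mult_2 elim!: oddE)
  interpret flip: L2_contraction_pair M2 M1 Ns N by (rule flip)
  define g where "g = F i f"
  have g: "g \<in> L2 M1" using f by (simp add: g_def F_L2)
  have "Suc n = Suc i + Suc i" using n by simp
  then have "\<mu> f (Suc n) = Re (L2_inner M1 (D g) (D g))"
    using \<mu>_even[OF f, of "Suc i"] by (simp only:) (simp add: g_def L2_inner_self)
  also have "L2_inner M1 (D g) (D g) = L2_inner M1 (D g) g - L2_inner M2 (N (D g)) (N g)"
    using g by (simp add: D_inner D_L2)
  also have "L2_inner M2 (N (D g)) (N g) = L2_inner M1 (D g) (Ns (N g))"
    using g by (simp add: adj N_L2 D_L2)
  also have "\<dots> = L2_inner M1 g (Ns (N g)) - L2_inner M1 (Ns (N g)) (Ns (N g))"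
    using g by (simp add: D_def L2_inner_diff N_L2 Ns_L2)
  also have "L2_inner M1 g (Ns (N g)) = L2_inner M2 (N g) (N g)"
    using g by (simp add: adj N_L2)
  also have "Re (L2_inner M1 (D g) g - (L2_inner M2 (N g) (N g) - L2_inner M1 (Ns (N g)) (Ns (N g))))
      = \<mu> f n - ((L2_norm M2 (N g))\<^sup>2 - (L2_norm M1 (Ns (N g)))\<^sup>2)"
    using g n \<mu>_odd[OF f, of i] by (simp add: D_inner L2_inner_self g_def)
  also have "\<dots> \<le> \<mu> f n" using flip.norm_sq_mono[OF N_L2[OF g]] by simp
  finally show ?thesis .
qed

abbreviation S :: "('a \<Rightarrow> complex) \<Rightarrow> nat \<Rightarrow> real" where
  "S f m \<equiv> (\<Sum>i\<le>m. \<Sum>j\<le>m. isqrt_coeff i * isqrt_coeff j * (\<mu> f (i+j) - \<mu> f (Suc (i+j))))"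

lemma W_norm_sq:
  assumes "f \<in> L2 M1"
  shows "(L2_norm M2 (W I f))\<^sup>2
    = (\<Sum>i\<in>I. \<Sum>j\<in>I. isqrt_coeff i * isqrt_coeff j * (\<mu> f (i+j) - \<mu> f (Suc (i+j))))"
proof -
  have "(L2_norm M2 (W I f))\<^sup>2 = Re (L2_inner M2 (W I f) (W I f))"
    by (simp add: L2_inner_self)
  also have "L2_inner M2 (W I f) (W I f)
      = (\<Sum>i\<in>I. \<Sum>j\<in>I. complex_of_real (isqrt_coeff i) * (complex_of_real (isqrt_coeff j) *
          L2_inner M2 (N (F i f)) (N (F j f))))"
    using W_L2[OF assms, of I] assms
    by (subst (1) W_def) (simp add: L2_inner_sum N_L2 F_L2 W_def L2_inner_sum_right sum_distrib_left)
  finally show ?thesis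
    using assms by (simp add: \<mu>_diff_inner mult.assoc)
qed

text \<open>The difference involves index pairs in the square over (l, m], which is contained in the
  large square minus the small one; the terms dropped are non-negative.\<close>

lemma W_cauchy_bound:
  assumes f: "f \<in> L2 M1" and "l \<le> m"
  shows "(L2_norm M2 (\<lambda>x. W {..m} f x - W {..l} f x))\<^sup>2 \<le> S f m - S f l"
proof -
  let ?g = "\<lambda>i j. isqrt_coeff i * isqrt_coeff j * (\<mu> f (i+j) - \<mu> f (Suc (i+j)))"
  have nn: "0 \<le> ?g i j" for i j using \<mu>_decreasing[OF f, of "i+j"] by (simp add: isqrt_coeff_nonneg)
  have un: "{..m} = {..l} \<union> {l<..m}" using \<open>l \<le> m\<close> by auto
  have "(\<lambda>x. W {..m} f x - W {..l} f x) = W {l<..m} f"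
    unfolding W_def un by (rule ext, subst sum.union_disjoint) auto
  then have "(L2_norm M2 (\<lambda>x. W {..m} f x - W {..l} f x))\<^sup>2 = (\<Sum>(i,j)\<in>{l<..m}\<times>{l<..m}. ?g i j)"
    using W_norm_sq[OF f, of "{l<..m}"] by (simp add: sum.cartesian_product)
  also have "\<dots> \<le> (\<Sum>(i,j)\<in>{..m}\<times>{..m} - {..l}\<times>{..l}. ?g i j)"
    using nn by (intro sum_mono2) auto
  also have "\<dots> = (\<Sum>(i,j)\<in>{..m}\<times>{..m}. ?g i j) - (\<Sum>(i,j)\<in>{..l}\<times>{..l}. ?g i j)"
    using \<open>l \<le> m\<close> by (intro sum_diff) auto
  finally show ?thesis by (simp add: sum.cartesian_product)
qed

text \<open>The sums \<open>S f\<close> increase and are bounded by the zeroth moment, so they are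
  Cauchy and control the distances of the partial sums.\<close>

lemma U_exists:
  assumes f: "f \<in> L2 M1"
  shows "\<exists>u\<in>L2 M2. (\<lambda>m. L2_norm M2 (\<lambda>x. W {..m} f x - u x)) \<longlonglongrightarrow> 0"
proof (rule L2_complete)
  show "W {..m} f \<in> L2 M2" for m using f by (rule W_L2)
next
  fix e :: real assume e: "e > 0"
  have mono: "S f l \<le> S f m" if "l \<le> m" for l m
    using W_cauchy_bound[OF f that] zero_le_power2[of "L2_norm M2 (\<lambda>x. W {..m} f x - W {..l} f x)"]
    by linarith
  have bd: "\<forall>m. S f m \<le> \<mu> f 0"
    by (rule allI, rule isqrt_double_sum_bounds(1)) (auto intro: \<mu>_decreasing \<mu>_nonneg f)
  have "incseq (S f)" unfolding incseq_def by (intro allI impI mono)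
  then obtain s where "S f \<longlonglongrightarrow> s"
    using bd by (rule incseq_convergent)
  then have "Cauchy (S f)" by (rule LIMSEQ_imp_Cauchy)
  then obtain L where L: "\<And>m n. m \<ge> L \<Longrightarrow> n \<ge> L \<Longrightarrow> dist (S f m) (S f n) < e\<^sup>2"
    using e unfolding Cauchy_def by (meson zero_less_power)
  have 1: "L2_norm M2 (\<lambda>x. W {..m} f x - W {..l} f x) < e" if "L \<le> l" "l \<le> m" for l m
  proof (rule power2_less_imp_less)
    show "(L2_norm M2 (\<lambda>x. W {..m} f x - W {..l} f x))\<^sup>2 < e\<^sup>2"
      using W_cauchy_bound[OF f that(2)] L[of m l] that by (simp add: dist_real_def)
  qed (use e in simp)
  show "\<exists>L. \<forall>m\<ge>L. \<forall>n\<ge>L. L2_norm M2 (\<lambda>x. W {..m} f x - W {..n} f x) < e"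
  proof (intro exI[of _ L] allI impI)
    fix m n assume "L \<le> m" "L \<le> n"
    then show "L2_norm M2 (\<lambda>x. W {..m} f x - W {..n} f x) < e"
      using 1[of m n] 1[of n m] L2_norm_minus_commute[of M2 "W {..m} f" "W {..n} f"]
      by (cases "m \<le> n") auto
  qed
qed

lemma U_L2: "f \<in> L2 M1 \<Longrightarrow> U f \<in> L2 M2"
  and U_lim: "f \<in> L2 M1 \<Longrightarrow> (\<lambda>m. L2_norm M2 (\<lambda>x. W {..m} f x - U f x)) \<longlonglongrightarrow> 0"
proof -
  assume "f \<in> L2 M1"
  then have "\<exists>u. u \<in> L2 M2 \<and> (\<lambda>m. L2_norm M2 (\<lambda>x. W {..m} f x - u x)) \<longlonglongrightarrow> 0"
    using U_exists by blast
  then have "U f \<in> L2 M2 \<and> (\<lambda>m. L2_norm M2 (\<lambda>x. W {..m} f x - U f x)) \<longlonglongrightarrow> 0"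
    unfolding U_def by (rule someI_ex)
  then show "U f \<in> L2 M2" "(\<lambda>m. L2_norm M2 (\<lambda>x. W {..m} f x - U f x)) \<longlonglongrightarrow> 0" by auto
qed

lemma W_inner:
  assumes "f \<in> L2 M1" "h \<in> L2 M2"
  shows "L2_inner M2 (W I f) h = (\<Sum>n\<in>I. complex_of_real (isqrt_coeff n) * L2_inner M1 f (F n (Ns h)))"
  unfolding W_def using assms
  by (simp add: L2_inner_sum N_L2 F_L2 adj F_inner Ns_L2)

lemma U_inner_lim:
  assumes "f \<in> L2 M1" "h \<in> L2 M2"
  shows "(\<lambda>m. \<Sum>n\<le>m. complex_of_real (isqrt_coeff n) * L2_inner M1 f (F n (Ns h))) \<longlonglongrightarrow> L2_inner M2 (U f) h"
  using L2_inner_tendsto[OF W_L2[OF assms(1)] U_L2[OF assms(1)] U_lim[OF assms(1)] assms(2)]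
  by (simp add: W_inner assms)

text \<open>\<open>U\<close> chooses a limit separately for each argument, so linearity is tested
  weakly, where the limits are limits of explicit numbers.\<close>

lemma U_inner_lincomb:
  assumes "f \<in> L2 M1" "g \<in> L2 M1" "h \<in> L2 M2"
  shows "L2_inner M2 (U (\<lambda>x. c * f x + d * g x)) h = c * L2_inner M2 (U f) h + d * L2_inner M2 (U g) h"
proof (rule LIMSEQ_unique)
  show "(\<lambda>m. \<Sum>n\<le>m. complex_of_real (isqrt_coeff n) * L2_inner M1 (\<lambda>x. c * f x + d * g x) (F n (Ns h)))
      \<longlonglongrightarrow> L2_inner M2 (U (\<lambda>x. c * f x + d * g x)) h"
    using assms by (intro U_inner_lim L2_lincomb)
  have "(\<lambda>m. c * (\<Sum>n\<le>m. complex_of_real (isqrt_coeff n) * L2_inner M1 f (F n (Ns h)))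
      + d * (\<Sum>n\<le>m. complex_of_real (isqrt_coeff n) * L2_inner M1 g (F n (Ns h))))
      \<longlonglongrightarrow> c * L2_inner M2 (U f) h + d * L2_inner M2 (U g) h"
    using assms by (intro tendsto_intros U_inner_lim)
  also have "(\<lambda>m. c * (\<Sum>n\<le>m. complex_of_real (isqrt_coeff n) * L2_inner M1 f (F n (Ns h)))
      + d * (\<Sum>n\<le>m. complex_of_real (isqrt_coeff n) * L2_inner M1 g (F n (Ns h))))
      = (\<lambda>m. \<Sum>n\<le>m. complex_of_real (isqrt_coeff n) * L2_inner M1 (\<lambda>x. c * f x + d * g x) (F n (Ns h)))"
    using assms by (simp add: L2_inner_lincomb F_L2 Ns_L2 sum_distrib_left sum.distrib[symmetric] algebra_simps)
  finally show "(\<lambda>m. \<Sum>n\<le>m. complex_of_real (isqrt_coeff n) * L2_inner M1 (\<lambda>x. c * f x + d * g x) (F n (Ns h)))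
      \<longlonglongrightarrow> c * L2_inner M2 (U f) h + d * L2_inner M2 (U g) h" .
qed

lemma U_linear:
  assumes "f \<in> L2 M1" "g \<in> L2 M1"
  shows "AE x in M2. U (\<lambda>x. c * f x + d * g x) x = c * U f x + d * U g x"
  using assms by (intro L2_ext) (auto intro: U_L2 L2_lincomb simp: U_inner_lincomb L2_inner_lincomb U_L2)

text \<open>Places the range of \<open>U\<close> in the orthogonal complement of the kernel of
  \<open>Ns\<close>, the target space of the unitary map.\<close>

lemma U_perp:
  assumes f: "f \<in> L2 M1" and g: "g \<in> L2 M2" "AE x in M1. Ns g x = 0"
  shows "L2_inner M2 (U f) g = 0"
proof -
  have "L2_inner M1 f (F n (Ns g)) = 0" for n
  proof -
    have "L2_inner M1 f (F n (Ns g)) = L2_inner M1 (F n f) (Ns g)"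
      using f g by (simp add: F_inner Ns_L2)
    also have "\<dots> = L2_inner M1 (F n f) (\<lambda>x. 0)"
      using f g by (intro L2_inner_cong_AE) (auto intro: F_L2 Ns_L2)
    finally show ?thesis by simp
  qed
  then show ?thesis
    using U_inner_lim[OF f g(1)] by (simp add: LIMSEQ_const_iff)
qed


section \<open>Isometry on the orthogonal complement of the kernel\<close>

abbreviation K1 :: "('a \<Rightarrow> complex) set" where
  "K1 \<equiv> {g \<in> L2 M1. AE x in M1. Ns (N g) x = 0}"

text \<open>The squared distance of D^m f and D^n f is a combination of moments that tends to l + l
  - 2 l = 0, so D^n f converges to some \<open>g\<close>. The limit is fixed by \<open>D\<close>,
  hence lies in \<open>K1\<close> and is orthogonal to \<open>f\<close>; the moments <D^n f, f> then
  tend to <g, f> = 0.\<close>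

lemma \<mu>_tendsto_0:
  assumes "f \<in> L2_perp M1 K1"
  shows "\<mu> f \<longlonglongrightarrow> 0"
proof -
  have f: "f \<in> L2 M1" and perp: "\<And>g. g \<in> L2 M1 \<Longrightarrow> AE x in M1. Ns (N g) x = 0 \<Longrightarrow> L2_inner M1 f g = 0"
    using assms by (auto simp: L2_perp_def)
  have "decseq (\<mu> f)" using \<mu>_decreasing[OF f] by (simp add: decseq_Suc_iff)
  moreover have "\<forall>n. 0 \<le> \<mu> f n" using \<mu>_nonneg[OF f] by blast
  ultimately obtain l where l: "\<mu> f \<longlonglongrightarrow> l" by (rule decseq_convergent)
  have Re_F: "Re (L2_inner M1 (F i f) (F j f)) = \<mu> f (i + j)" for i j
  proof -
    have "F (i + j) f = F j (F i f)" by (simp add: funpow_add add.commute[of i])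
    then show ?thesis using F_inner[of "F i f" f j] f by (simp add: \<mu>_def F_L2)
  qed
  have diff: "(L2_norm M1 (\<lambda>x. F m f x - F n f x))\<^sup>2 = \<mu> f (m+m) + \<mu> f (n+n) - 2 * \<mu> f (m+n)" for m n
  proof -
    have "(L2_norm M1 (\<lambda>x. F m f x - F n f x))\<^sup>2
        = Re (L2_inner M1 (\<lambda>x. F m f x - F n f x) (\<lambda>x. F m f x - F n f x))"
      by (simp add: L2_inner_self)
    also have "\<dots> = \<mu> f (m+m) + \<mu> f (n+n) - 2 * \<mu> f (m+n)"
      using f by (simp add: L2_inner_diff L2_diff F_L2 Re_F add.commute[of n m])
    finally show ?thesis .
  qed
  have "\<exists>g\<in>L2 M1. (\<lambda>n. L2_norm M1 (\<lambda>x. F n f x - g x)) \<longlonglongrightarrow> 0"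
  proof (rule L2_complete)
    fix e :: real assume e: "e > 0"
    then obtain K where K: "\<And>n. n \<ge> K \<Longrightarrow> \<bar>\<mu> f n - l\<bar> < e\<^sup>2 / 4"
      using LIMSEQ_D[OF l, of "e\<^sup>2/4"] by auto
    show "\<exists>K. \<forall>m\<ge>K. \<forall>n\<ge>K. L2_norm M1 (\<lambda>x. F m f x - F n f x) < e"
    proof (intro exI[of _ K] allI impI)
      fix m n assume "K \<le> m" "K \<le> n"
      then have "\<bar>\<mu> f (m+m) - l\<bar> < e\<^sup>2/4" "\<bar>\<mu> f (n+n) - l\<bar> < e\<^sup>2/4" "\<bar>\<mu> f (m+n) - l\<bar> < e\<^sup>2/4"
        by (intro K; simp)+
      then have "(L2_norm M1 (\<lambda>x. F m f x - F n f x))\<^sup>2 < e\<^sup>2"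
        unfolding diff by linarith
      then show "L2_norm M1 (\<lambda>x. F m f x - F n f x) < e"
        using e power2_less_imp_less[of _ e] by simp
    qed
  qed (use f F_L2 in auto)
  then obtain g where g: "g \<in> L2 M1" and lim: "(\<lambda>n. L2_norm M1 (\<lambda>x. F n f x - g x)) \<longlonglongrightarrow> 0" by blast
  have ip: "(\<lambda>n. L2_inner M1 (F n f) h) \<longlonglongrightarrow> L2_inner M1 g h" if "h \<in> L2 M1" for h
    using L2_inner_tendsto[OF F_L2[OF f] g lim that] .
  have "AE x in M1. Ns (N g) x = 0"
  proof (rule L2_ext)
    fix h assume h: "h \<in> L2 M1"
    have "(\<lambda>n. L2_inner M1 (F (Suc n) f) h) \<longlonglongrightarrow> L2_inner M1 g h"
      using ip[OF h] by (rule LIMSEQ_Suc)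
    moreover have "(\<lambda>n. L2_inner M1 (F (Suc n) f) h) = (\<lambda>n. L2_inner M1 (F n f) (D h))"
      using f h by (simp add: D_inner F_L2)
    ultimately have "L2_inner M1 g h = L2_inner M1 g (D h)"
      using LIMSEQ_unique[OF _ ip[OF D_L2[OF h]], of "L2_inner M1 g h"] by simp
    then have "L2_inner M2 (N g) (N h) = 0"
      using g h by (simp add: D_inner)
    then show "L2_inner M1 (Ns (N g)) h = L2_inner M1 (\<lambda>x. 0) h"
      using g h by (simp add: adj' N_L2)
  qed (use g N_L2 Ns_L2 in auto)
  then have "L2_inner M1 g f = 0"
    using perp[OF g] L2_inner_commute[of M1 g f] by simp
  then have "(\<lambda>n. Re (L2_inner M1 (F n f) f)) \<longlonglongrightarrow> Re 0"
    using ip[OF f] by (intro tendsto_Re) simp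
  then show ?thesis by (simp add: \<mu>_def[abs_def])
qed

text \<open>The double sum bounds squeeze the squared norm of the partial sums between \<mu>_0 -
  \<mu>_(m+1) and \<mu>_0.\<close>

lemma U_norm:
  assumes P: "f \<in> L2_perp M1 K1"
  shows "L2_norm M2 (U f) = L2_norm M1 f"
proof -
  have f: "f \<in> L2 M1" using P by (simp add: L2_perp_def)
  have "(\<lambda>m. (L2_norm M2 (W {..m} f))\<^sup>2) \<longlonglongrightarrow> (L2_norm M2 (U f))\<^sup>2"
    by (intro tendsto_power L2_norm_tendsto W_L2 U_L2 U_lim f)
  moreover have "(\<lambda>m. (L2_norm M2 (W {..m} f))\<^sup>2) \<longlonglongrightarrow> \<mu> f 0"
  proof (rule tendsto_sandwich)
    show "\<forall>\<^sub>F m in sequentially. \<mu> f 0 - \<mu> f (Suc m) \<le> (L2_norm M2 (W {..m} f))\<^sup>2"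
      unfolding W_norm_sq[OF f]
      by (intro always_eventually allI isqrt_double_sum_bounds(2) \<mu>_decreasing \<mu>_nonneg f)
    show "\<forall>\<^sub>F m in sequentially. (L2_norm M2 (W {..m} f))\<^sup>2 \<le> \<mu> f 0"
      unfolding W_norm_sq[OF f]
      by (intro always_eventually allI isqrt_double_sum_bounds(1) \<mu>_decreasing \<mu>_nonneg f)
    show "(\<lambda>m. \<mu> f 0 - \<mu> f (Suc m)) \<longlonglongrightarrow> \<mu> f 0"
      using tendsto_diff[OF tendsto_const LIMSEQ_Suc[OF \<mu>_tendsto_0[OF P]], of "\<mu> f 0"] by simp
  qed auto
  ultimately have "(L2_norm M2 (U f))\<^sup>2 = \<mu> f 0" by (rule LIMSEQ_unique)
  also have "\<dots> = (L2_norm M1 f)\<^sup>2" using \<mu>_even[OF f, of 0] by simp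
  finally show ?thesis by (simp add: power2_eq_iff_nonneg)
qed

text \<open>Polarization: comparing the norms of f + c g before and after \<open>U\<close> for c = 1
  gives the real part, and for c = i the imaginary part.\<close>

lemma U_isometry:
  assumes P: "f \<in> L2_perp M1 K1" "g \<in> L2_perp M1 K1"
  shows "L2_inner M2 (U f) (U g) = L2_inner M1 f g"
proof -
  have f: "f \<in> L2 M1" and g: "g \<in> L2 M1" using P by (simp_all add: L2_perp_def)
  have expand: "(L2_norm M (\<lambda>x. 1 * p x + c * q x))\<^sup>2
      = (L2_norm M p)\<^sup>2 + (cmod c)\<^sup>2 * (L2_norm M q)\<^sup>2 + 2 * Re (cnj c * L2_inner M p q)"
    if "p \<in> L2 M" "q \<in> L2 M" for M :: "'c measure" and p q c
  proof -
    have "(L2_norm M (\<lambda>x. 1 * p x + c * q x))\<^sup>2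
        = Re (L2_inner M (\<lambda>x. 1 * p x + c * q x) (\<lambda>x. 1 * p x + c * q x))"
      by (simp only: L2_inner_self Re_complex_of_real)
    also have "L2_inner M (\<lambda>x. 1 * p x + c * q x) (\<lambda>x. 1 * p x + c * q x)
        = L2_inner M p p + cnj c * L2_inner M p q + c * L2_inner M q p + c * cnj c * L2_inner M q q"
      using that by (simp only: L2_inner_lincomb L2_inner_lincomb_right L2_lincomb) (simp add: algebra_simps)
    also have "Re \<dots> = (L2_norm M p)\<^sup>2 + (cmod c)\<^sup>2 * (L2_norm M q)\<^sup>2 + 2 * Re (cnj c * L2_inner M p q)"
      by (simp add: L2_inner_self L2_inner_commute[of M q p] complex_norm_square[symmetric])
    finally show ?thesis .
  qed
  have "Re (cnj c * L2_inner M2 (U f) (U g)) = Re (cnj c * L2_inner M1 f g)" for c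
  proof -
    have s: "(\<lambda>x. 1 * f x + c * g x) \<in> L2_perp M1 K1"
      unfolding L2_perp_def
    proof (intro CollectI conjI ballI L2_lincomb f g)
      fix k assume k: "k \<in> K1"
      then have "L2_inner M1 f k = 0" "L2_inner M1 g k = 0" using P by (auto simp: L2_perp_def)
      then show "L2_inner M1 (\<lambda>x. 1 * f x + c * g x) k = 0"
        using k f g by (simp only: L2_inner_lincomb mem_Collect_eq) simp
    qed
    have "L2_norm M2 (\<lambda>x. 1 * U f x + c * U g x) = L2_norm M2 (U (\<lambda>x. 1 * f x + c * g x))"
      using U_linear[OF f g, of 1 c]
      by (intro L2_norm_cong_AE) (auto intro!: U_L2 L2_lincomb f g simp del: mult_1)
    also have "\<dots> = L2_norm M1 (\<lambda>x. 1 * f x + c * g x)" by (rule U_norm[OF s])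
    finally show ?thesis
      using expand[OF U_L2[OF f] U_L2[OF g], of c] expand[OF f g, of c] U_norm[OF P(1)] U_norm[OF P(2)]
      by simp
  qed
  from this[of 1] this[of \<i>] show ?thesis by (simp add: complex_eq_iff)
qed

text \<open>A weak form of the fact that N^* N = 1 - D commutes with the powers of
  \<open>D\<close>.\<close>

lemma F_NsN_commute:
  assumes "f \<in> L2 M1" "k \<in> L2 M1"
  shows "L2_inner M1 f (F n (Ns (N k))) = L2_inner M1 (Ns (N f)) (F n k)"
proof -
  have "L2_inner M1 f (F n (Ns (N k))) = L2_inner M2 (N (F n f)) (N (F 0 k))"
    using assms by (simp add: F_inner[symmetric] adj F_L2 N_L2 Ns_L2)
  also have "\<dots> = L2_inner M2 (N (F 0 f)) (N (F n k))"
    using assms by (simp only: NF_inner) simp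
  also have "\<dots> = L2_inner M1 (Ns (N f)) (F n k)"
    using assms by (simp add: adj' N_L2 F_L2)
  finally show ?thesis .
qed

text \<open>\<open>T\<close> stands for the operator in its original form, known only almost
  everywhere and up to the scalar \<open>c\<close> that arises when \<open>N\<close> is normalized
  to a contraction.\<close>

lemma U_intertwine:
  assumes f: "f \<in> L2 M1" and T: "T \<in> L2 M1" "AE x in M1. T x = c * Ns (N f) x" and h: "h \<in> L2 M2"
  shows "L2_inner M2 (U T) h = c * L2_inner M2 (N (Ns (U f))) h"
proof (rule LIMSEQ_unique[OF U_inner_lim[OF T(1) h]])
  have "(\<lambda>m. c * (\<Sum>n\<le>m. complex_of_real (isqrt_coeff n) * L2_inner M1 f (F n (Ns (N (Ns h))))))
      \<longlonglongrightarrow> c * L2_inner M2 (U f) (N (Ns h))"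
    by (intro tendsto_intros U_inner_lim f N_L2 Ns_L2 h)
  also have "L2_inner M2 (U f) (N (Ns h)) = L2_inner M2 (N (Ns (U f))) h"
    using f h by (simp add: adj adj' U_L2 Ns_L2)
  also have "(\<lambda>m. c * (\<Sum>n\<le>m. complex_of_real (isqrt_coeff n) * L2_inner M1 f (F n (Ns (N (Ns h))))))
      = (\<lambda>m. \<Sum>n\<le>m. complex_of_real (isqrt_coeff n) * L2_inner M1 T (F n (Ns h)))"
  proof -
    have "L2_inner M1 T (F n (Ns h)) = c * L2_inner M1 f (F n (Ns (N (Ns h))))" for n
    proof -
      have "L2_inner M1 T (F n (Ns h)) = L2_inner M1 (\<lambda>x. c * Ns (N f) x) (F n (Ns h))"
        using f T h by (intro L2_inner_cong_AE) (auto intro!: F_L2 Ns_L2 N_L2 L2_scale)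
      also have "\<dots> = c * L2_inner M1 (Ns (N f)) (F n (Ns h))"
        using f h by (intro L2_inner_scale F_L2 Ns_L2 N_L2)
      finally show ?thesis using f h by (simp add: F_NsN_commute Ns_L2)
    qed
    then show ?thesis by (simp add: sum_distrib_left mult_ac)
  qed
  finally show "(\<lambda>m. \<Sum>n\<le>m. complex_of_real (isqrt_coeff n) * L2_inner M1 T (F n (Ns h)))
      \<longlonglongrightarrow> c * L2_inner M2 (N (Ns (U f))) h" .
qed

lemma Ns_ker_iff:
  assumes "g \<in> L2 M2"
  shows "(AE x in M2. N (Ns g) x = 0) \<longleftrightarrow> (AE x in M1. Ns g x = 0)"
proof
  assume "AE x in M1. Ns g x = 0"
  then have "L2_norm M1 (Ns g) = 0" using L2_norm_eq_0_iff Ns_L2 assms by blast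
  then have "L2_norm M2 (N (Ns g)) = 0"
    using contr[OF Ns_L2[OF assms]] L2_norm_nonneg[of M2 "N (Ns g)"] by simp
  then show "AE x in M2. N (Ns g) x = 0" using L2_norm_eq_0_iff N_L2 Ns_L2 assms by blast
next
  assume "AE x in M2. N (Ns g) x = 0"
  then have "L2_inner M2 (N (Ns g)) g = L2_inner M2 (\<lambda>x. 0) g"
    using assms by (intro L2_inner_cong_AE) (auto intro: N_L2 Ns_L2)
  then have "L2_inner M1 (Ns g) (Ns g) = 0" using assms by (simp add: adj Ns_L2)
  then have "L2_norm M1 (Ns g) = 0" by (simp add: L2_inner_self)
  then show "AE x in M1. Ns g x = 0" using L2_norm_eq_0_iff Ns_L2 assms by blast
qed

end

section \<open>Surjectivity of the partial isometry\<close>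

context L2_contraction_pair
begin

interpretation flip: L2_contraction_pair M2 M1 Ns N by (rule flip)

text \<open>Moves \<open>Ns\<close> through the powers: (1 - N^* N)^n N^* = N^* (1 - N N^* )^n,
  tested weakly.\<close>

lemma F_Ns:
  assumes "f \<in> L2 M1" "h \<in> L2 M2"
  shows "L2_inner M1 f (F n (Ns h)) = L2_inner M2 (N f) (flip.F n h)"
  using assms(2)
proof (induction n arbitrary: h)
  case (Suc n)
  have "L2_inner M1 f (F (Suc n) (Ns h)) = L2_inner M1 (F n f) (D (Ns h))"
    using assms Suc.prems by (simp add: funpow_swap1 F_inner D_L2 Ns_L2)
  also have "\<dots> = L2_inner M2 (N (F n f)) (flip.D h)"
    using assms Suc.prems by (simp add: D_inner flip.D_def L2_inner_diff N_L2 Ns_L2 F_L2 adj)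
  also have "\<dots> = L2_inner M1 f (F n (Ns (flip.D h)))"
    using assms Suc.prems by (simp add: adj F_L2 flip.D_L2 F_inner Ns_L2)
  also have "\<dots> = L2_inner M2 (N f) (flip.F n (flip.D h))"
    using Suc by (simp add: flip.D_L2)
  finally show ?case by (simp add: funpow_swap1)
qed (simp add: assms adj)

text \<open>Term by term, the series for the flipped pair is the adjoint of the series for
  \<open>U\<close>, since the coefficients are real.\<close>

lemma U_adjoint:
  assumes "f \<in> L2 M1" "h \<in> L2 M2"
  shows "L2_inner M2 (U f) h = L2_inner M1 f (flip.U h)"
proof (rule LIMSEQ_unique[OF U_inner_lim[OF assms]])
  have "(\<lambda>m. cnj (\<Sum>n\<le>m. complex_of_real (isqrt_coeff n) * L2_inner M2 h (flip.F n (N f))))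
      \<longlonglongrightarrow> cnj (L2_inner M1 (flip.U h) f)"
    by (intro tendsto_cnj flip.U_inner_lim assms)
  also have "(\<lambda>m. cnj (\<Sum>n\<le>m. complex_of_real (isqrt_coeff n) * L2_inner M2 h (flip.F n (N f))))
      = (\<lambda>m. \<Sum>n\<le>m. complex_of_real (isqrt_coeff n) * L2_inner M1 f (F n (Ns h)))"
    using assms by (simp add: F_Ns L2_inner_commute[of M2 _ h, symmetric] flip.F_inner N_L2)
  finally show "(\<lambda>m. \<Sum>n\<le>m. complex_of_real (isqrt_coeff n) * L2_inner M1 f (F n (Ns h)))
      \<longlonglongrightarrow> L2_inner M1 f (flip.U h)"
    by (simp add: L2_inner_commute[of M1 f "flip.U h"])
qed

text \<open>Let d = U U^* h - h. It is orthogonal to the kernel, and U^* is isometric there, so <U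
  U^* h, d> = <U^* h, U^* d> = <h, d>, whence <d, d> = 0.\<close>

lemma U_surj:
  assumes h: "h \<in> L2_perp M2 flip.K1"
  shows "AE x in M2. U (flip.U h) x = h x"
proof -
  have h2: "h \<in> L2 M2" using h by (simp add: L2_perp_def)
  let ?d = "\<lambda>x. U (flip.U h) x - h x"
  have V: "flip.U h \<in> L2 M1" by (rule flip.U_L2[OF h2])
  have d: "?d \<in> L2 M2" by (intro L2_diff U_L2 V h2)
  have dP: "?d \<in> L2_perp M2 flip.K1"
    unfolding L2_perp_def
  proof (intro CollectI conjI ballI d)
    fix k assume k: "k \<in> flip.K1"
    then have "AE x in M1. Ns k x = 0" using Ns_ker_iff by blast
    then have "L2_inner M2 (U (flip.U h)) k = 0" using U_perp[OF V] k by blast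
    moreover have "L2_inner M2 h k = 0" using h k by (auto simp: L2_perp_def)
    ultimately show "L2_inner M2 ?d k = 0"
      using k by (simp add: L2_inner_diff U_L2 V h2)
  qed
  have "L2_inner M2 ?d ?d = L2_inner M2 (U (flip.U h)) ?d - L2_inner M2 h ?d"
    by (rule L2_inner_diff(1)) (intro U_L2 V h2 d)+
  also have "\<dots> = L2_inner M1 (flip.U h) (flip.U ?d) - L2_inner M2 h ?d"
    by (simp add: U_adjoint[OF V d])
  also have "\<dots> = 0" using flip.U_isometry[OF h dP] by simp
  finally have "L2_norm M2 ?d = 0" by (simp add: L2_inner_self)
  then show ?thesis using L2_norm_eq_0_iff[OF d] by simp
qed

text \<open>The partial isometry of the polar decomposition of \<open>N\<close> intertwines \<open>N\<^sup>* N\<close> and \<open>N N\<^sup>*\<close>.\<close>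

theorem unitarily_equiv_mod_ker_gram:
  assumes c: "c \<noteq> 0"
    and T1: "\<And>f. f \<in> L2 M1 \<Longrightarrow> T1 f \<in> L2 M1" "\<And>f. f \<in> L2 M1 \<Longrightarrow> AE x in M1. T1 f x = c * Ns (N f) x"
    and T2: "\<And>g. g \<in> L2 M2 \<Longrightarrow> T2 g \<in> L2 M2" "\<And>g. g \<in> L2 M2 \<Longrightarrow> AE x in M2. T2 g x = c * N (Ns g) x"
  shows "unitarily_equiv_mod_ker M1 T1 M2 T2"
proof -
  have ker1: "L2_ker M1 T1 = K1"
  proof -
    have "(AE x in M1. T1 f x = 0) \<longleftrightarrow> (AE x in M1. Ns (N f) x = 0)" if "f \<in> L2 M1" for f
      using T1(2)[OF that] c by (intro eventually_subst) (auto elim: eventually_mono)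
    then show ?thesis unfolding L2_ker_def by (intro Collect_cong conj_cong refl)
  qed
  have ker2: "L2_ker M2 T2 = flip.K1"
  proof -
    have "(AE x in M2. T2 f x = 0) \<longleftrightarrow> (AE x in M2. N (Ns f) x = 0)" if "f \<in> L2 M2" for f
      using T2(2)[OF that] c by (intro eventually_subst) (auto elim: eventually_mono)
    then show ?thesis unfolding L2_ker_def by (intro Collect_cong conj_cong refl)
  qed
  have inv1: "T1 f \<in> L2_perp M1 K1" if f: "f \<in> L2_perp M1 K1" for f
    unfolding L2_perp_def
  proof (intro CollectI conjI ballI)
    have f1: "f \<in> L2 M1" using f by (simp add: L2_perp_def)
    then show "T1 f \<in> L2 M1" by (rule T1)
    fix k assume k: "k \<in> K1"
    have "L2_inner M1 (T1 f) k = L2_inner M1 (\<lambda>x. c * Ns (N f) x) k"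
      using f1 k T1 by (intro L2_inner_cong_AE) (auto intro: L2_scale Ns_L2 N_L2)
    also have "\<dots> = c * L2_inner M1 f (Ns (N k))"
      using f1 k by (simp add: L2_inner_scale Ns_L2 N_L2 adj'[symmetric] adj[symmetric])
    also have "L2_inner M1 f (Ns (N k)) = L2_inner M1 f (\<lambda>x. 0)"
      using f1 k by (intro L2_inner_cong_AE) (auto intro: Ns_L2 N_L2)
    finally show "L2_inner M1 (T1 f) k = 0" by simp
  qed
  have inv2: "T2 f \<in> L2_perp M2 flip.K1" if f: "f \<in> L2_perp M2 flip.K1" for f
    unfolding L2_perp_def
  proof (intro CollectI conjI ballI)
    have f1: "f \<in> L2 M2" using f by (simp add: L2_perp_def)
    then show "T2 f \<in> L2 M2" by (rule T2)
    fix k assume k: "k \<in> flip.K1"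
    have "L2_inner M2 (T2 f) k = L2_inner M2 (\<lambda>x. c * N (Ns f) x) k"
      using f1 k T2 by (intro L2_inner_cong_AE) (auto intro: L2_scale Ns_L2 N_L2)
    also have "\<dots> = c * L2_inner M2 f (N (Ns k))"
      using f1 k by (simp add: L2_inner_scale Ns_L2 N_L2 adj' adj)
    also have "L2_inner M2 f (N (Ns k)) = L2_inner M2 f (\<lambda>x. 0)"
      using f1 k by (intro L2_inner_cong_AE) (auto intro: Ns_L2 N_L2)
    finally show "L2_inner M2 (T2 f) k = 0" by simp
  qed
  have U_in: "U f \<in> L2_perp M2 flip.K1" if "f \<in> L2 M1" for f
    unfolding L2_perp_def using U_L2[OF that] U_perp[OF that] Ns_ker_iff by fast
  have V_in: "flip.U f \<in> L2_perp M1 K1" if "f \<in> L2 M2" for f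
    unfolding L2_perp_def using flip.U_L2[OF that] flip.U_perp[OF that] flip.Ns_ker_iff by fast
  have perp1: "f \<in> L2 M1" if "f \<in> L2_perp M1 K1" for f using that by (simp add: L2_perp_def)
  have perp2: "f \<in> L2 M2" if "f \<in> L2_perp M2 flip.K1" for f using that by (simp add: L2_perp_def)
  have inter: "AE x in M2. U (T1 f) x = T2 (U f) x" if f: "f \<in> L2 M1" for f
  proof (rule L2_ext)
    fix h assume h: "h \<in> L2 M2"
    have "L2_inner M2 (T2 (U f)) h = L2_inner M2 (\<lambda>x. c * N (Ns (U f)) x) h"
      using f h T2 by (intro L2_inner_cong_AE) (auto intro: L2_scale Ns_L2 N_L2 U_L2)
    also have "\<dots> = c * L2_inner M2 (N (Ns (U f))) h"
      using f h by (simp add: L2_inner_scale Ns_L2 N_L2 U_L2)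
    finally show "L2_inner M2 (U (T1 f)) h = L2_inner M2 (T2 (U f)) h"
      using U_intertwine[OF f T1(1)[OF f] T1(2)[OF f] h] by simp
  qed (use f T1 T2 U_L2 in auto)
  have "L2_unitary_between M1 (L2_perp M1 K1) M2 (L2_perp M2 flip.K1) U"
    unfolding L2_unitary_between_def L2_linear_on_def
  proof (intro conjI ballI allI U_in U_linear U_isometry perp1)
    fix h assume h: "h \<in> L2_perp M2 flip.K1"
    show "\<exists>f\<in>L2_perp M1 K1. AE x in M2. U f x = h x"
      using U_surj[OF h] V_in[OF perp2[OF h]] by blast
  qed
  then show ?thesis
    unfolding unitarily_equiv_mod_ker_def ker1 ker2 Let_def
    by (intro conjI ballI inv1 inv2 exI[of _ U] inter perp1)
qed

end

section \<open>Integral operators with non-negative kernel\<close>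

text \<open>Factor the kernel as sqrt (\<kappa> q) times sqrt (\<kappa> / q), apply Cauchy-Schwarz
  in \<open>y\<close>, then Tonelli and the column bound. Stating it for \<open>ennreal\<close>
  valued \<open>G\<close> keeps integrability out of the argument.\<close>

lemma Schur_test:
  fixes \<kappa> :: "'a \<Rightarrow> 'b \<Rightarrow> real" and p :: "'a \<Rightarrow> real" and q :: "'b \<Rightarrow> real" and G :: "'b \<Rightarrow> ennreal"
  assumes "pair_sigma_finite M1 M2"
    and [measurable]: "(\<lambda>(x, y). \<kappa> x y) \<in> borel_measurable (M1 \<Otimes>\<^sub>M M2)"
      "p \<in> borel_measurable M1" "q \<in> borel_measurable M2" "G \<in> borel_measurable M2"
    and nonneg: "\<And>x y. 0 \<le> \<kappa> x y" and q: "\<And>y. y \<in> space M2 \<Longrightarrow> 0 < q y"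
    and p: "\<And>x. x \<in> space M1 \<Longrightarrow> 0 \<le> p x" and C: "0 \<le> C"
    and row: "\<And>x. x \<in> space M1 \<Longrightarrow> (\<integral>\<^sup>+y. ennreal (\<kappa> x y * q y) \<partial>M2) \<le> ennreal (C * p x)"
    and col: "\<And>y. y \<in> space M2 \<Longrightarrow> (\<integral>\<^sup>+x. ennreal (\<kappa> x y * p x) \<partial>M1) \<le> ennreal (C * q y)"
  shows "(\<integral>\<^sup>+x. (\<integral>\<^sup>+y. ennreal (\<kappa> x y) * G y \<partial>M2)\<^sup>2 \<partial>M1) \<le> ennreal (C\<^sup>2) * (\<integral>\<^sup>+y. (G y)\<^sup>2 \<partial>M2)"
proof -
  interpret pair_sigma_finite M1 M2 by fact
  have 1: "(\<integral>\<^sup>+y. ennreal (\<kappa> x y) * G y \<partial>M2)\<^sup>2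
      \<le> ennreal (C * p x) * (\<integral>\<^sup>+y. ennreal (\<kappa> x y / q y) * (G y)\<^sup>2 \<partial>M2)" if x: "x \<in> space M1" for x
  proof -
    have [measurable]: "\<kappa> x \<in> borel_measurable M2"
      using measurable_compose[OF measurable_Pair1'[OF x] assms(2)] by simp
    have "(\<integral>\<^sup>+y. ennreal (\<kappa> x y) * G y \<partial>M2)
        = (\<integral>\<^sup>+y. ennreal (sqrt (\<kappa> x y * q y)) * (ennreal (sqrt (\<kappa> x y / q y)) * G y) \<partial>M2)"
    proof (rule nn_integral_cong)
      fix y assume "y \<in> space M2"
      then have "\<kappa> x y = sqrt (\<kappa> x y * q y) * sqrt (\<kappa> x y / q y)"
        using q[of y] nonneg[of x y] by (simp add: real_sqrt_mult[symmetric] power2_eq_square[symmetric])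
      moreover have "ennreal (sqrt (\<kappa> x y * q y) * sqrt (\<kappa> x y / q y))
          = ennreal (sqrt (\<kappa> x y * q y)) * ennreal (sqrt (\<kappa> x y / q y))"
        using q[OF \<open>y \<in> space M2\<close>] nonneg[of x y] by (intro ennreal_mult) auto
      ultimately show "ennreal (\<kappa> x y) * G y = ennreal (sqrt (\<kappa> x y * q y)) * (ennreal (sqrt (\<kappa> x y / q y)) * G y)"
        by (simp add: mult.assoc)
    qed
    also have "\<dots>\<^sup>2 \<le> (\<integral>\<^sup>+y. (ennreal (sqrt (\<kappa> x y * q y)))\<^sup>2 \<partial>M2)
        * (\<integral>\<^sup>+y. (ennreal (sqrt (\<kappa> x y / q y)) * G y)\<^sup>2 \<partial>M2)"
      by (rule Cauchy_Schwarz_nn_integral) measurable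
    also have "(\<integral>\<^sup>+y. (ennreal (sqrt (\<kappa> x y * q y)))\<^sup>2 \<partial>M2) = (\<integral>\<^sup>+y. ennreal (\<kappa> x y * q y) \<partial>M2)"
      using q nonneg by (intro nn_integral_cong) (simp add: ennreal_power less_imp_le)
    also have "(\<integral>\<^sup>+y. (ennreal (sqrt (\<kappa> x y / q y)) * G y)\<^sup>2 \<partial>M2)
        = (\<integral>\<^sup>+y. ennreal (\<kappa> x y / q y) * (G y)\<^sup>2 \<partial>M2)"
      using q nonneg by (intro nn_integral_cong) (simp add: power_mult_distrib ennreal_power less_imp_le)
    finally show ?thesis using mult_right_mono[OF row[OF x]] order_trans by fastforce
  qed
  have "(\<integral>\<^sup>+x. (\<integral>\<^sup>+y. ennreal (\<kappa> x y) * G y \<partial>M2)\<^sup>2 \<partial>M1)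
      \<le> (\<integral>\<^sup>+x. ennreal (C * p x) * (\<integral>\<^sup>+y. ennreal (\<kappa> x y / q y) * (G y)\<^sup>2 \<partial>M2) \<partial>M1)"
    by (rule nn_integral_mono) (rule 1)
  also have "\<dots> = (\<integral>\<^sup>+x. (\<integral>\<^sup>+y. ennreal (C * p x) * (ennreal (\<kappa> x y / q y) * (G y)\<^sup>2) \<partial>M2) \<partial>M1)"
    by (intro nn_integral_cong nn_integral_cmult[symmetric]) measurable
  also have "\<dots> = (\<integral>\<^sup>+y. (\<integral>\<^sup>+x. ennreal (C * p x) * (ennreal (\<kappa> x y / q y) * (G y)\<^sup>2) \<partial>M1) \<partial>M2)"
    by (rule Fubini'[symmetric]) measurable
  also have "\<dots> \<le> (\<integral>\<^sup>+y. ennreal (C\<^sup>2) * (G y)\<^sup>2 \<partial>M2)"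
  proof (rule nn_integral_mono)
    fix y assume y: "y \<in> space M2"
    have [measurable]: "(\<lambda>x. \<kappa> x y) \<in> borel_measurable M1"
      using measurable_compose[OF measurable_Pair2'[OF y] assms(2)] by simp
    have "(\<integral>\<^sup>+x. ennreal (C * p x) * (ennreal (\<kappa> x y / q y) * (G y)\<^sup>2) \<partial>M1)
        = (\<integral>\<^sup>+x. (ennreal (C / q y) * (G y)\<^sup>2) * ennreal (\<kappa> x y * p x) \<partial>M1)"
    proof (rule nn_integral_cong)
      fix x assume "x \<in> space M1"
      then have "ennreal (C * p x) * ennreal (\<kappa> x y / q y) = ennreal (C / q y) * ennreal (\<kappa> x y * p x)"
        using p[of x] q[OF y] nonneg[of x y] C by (simp add: ennreal_mult[symmetric])
      then show "ennreal (C * p x) * (ennreal (\<kappa> x y / q y) * (G y)\<^sup>2)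
          = (ennreal (C / q y) * (G y)\<^sup>2) * ennreal (\<kappa> x y * p x)"
        by (metis mult.assoc mult.commute)
    qed
    also have "\<dots> = (ennreal (C / q y) * (G y)\<^sup>2) * (\<integral>\<^sup>+x. ennreal (\<kappa> x y * p x) \<partial>M1)"
      by (rule nn_integral_cmult) measurable
    also have "\<dots> \<le> (ennreal (C / q y) * (G y)\<^sup>2) * ennreal (C * q y)"
      by (intro mult_left_mono col y) auto
    also have "\<dots> = (ennreal (C / q y) * ennreal (C * q y)) * (G y)\<^sup>2" by (simp only: mult_ac)
    also have "ennreal (C / q y) * ennreal (C * q y) = ennreal (C\<^sup>2)"
      using q[OF y] C by (simp add: ennreal_mult[symmetric] power2_eq_square)
    finally show "(\<integral>\<^sup>+x. ennreal (C * p x) * (ennreal (\<kappa> x y / q y) * (G y)\<^sup>2) \<partial>M1) \<le> ennreal (C\<^sup>2) * (G y)\<^sup>2" .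
  qed
  also have "\<dots> = ennreal (C\<^sup>2) * (\<integral>\<^sup>+y. (G y)\<^sup>2 \<partial>M2)"
    by (rule nn_integral_cmult) measurable
  finally show ?thesis .
qed

text \<open>The bounds concern non-negative functions, so they also control the operator applied to
  absolute values, as Fubini requires. Rows and columns in \<open>L2\<close> make the defining
  integral converge at every point and make the rows admissible arguments of the operator.\<close>

locale kernel_operator = pair_sigma_finite M1 M2 for M1 :: "'a measure" and M2 :: "'b measure" +
  fixes \<kappa> :: "'a \<Rightarrow> 'b \<Rightarrow> real" and C :: real
  assumes kernel_measurable: "(\<lambda>(x, y). \<kappa> x y) \<in> borel_measurable (M1 \<Otimes>\<^sub>M M2)"
    and kernel_nonneg: "\<And>x y. 0 \<le> \<kappa> x y"
    and C_pos: "0 < C"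
    and bound: "\<And>G :: 'b \<Rightarrow> ennreal. G \<in> borel_measurable M2 \<Longrightarrow>
      (\<integral>\<^sup>+x. (\<integral>\<^sup>+y. ennreal (\<kappa> x y) * G y \<partial>M2)\<^sup>2 \<partial>M1) \<le> ennreal (C\<^sup>2) * (\<integral>\<^sup>+y. (G y)\<^sup>2 \<partial>M2)"
    and bound': "\<And>G :: 'a \<Rightarrow> ennreal. G \<in> borel_measurable M1 \<Longrightarrow>
      (\<integral>\<^sup>+y. (\<integral>\<^sup>+x. ennreal (\<kappa> x y) * G x \<partial>M1)\<^sup>2 \<partial>M2) \<le> ennreal (C\<^sup>2) * (\<integral>\<^sup>+x. (G x)\<^sup>2 \<partial>M1)"
    and row_L2: "\<And>x. x \<in> space M1 \<Longrightarrow> (\<lambda>y. complex_of_real (\<kappa> x y)) \<in> L2 M2"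
    and col_L2: "\<And>y. y \<in> space M2 \<Longrightarrow> (\<lambda>x. complex_of_real (\<kappa> x y)) \<in> L2 M1"
begin

definition T :: "('b \<Rightarrow> complex) \<Rightarrow> 'a \<Rightarrow> complex" where
  "T f = (\<lambda>x. LINT y|M2. complex_of_real (\<kappa> x y) * f y)"

lemma flip: "kernel_operator M2 M1 (\<lambda>y x. \<kappa> x y) C"
proof -
  interpret flip: pair_sigma_finite M2 M1 ..
  have "(\<lambda>(y, x). \<kappa> x y) \<in> borel_measurable (M2 \<Otimes>\<^sub>M M1)"
    using measurable_pair_swap[OF kernel_measurable] by (simp add: split_def)
  then show ?thesis
    using kernel_nonneg C_pos bound bound' row_L2 col_L2 by unfold_locales auto
qed

lemma T_integrable:
  assumes "f \<in> L2 M2" "x \<in> space M1"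
  shows "integrable M2 (\<lambda>y. complex_of_real (\<kappa> x y) * f y)"
  using row_L2[OF assms(2)] assms(1) by (rule L2_prod_integrable)

lemma T_lincomb:
  assumes "f \<in> L2 M2" "g \<in> L2 M2" "x \<in> space M1"
  shows "T (\<lambda>y. c * f y + d * g y) x = c * T f x + d * T g x"
proof -
  have "T (\<lambda>y. c * f y + d * g y) x
      = (LINT y|M2. c * (complex_of_real (\<kappa> x y) * f y) + d * (complex_of_real (\<kappa> x y) * g y))"
    unfolding T_def by (intro Bochner_Integration.integral_cong) (auto simp: algebra_simps)
  also have "\<dots> = c * T f x + d * T g x"
    unfolding T_def using assms
    by (subst Bochner_Integration.integral_add) (auto intro!: T_integrable)
  finally show ?thesis .
qed

lemma T_measurable:
  assumes "f \<in> L2 M2"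
  shows "T f \<in> borel_measurable M1"
proof -
  note kernel_measurable[measurable]
  have [measurable]: "f \<in> borel_measurable M2" using assms by (rule L2_measurable)
  show ?thesis unfolding T_def by measurable
qed

lemma T_bound:
  assumes f: "f \<in> L2 M2"
  shows "T f \<in> L2 M1" "L2_norm M1 (T f) \<le> C * L2_norm M2 f"
proof -
  have [measurable]: "f \<in> borel_measurable M2" using f by (rule L2_measurable)
  have "(\<integral>\<^sup>+x. ennreal ((cmod (T f x))\<^sup>2) \<partial>M1)
      \<le> (\<integral>\<^sup>+x. (\<integral>\<^sup>+y. ennreal (\<kappa> x y) * ennreal (cmod (f y)) \<partial>M2)\<^sup>2 \<partial>M1)"
  proof (rule nn_integral_mono)
    fix x assume x: "x \<in> space M1"
    have "ennreal ((cmod (T f x))\<^sup>2) = (ennreal (cmod (T f x)))\<^sup>2" by (simp add: ennreal_power)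
    also have "\<dots> \<le> (\<integral>\<^sup>+y. ennreal (cmod (complex_of_real (\<kappa> x y) * f y)) \<partial>M2)\<^sup>2"
      unfolding T_def by (intro power_mono_ennreal integral_norm_bound_ennreal T_integrable f x)
    also have "\<dots> = (\<integral>\<^sup>+y. ennreal (\<kappa> x y) * ennreal (cmod (f y)) \<partial>M2)\<^sup>2"
      by (simp add: norm_mult ennreal_mult kernel_nonneg)
    finally show "ennreal ((cmod (T f x))\<^sup>2) \<le> (\<integral>\<^sup>+y. ennreal (\<kappa> x y) * ennreal (cmod (f y)) \<partial>M2)\<^sup>2" .
  qed
  also have "\<dots> \<le> ennreal (C\<^sup>2) * (\<integral>\<^sup>+y. (ennreal (cmod (f y)))\<^sup>2 \<partial>M2)"
    by (rule bound) measurable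
  also have "\<dots> = ennreal ((C * L2_norm M2 f)\<^sup>2)"
    by (simp add: ennreal_power L2_norm_nn[OF f, symmetric] ennreal_mult[symmetric] power_mult_distrib)
  finally have *: "(\<integral>\<^sup>+x. ennreal ((cmod (T f x))\<^sup>2) \<partial>M1) \<le> ennreal ((C * L2_norm M2 f)\<^sup>2)" .
  show "T f \<in> L2 M1" "L2_norm M1 (T f) \<le> C * L2_norm M2 f"
    using L2_norm_le_nn[OF T_measurable[OF f] *] C_pos by auto
qed

end

section \<open>The adjoint of an integral operator\<close>

context kernel_operator
begin

interpretation flip: kernel_operator M2 M1 "\<lambda>y x. \<kappa> x y" C by (rule flip)

text \<open>Fubini; the double integral converges absolutely by Cauchy-Schwarz in \<open>x\<close>
  and the norm bound applied to the absolute value of \<open>f\<close>.\<close>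

lemma T_adjoint:
  assumes f: "f \<in> L2 M2" and g: "g \<in> L2 M1"
  shows "L2_inner M1 (T f) g = L2_inner M2 f (flip.T g)"
proof -
  note kernel_measurable[measurable]
  have [measurable]: "f \<in> borel_measurable M2" "g \<in> borel_measurable M1"
    using f g by (auto dest: L2_measurable)
  define \<Phi> where "\<Phi> x y = complex_of_real (\<kappa> x y) * f y * cnj (g x)" for x y
  have int: "integrable (M1 \<Otimes>\<^sub>M M2) (case_prod \<Phi>)"
  proof (rule integrableI_bounded)
    show \<Phi>m [measurable]: "case_prod \<Phi> \<in> borel_measurable (M1 \<Otimes>\<^sub>M M2)"
      unfolding \<Phi>_def by measurable
    have "(\<integral>\<^sup>+z. ennreal (norm (case_prod \<Phi> z)) \<partial>(M1 \<Otimes>\<^sub>M M2))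
        = (\<integral>\<^sup>+x. (\<integral>\<^sup>+y. ennreal (norm (\<Phi> x y)) \<partial>M2) \<partial>M1)"
      using M2.nn_integral_fst[of "\<lambda>z. ennreal (norm (case_prod \<Phi> z))" M1]
        measurable_compose[OF measurable_compose[OF \<Phi>m borel_measurable_norm] measurable_ennreal]
      by simp
    also have "\<dots> = (\<integral>\<^sup>+x. ennreal (cmod (g x)) * (\<integral>\<^sup>+y. ennreal (\<kappa> x y) * ennreal (cmod (f y)) \<partial>M2) \<partial>M1)"
    proof (rule nn_integral_cong)
      fix x assume x: "x \<in> space M1"
      have [measurable]: "\<kappa> x \<in> borel_measurable M2"
        using measurable_compose[OF measurable_Pair1'[OF x] kernel_measurable] by simp
      show "(\<integral>\<^sup>+y. ennreal (norm (\<Phi> x y)) \<partial>M2)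
          = ennreal (cmod (g x)) * (\<integral>\<^sup>+y. ennreal (\<kappa> x y) * ennreal (cmod (f y)) \<partial>M2)"
        by (subst nn_integral_cmult[symmetric])
          (auto simp: \<Phi>_def norm_mult ennreal_mult kernel_nonneg mult_ac)
    qed
    also have "\<dots> < \<infinity>"
    proof -
      have "(\<integral>\<^sup>+x. ennreal (cmod (g x)) * (\<integral>\<^sup>+y. ennreal (\<kappa> x y) * ennreal (cmod (f y)) \<partial>M2) \<partial>M1)\<^sup>2
          \<le> (\<integral>\<^sup>+x. (ennreal (cmod (g x)))\<^sup>2 \<partial>M1) *
            (\<integral>\<^sup>+x. (\<integral>\<^sup>+y. ennreal (\<kappa> x y) * ennreal (cmod (f y)) \<partial>M2)\<^sup>2 \<partial>M1)"
        by (rule Cauchy_Schwarz_nn_integral) measurable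
      also have "\<dots> \<le> (\<integral>\<^sup>+x. (ennreal (cmod (g x)))\<^sup>2 \<partial>M1) *
          (ennreal (C\<^sup>2) * (\<integral>\<^sup>+y. (ennreal (cmod (f y)))\<^sup>2 \<partial>M2))"
        by (intro mult_left_mono bound) auto
      also have "\<dots> < \<infinity>"
        by (simp add: ennreal_power L2_norm_nn[OF f, symmetric] L2_norm_nn[OF g, symmetric] ennreal_mult_less_top)
      finally show ?thesis by (simp add: power_less_top_ennreal)
    qed
    finally show "(\<integral>\<^sup>+z. ennreal (norm (case_prod \<Phi> z)) \<partial>(M1 \<Otimes>\<^sub>M M2)) < \<infinity>" .
  qed
  have "L2_inner M1 (T f) g = (LINT x|M1. LINT y|M2. \<Phi> x y)"
    unfolding L2_inner_def
  proof (rule Bochner_Integration.integral_cong[OF refl])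
    fix x assume "x \<in> space M1"
    then show "T f x * cnj (g x) = (LINT y|M2. \<Phi> x y)"
      unfolding T_def \<Phi>_def using T_integrable[OF f] by simp
  qed
  also have "\<dots> = (LINT y|M2. LINT x|M1. \<Phi> x y)"
    by (rule Fubini_integral[symmetric, OF int])
  also have "\<dots> = L2_inner M2 f (flip.T g)"
    unfolding L2_inner_def
  proof (rule Bochner_Integration.integral_cong[OF refl])
    fix y assume y: "y \<in> space M2"
    have "(LINT x|M1. \<Phi> x y) = (LINT x|M1. f y * cnj (complex_of_real (\<kappa> x y) * g x))"
      unfolding \<Phi>_def by (intro Bochner_Integration.integral_cong) auto
    also have "\<dots> = f y * (LINT x|M1. cnj (complex_of_real (\<kappa> x y) * g x))"
      by (rule integral_mult_right_zero)
    also have "\<dots> = f y * cnj (flip.T g y)"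
      unfolding flip.T_def by (simp only: Bochner_Integration.integral_cnj)
    finally show "(LINT x|M1. \<Phi> x y) = f y * cnj (flip.T g y)" .
  qed
  finally show ?thesis .
qed

end

section \<open>Products of an integral operator with its adjoint\<close>

context kernel_operator
begin

interpretation flip: kernel_operator M2 M1 "\<lambda>y x. \<kappa> x y" C by (rule flip)

text \<open>Evaluation at \<open>x\<close> is an inner product with the row of \<open>x\<close>, so
  the adjoint relation exchanges the integrals without another use of Fubini.\<close>

lemma gram_kernel:
  assumes g: "g \<in> L2 M1" and x: "x \<in> space M1"
  shows "T (flip.T g) x = (LINT x'|M1. complex_of_real (LINT y|M2. \<kappa> x y * \<kappa> x' y) * g x')"
proof -
  let ?h = "\<lambda>y. complex_of_real (\<kappa> x y)"
  have "T (flip.T g) x = L2_inner M2 (flip.T g) ?h"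
    unfolding T_def L2_inner_def by (simp add: mult.commute)
  also have "\<dots> = L2_inner M1 g (T ?h)"
    by (rule flip.T_adjoint[OF g row_L2[OF x]])
  also have "\<dots> = (LINT x'|M1. complex_of_real (LINT y|M2. \<kappa> x y * \<kappa> x' y) * g x')"
    unfolding L2_inner_def T_def
    by (intro Bochner_Integration.integral_cong refl)
      (simp add: mult.commute flip: of_real_mult)
  finally show ?thesis .
qed

lemma gram_kernel_integrable:
  assumes g: "g \<in> L2 M1" and x: "x \<in> space M1"
  shows "integrable M1 (\<lambda>x'. complex_of_real (LINT y|M2. \<kappa> x y * \<kappa> x' y) * g x')"
proof -
  have "T (\<lambda>y. complex_of_real (\<kappa> x y)) = (\<lambda>x'. complex_of_real (LINT y|M2. \<kappa> x y * \<kappa> x' y))"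
    unfolding T_def by (simp add: mult.commute flip: of_real_mult)
  then show ?thesis
    using L2_prod_integrable[OF T_bound(1)[OF row_L2[OF x]] g] by simp
qed

text \<open>\<open>P\<close> is the operator in its own definition, which agrees with the product
  only for arguments in \<open>L2\<close> and at points of the space.\<close>

lemma gram_ops:
  assumes P: "\<And>g x. g \<in> L2 M1 \<Longrightarrow> x \<in> space M1 \<Longrightarrow> P g x = T (flip.T g) x"
  shows gram_L2: "\<And>g. g \<in> L2 M1 \<Longrightarrow> P g \<in> L2 M1"
    and gram_inner: "\<And>f g. f \<in> L2 M1 \<Longrightarrow> g \<in> L2 M1 \<Longrightarrow> L2_inner M1 (P f) g = L2_inner M2 (flip.T f) (flip.T g)"
    and gram_selfadjoint: "L2_selfadjoint M1 P"
    and gram_nonneg: "L2_nonneg M1 P"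
proof -
  have TT: "T (flip.T g) \<in> L2 M1" if "g \<in> L2 M1" for g
    using that by (intro T_bound flip.T_bound)
  show L2: "P g \<in> L2 M1" if g: "g \<in> L2 M1" for g
  proof -
    have "P g \<in> borel_measurable M1"
      using L2_measurable[OF TT[OF g]] P[OF g] by (simp cong: measurable_cong)
    moreover have "integrable M1 (\<lambda>x. (cmod (P g x))\<^sup>2)"
      using L2_integrable_sq[OF TT[OF g]] P[OF g] by (simp cong: Bochner_Integration.integrable_cong)
    ultimately show ?thesis by (simp add: L2_def)
  qed
  have AE: "AE x in M1. P g x = T (flip.T g) x" if g: "g \<in> L2 M1" for g
    using P[OF g] by (intro AE_I2)
  show inner: "L2_inner M1 (P f) g = L2_inner M2 (flip.T f) (flip.T g)" if "f \<in> L2 M1" "g \<in> L2 M1" for f g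
  proof -
    have "L2_inner M1 (P f) g = L2_inner M1 (T (flip.T f)) g"
      using that by (intro L2_inner_cong_AE AE L2 TT) auto
    then show ?thesis using that by (simp add: T_adjoint flip.T_bound)
  qed
  have bounded: "L2_bounded_op M1 P"
    unfolding L2_bounded_op_def L2_linear_on_def
  proof (intro conjI ballI allI exI[of _ "C * C"] L2)
    fix f g c d assume fg: "f \<in> L2 M1" "g \<in> L2 M1"
    have *: "T (flip.T (\<lambda>y. c * f y + d * g y)) x = c * T (flip.T f) x + d * T (flip.T g) x"
      if x: "x \<in> space M1" for x
    proof -
      have "T (flip.T (\<lambda>y. c * f y + d * g y)) x = T (\<lambda>y. c * flip.T f y + d * flip.T g y) x"
        unfolding T_def[of "flip.T _"] T_def[of "\<lambda>y. c * flip.T f y + _ y"]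
        using fg by (intro Bochner_Integration.integral_cong) (auto simp: flip.T_lincomb)
      then show ?thesis using fg x by (simp add: T_lincomb flip.T_bound)
    qed
    show "AE x in M1. P (\<lambda>y. c * f y + d * g y) x = c * P f x + d * P g x"
      using fg by (intro AE_I2) (simp add: P * L2_lincomb)
  next
    fix f assume f: "f \<in> L2 M1"
    have "L2_norm M1 (P f) = L2_norm M1 (T (flip.T f))"
      using f by (intro L2_norm_cong_AE AE L2 TT)
    also have "\<dots> \<le> C * L2_norm M2 (flip.T f)" using f by (intro T_bound flip.T_bound)
    also have "\<dots> \<le> C * (C * L2_norm M1 f)" using f C_pos by (intro mult_left_mono flip.T_bound) auto
    finally show "L2_norm M1 (P f) \<le> C * C * L2_norm M1 f" by (simp add: mult.assoc)
  qed
  show "L2_selfadjoint M1 P"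
    unfolding L2_selfadjoint_def
  proof (intro conjI bounded ballI)
    fix f g assume "f \<in> L2 M1" "g \<in> L2 M1"
    then show "L2_inner M1 (P f) g = L2_inner M1 f (P g)"
      using L2_inner_commute[of M1 f "P g"] L2_inner_commute[of M2 "flip.T f" "flip.T g"]
      by (simp add: inner)
  qed
  show "L2_nonneg M1 P"
    unfolding L2_nonneg_def using bounded by (auto simp: inner L2_inner_self)
qed

end

section \<open>Unitary equivalence of the two products\<close>

context kernel_operator
begin

interpretation flip: kernel_operator M2 M1 "\<lambda>y x. \<kappa> x y" C by (rule flip)

lemma gram_unitarily_equiv:
  assumes P: "\<And>g x. g \<in> L2 M1 \<Longrightarrow> x \<in> space M1 \<Longrightarrow> P g x = T (flip.T g) x"
    and Q: "\<And>g x. g \<in> L2 M2 \<Longrightarrow> x \<in> space M2 \<Longrightarrow> Q g x = flip.T (T g) x"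
  shows "unitarily_equiv_mod_ker M1 P M2 Q"
proof -
  let ?c = "complex_of_real (1 / C)"
  \<comment> \<open>Division by \<open>C\<close> makes both maps contractions. The map in the role
    of \<open>N\<close> is the adjoint of \<open>T\<close>, so that \<open>P\<close> is C^2 times
    \<open>Ns\<close> after \<open>N\<close>.\<close>
  interpret L2_contraction_pair M1 M2 "\<lambda>f y. ?c * flip.T f y" "\<lambda>f x. ?c * T f x"
  proof
    show "(\<lambda>y. ?c * flip.T f y) \<in> L2 M2" if "f \<in> L2 M1" for f
      using that by (intro L2_scale flip.T_bound)
    show "(\<lambda>y. ?c * T f y) \<in> L2 M1" if "f \<in> L2 M2" for f
      using that by (intro L2_scale T_bound)
    show "L2_inner M2 (\<lambda>y. ?c * flip.T f y) g = L2_inner M1 f (\<lambda>x. ?c * T g x)"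
      if "f \<in> L2 M1" "g \<in> L2 M2" for f g
      using that by (simp only: L2_inner_scale flip.T_bound T_bound flip.T_adjoint complex_cnj_complex_of_real)
    show "L2_norm M2 (\<lambda>y. ?c * flip.T f y) \<le> L2_norm M1 f" if "f \<in> L2 M1" for f
      using flip.T_bound(2)[OF that] flip.T_bound(1)[OF that] C_pos
      by (simp only: L2_norm_scale) (simp add: norm_divide divide_simps mult.commute)
  qed
  have scale: "T (\<lambda>y. ?c * f y) x = ?c * T f x" if "f \<in> L2 M2" "x \<in> space M1" for f x
    using T_lincomb[OF that(1) that(1) that(2), of ?c 0] by simp
  have scale': "flip.T (\<lambda>y. ?c * f y) x = ?c * flip.T f x" if "f \<in> L2 M1" "x \<in> space M2" for f x
    using flip.T_lincomb[OF that(1) that(1) that(2), of ?c 0] by simp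
  have c: "complex_of_real (C\<^sup>2) * (?c * (?c * z)) = z" for z
    using C_pos by (simp add: power2_eq_square)
  show ?thesis
  proof (rule unitarily_equiv_mod_ker_gram[of "complex_of_real (C\<^sup>2)"])
    show "complex_of_real (C\<^sup>2) \<noteq> 0" using C_pos by simp
    show "P f \<in> L2 M1" if "f \<in> L2 M1" for f using gram_L2[of P, OF P that] .
    show "Q f \<in> L2 M2" if "f \<in> L2 M2" for f using flip.gram_L2[of Q, OF Q that] .
    show "AE x in M1. P f x = complex_of_real (C\<^sup>2) * (?c * T (\<lambda>y. ?c * flip.T f y) x)" if "f \<in> L2 M1" for f
      using that by (intro AE_I2) (simp only: P scale flip.T_bound c)
    show "AE x in M2. Q f x = complex_of_real (C\<^sup>2) * (?c * flip.T (\<lambda>y. ?c * T f y) x)" if "f \<in> L2 M2" for f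
      using that by (intro AE_I2) (simp only: Q scale' T_bound c)
  qed
qed

end

section \<open>The regular part of the zeta function\<close>

text \<open>Prepares the integral of u^(-1-a) (ln u)^k / k! over [1, infinity), which is a^(-k-1).
  The antiderivative is normalized to vanish at infinity, so minus its value at 1 is the integral;
  induction on \<open>k\<close> is integration by parts.\<close>

lemma powr_ln_antiderivative:
  fixes a :: real
  assumes a: "0 < a"
  shows "\<exists>F. (\<forall>u\<ge>1. (F has_real_derivative (u powr (-1-a) * ln u ^ k / fact k)) (at u))
    \<and> (F \<longlongrightarrow> 0) at_top \<and> F 1 = - (1 / a ^ Suc k)"
proof (induction k)
  case 0
  have "((\<lambda>u. - (u powr (-a)) / a) has_real_derivative u powr (-1-a)) (at u)" if "u \<ge> 1" for u
    using that a by (auto intro!: derivative_eq_intros simp: field_simps minus_diff_commute)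
  moreover have "((\<lambda>u. - (u powr (-a)) / a) \<longlongrightarrow> - 0 / a) at_top"
    using a by (intro tendsto_intros tendsto_neg_powr filterlim_ident) auto
  ultimately show ?case by (intro exI[of _ "\<lambda>u. - (u powr (-a)) / a"]) simp
next
  case (Suc k)
  then obtain F where F: "\<And>u. u \<ge> 1 \<Longrightarrow> (F has_real_derivative (u powr (-1-a) * ln u ^ k / fact k)) (at u)"
    "(F \<longlongrightarrow> 0) at_top" "F 1 = - (1 / a ^ Suc k)" by blast
  \<comment> \<open>Integration by parts with -u^(-a) / a as the antiderivative of u^(-1-a); the
    remaining integral is \<open>F\<close>.\<close>
  let ?G = "\<lambda>u. (F u - u powr (-a) * ln u ^ Suc k / fact (Suc k)) / a"
  have "(?G has_real_derivative (u powr (-1-a) * ln u ^ Suc k / fact (Suc k))) (at u)" if u: "u \<ge> 1" for u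
  proof -
    have "(?G has_real_derivative ((u powr (-1-a) * ln u ^ k / fact k) -
        ((-a) * u powr (-a - 1) * ln u ^ Suc k + u powr (-a) * (real (Suc k) * ln u ^ k * (1 / u))) / fact (Suc k)) / a) (at u)"
      using u a by (auto intro!: derivative_eq_intros F simp del: fact_Suc power_Suc)
    also have "u powr (-a) * (real (Suc k) * ln u ^ k * (1 / u)) = u powr (-1-a) * real (Suc k) * ln u ^ k"
    proof -
      have "u powr (-1-a) = u powr (-a) * (1 / u)"
        using u powr_add[of u "-a" "-1"] by (simp add: powr_minus_divide minus_diff_commute)
      then show ?thesis by (simp only: mult_ac)
    qed
    also have "((u powr (-1-a) * ln u ^ k / fact k) -
        ((-a) * u powr (-a - 1) * ln u ^ Suc k + u powr (-1-a) * real (Suc k) * ln u ^ k) / fact (Suc k)) / a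
        = u powr (-1-a) * ln u ^ Suc k / fact (Suc k)"
    proof -
      have "u powr (-1-a) * real (Suc k) * ln u ^ k / fact (Suc k) = u powr (-1-a) * ln u ^ k / fact k"
        by (simp add: field_simps del: of_nat_Suc)
      moreover have "- a - 1 = -1 - a" by simp
      ultimately show ?thesis using a
        by (simp only: add_divide_distrib) (simp add: field_simps del: fact_Suc power_Suc)
    qed
    finally show ?thesis .
  qed
  moreover have "(?G \<longlongrightarrow> (0 - (1 / a ^ Suc k) * 0 / fact (Suc k)) / a) at_top"
  proof -
    have "filterlim (\<lambda>u. a * ln u) at_top at_top"
      using a by (intro filterlim_tendsto_pos_mult_at_top[OF tendsto_const] ln_at_top)
    \<comment> \<open>With y = a ln u the boundary term becomes a multiple of y^(k+1) / exp
      y.\<close>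
    from filterlim_compose[OF tendsto_power_div_exp_0[of "Suc k"] this]
    have "((\<lambda>u. (1 / a ^ Suc k) * ((a * ln u) ^ Suc k / exp (a * ln u))) \<longlongrightarrow> (1 / a ^ Suc k) * 0) at_top"
      by (intro tendsto_mult_left)
    moreover have "\<forall>\<^sub>F u in at_top. (1 / a ^ Suc k) * ((a * ln u) ^ Suc k / exp (a * ln u)) = u powr (-a) * ln u ^ Suc k"
      using a by (intro eventually_mono[OF eventually_gt_at_top[of 0]])
        (simp add: powr_def exp_minus power_mult_distrib divide_simps del: power_Suc)
    ultimately have pw: "((\<lambda>u. u powr (-a) * ln u ^ Suc k) \<longlongrightarrow> (1 / a ^ Suc k) * 0) at_top"
      by (rule Lim_transform_eventually)
    show ?thesis by (intro tendsto_divide tendsto_diff F(2) pw tendsto_const) (use a in auto)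
  qed
  ultimately show ?case by (intro exI[of _ ?G]) (simp add: F del: fact_Suc)
qed

lemma has_bochner_integral_powr_ln:
  fixes a :: real
  assumes a: "0 < a"
  shows "has_bochner_integral lborel (\<lambda>u. indicator {1..} u * (u powr (-1-a) * ln u ^ k / fact k)) (1 / a ^ Suc k)"
proof (rule has_bochner_integral_nn_integral)
  obtain F where F: "\<And>u. u \<ge> 1 \<Longrightarrow> (F has_real_derivative (u powr (-1-a) * ln u ^ k / fact k)) (at u)"
    "(F \<longlongrightarrow> 0) at_top" "F 1 = - (1 / a ^ Suc k)"
    using powr_ln_antiderivative[OF a, of k] by blast
  have "(\<integral>\<^sup>+u. ennreal (u powr (-1-a) * ln u ^ k / fact k) * indicator {1..} u \<partial>lborel) = ennreal (0 - F 1)"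
    by (rule nn_integral_FTC_atLeast[OF _ F(1) _ F(2)]) auto
  also have "(\<integral>\<^sup>+u. ennreal (u powr (-1-a) * ln u ^ k / fact k) * indicator {1..} u \<partial>lborel)
      = (\<integral>\<^sup>+u. ennreal (indicator {1..} u * (u powr (-1-a) * ln u ^ k / fact k)) \<partial>lborel)"
    by (intro nn_integral_cong) (auto split: split_indicator)
  finally show "(\<integral>\<^sup>+u. ennreal (indicator {1..} u * (u powr (-1-a) * ln u ^ k / fact k)) \<partial>lborel) = ennreal (1 / a ^ Suc k)"
    by (simp add: F(3))
  show "AE u in lborel. 0 \<le> indicator {1..} u * (u powr (-1-a) * ln u ^ k / fact k)"
    by (auto split: split_indicator)
qed (use a in auto)

text \<open>One minus the fractional part. Compared with the centred sawtooth this choice keeps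
  every integrand below non-negative.\<close>

definition sawtooth :: "real \<Rightarrow> real" where
  "sawtooth u = real_of_int \<lfloor>u\<rfloor> + 1 - u"

lemma sawtooth_bounds: "0 \<le> sawtooth u" "sawtooth u \<le> 1"
  unfolding sawtooth_def by linarith+

lemma sawtooth_measurable [measurable]: "sawtooth \<in> borel_measurable borel"
  unfolding sawtooth_def[abs_def] by measurable

text \<open>An integral representation of zeta(1+s) - 1/s that also makes sense at s = 0, where it
  gives Euler's constant.\<close>

definition zeta_reg :: "real \<Rightarrow> real" where
  "zeta_reg s = (1 + s) * (LINT u|lborel. indicator {1..} u * (sawtooth u * u powr (-2-s)))"

lemma sawtooth_moment_integrable:
  assumes s: "-1 < s"
  shows "integrable lborel (\<lambda>u. indicator {1..} u * (sawtooth u * (u powr (-2-s) * ln u ^ k / fact k)))"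
proof (rule Bochner_Integration.integrable_bound)
  show "integrable lborel (\<lambda>u. indicator {1..} u * (u powr (-1-(1+s)) * ln u ^ k / fact k))"
    using integrable.intros[OF has_bochner_integral_powr_ln[of "1+s" k]] s by simp
  have "\<bar>sawtooth u * x\<bar> \<le> \<bar>x\<bar>" for u x
    using sawtooth_bounds[of u] by (simp add: abs_mult mult_left_le_one_le)
  moreover have "-1 - (1 + s) = -2 - s" by simp
  ultimately show "AE u in lborel. norm (indicator {1..} u * (sawtooth u * (u powr (-2-s) * ln u ^ k / fact k)))
      \<le> norm (indicator {1..} u * (u powr (-1-(1+s)) * ln u ^ k / fact k))"
    by (intro AE_I2) (simp only: real_norm_def mult.left_commute[of "indicator {1..} _" "sawtooth _"])
qed measurable

lemma zeta_reg_bounds: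
  assumes s: "0 \<le> s"
  shows "0 \<le> zeta_reg s" "zeta_reg s \<le> 1"
proof -
  have 1: "has_bochner_integral lborel (\<lambda>u. indicator {1..} u * u powr (-2-s)) (1 / (1+s))"
    using has_bochner_integral_powr_ln[of "1+s" 0] s minus_add_distrib[of 1 "1 + s"]
    by (simp add: diff_diff_add[symmetric])
  have "0 \<le> (LINT u|lborel. indicator {1..} u * (sawtooth u * u powr (-2-s)))"
    by (intro Bochner_Integration.integral_nonneg) (auto simp: sawtooth_bounds)
  then show "0 \<le> zeta_reg s" using s by (simp add: zeta_reg_def)
  have "(LINT u|lborel. indicator {1..} u * (sawtooth u * u powr (-2-s)))
      \<le> (LINT u|lborel. indicator {1..} u * u powr (-2-s))"
  proof (rule integral_mono)
    show "integrable lborel (\<lambda>u. indicator {1..} u * (sawtooth u * u powr (-2-s)))"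
      using sawtooth_moment_integrable[of s 0] s by simp
    show "integrable lborel (\<lambda>u. indicator {1..} u * u powr (-2-s))"
      using 1 by (rule integrable.intros)
  qed (auto simp: sawtooth_bounds mult_left_le_one_le split: split_indicator)
  also have "\<dots> = 1 / (1+s)" using 1 by (rule has_bochner_integral_integral_eq)
  finally have "(1+s) * (LINT u|lborel. indicator {1..} u * (sawtooth u * u powr (-2-s))) \<le> (1+s) * (1 / (1+s))"
    using s by (intro mult_left_mono) auto
  then show "zeta_reg s \<le> 1" using s by (simp add: zeta_reg_def)
qed

text \<open>Euler--Maclaurin summation of order one.\<close>

lemma zeta_eq:
  assumes s: "0 < s"
  shows "(\<lambda>j. real (Suc j) powr (-1-s)) sums (1 / s + zeta_reg s)"
proof -
  \<comment> \<open>The term at n = j + 1 minus the integral of u^(-1-s) over [n, n + 1].\<close>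
  define c where "c j = real (Suc j) powr (-1-s) - (real (Suc j) powr (-s) - real (Suc (Suc j)) powr (-s)) / s" for j
  have piece: "(\<integral>\<^sup>+u. ennreal ((1+s) * (sawtooth u * u powr (-2-s))) * indicator {real (Suc j)..<real (Suc (Suc j))} u \<partial>lborel)
      = ennreal (c j)" and c_nonneg: "0 \<le> c j" for j
  proof -
    \<comment> \<open>Integrating by parts on one unit interval, where the sawtooth is the linear
      function j + 2 - u.\<close>
    let ?F = "\<lambda>u. u powr (-s) / s - (real (Suc (Suc j)) - u) * u powr (-1-s)"
    let ?f = "\<lambda>u. (1+s) * ((real (Suc (Suc j)) - u) * u powr (-2-s))"
    have der: "(?F has_real_derivative ?f u) (at u)" if "real (Suc j) \<le> u" for u
    proof -
      have u: "0 < u" using that by linarith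
      have 1: "u powr (-s-1) = u powr (-1-s)" "u powr (-1-s-1) = u powr (-2-s)"
        by (rule arg_cong[where f="\<lambda>z. u powr z"], simp)+
      have "(?F has_real_derivative ((-s) * u powr (-s-1) / s -
         ((0 - 1) * u powr (-1-s) + ((-1-s) * u powr (-1-s-1)) * (real (Suc (Suc j)) - u)))) (at u)"
        using u s by (auto intro!: derivative_eq_intros)
      also have "(-s) * u powr (-s-1) / s -
         ((0 - 1) * u powr (-1-s) + ((-1-s) * u powr (-1-s-1)) * (real (Suc (Suc j)) - u)) = ?f u"
        using s unfolding 1 by (simp add: algebra_simps)
      finally show ?thesis .
    qed
    have nn: "0 \<le> ?f u" if "u \<le> real (Suc (Suc j))" for u using that s by simp
    have FTC: "has_bochner_integral lborel (\<lambda>u. ?f u * indicator {real (Suc j)..real (Suc (Suc j))} u)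
        (?F (real (Suc (Suc j))) - ?F (real (Suc j)))"
      using der nn s by (intro has_bochner_integral_FTC_Icc_nonneg)
        (auto intro!: continuous_intros DERIV_subset simp del: of_nat_Suc)
    have "?F (real (Suc (Suc j))) - ?F (real (Suc j)) = c j"
      using s by (simp add: c_def field_simps)
    with FTC have FTC: "has_bochner_integral lborel (\<lambda>u. ?f u * indicator {real (Suc j)..real (Suc (Suc j))} u) (c j)"
      by simp
    have nn2: "AE u in lborel. 0 \<le> ?f u * indicator {real (Suc j)..real (Suc (Suc j))} u"
      using nn by (auto split: split_indicator simp del: of_nat_Suc)
    show "0 \<le> c j"
      using has_bochner_integral_integral_eq[OF FTC] integral_nonneg_AE[OF nn2] by simp
    have "(\<integral>\<^sup>+u. ennreal ((1+s) * (sawtooth u * u powr (-2-s))) * indicator {real (Suc j)..<real (Suc (Suc j))} u \<partial>lborel)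
      = (\<integral>\<^sup>+u. ennreal (?f u * indicator {real (Suc j)..real (Suc (Suc j))} u) \<partial>lborel)"
    \<comment> \<open>At the right endpoint the floor jumps and the sawtooth differs from the linear
      function; this is a single point.\<close>
    proof (rule nn_integral_cong_AE)
      have "AE u in lborel. u \<noteq> real (Suc (Suc j))" by (rule AE_lborel_singleton)
      then show "AE u in lborel. ennreal ((1+s) * (sawtooth u * u powr (-2-s))) * indicator {real (Suc j)..<real (Suc (Suc j))} u
          = ennreal (?f u * indicator {real (Suc j)..real (Suc (Suc j))} u)"
      proof eventually_elim
        case (elim u)
        show ?case
        proof (cases "real (Suc j) \<le> u \<and> u < real (Suc (Suc j))")
          case True
          then have "\<lfloor>u\<rfloor> = int (Suc j)" by (intro floor_unique) auto
          then have "sawtooth u = real (Suc (Suc j)) - u" by (simp add: sawtooth_def)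
          then show ?thesis using True by simp
        next
          case False
          then show ?thesis using elim by (auto split: split_indicator)
        qed
      qed
    qed
    also have "\<dots> = ennreal (c j)"
      using FTC nn2 \<open>0 \<le> c j\<close> by (simp add: nn_integral_eq_integral has_bochner_integral_iff)
    finally show "(\<integral>\<^sup>+u. ennreal ((1+s) * (sawtooth u * u powr (-2-s))) * indicator {real (Suc j)..<real (Suc (Suc j))} u \<partial>lborel)
      = ennreal (c j)" .
  qed
  have "summable (\<lambda>n. real n powr (-1-s))" using s by (subst summable_real_powr_iff) simp
  then have sm: "summable (\<lambda>j. real (Suc j) powr (-1-s))"
    by (subst summable_Suc_iff[of "\<lambda>n. real n powr (-1-s)"])
  have tele: "(\<lambda>j. (real (Suc j) powr (-s) - real (Suc (Suc j)) powr (-s)) / s) sums ((real (Suc 0) powr (-s) - 0) / s)"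
  proof (intro sums_divide telescope_sums')
    have "filterlim (\<lambda>n. real (Suc n)) at_top sequentially"
      by (rule filterlim_compose[OF filterlim_real_sequentially filterlim_Suc])
    then show "(\<lambda>n. real (Suc n) powr (-s)) \<longlonglongrightarrow> 0"
      using s by (intro tendsto_neg_powr) auto
  qed
  have csums: "c sums ((\<Sum>j. real (Suc j) powr (-1-s)) - 1 / s)"
    unfolding c_def using sums_diff[OF summable_sums[OF sm] tele] by simp
  have un: "(\<Sum>j. indicator {real (Suc j)..<real (Suc (Suc j))} u :: ennreal) = indicator {1..} u" for u
  proof -
    have "disjoint_family (\<lambda>j. {real (Suc j)..<real (Suc (Suc j))})"
    proof (unfold disjoint_family_on_def, intro ballI impI equals0I)
      fix m n :: nat and x assume "m \<noteq> n" "x \<in> {real (Suc m)..<real (Suc (Suc m))} \<inter> {real (Suc n)..<real (Suc (Suc n))}"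
      then have "real (Suc m) < real (Suc (Suc n))" "real (Suc n) < real (Suc (Suc m))" by auto
      then show False using \<open>m \<noteq> n\<close> by linarith
    qed
    then have "(\<Sum>j. indicator {real (Suc j)..<real (Suc (Suc j))} u :: ennreal)
        = indicator (\<Union>j. {real (Suc j)..<real (Suc (Suc j))}) u"
      by (rule suminf_indicator)
    also have "(\<Union>j. {real (Suc j)..<real (Suc (Suc j))}) = {1..}"
    proof (intro equalityI subsetI)
      fix x :: real assume "x \<in> {1..}"
      then have "real (nat \<lfloor>x\<rfloor>) = of_int \<lfloor>x\<rfloor>" "1 \<le> nat \<lfloor>x\<rfloor>" by (auto simp: le_nat_floor)
      then have "1 \<le> nat \<lfloor>x\<rfloor>" "real (nat \<lfloor>x\<rfloor>) \<le> x" "x < real (nat \<lfloor>x\<rfloor>) + 1" by linarith+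
      then show "x \<in> (\<Union>j. {real (Suc j)..<real (Suc (Suc j))})"
        by (intro UN_I[of "nat \<lfloor>x\<rfloor> - 1"]) (auto, linarith)
    qed auto
    finally show ?thesis .
  qed
  have "(\<integral>\<^sup>+u. ennreal ((1+s) * (indicator {1..} u * (sawtooth u * u powr (-2-s)))) \<partial>lborel)
      = (\<integral>\<^sup>+u. (\<Sum>j. ennreal ((1+s) * (sawtooth u * u powr (-2-s))) * indicator {real (Suc j)..<real (Suc (Suc j))} u) \<partial>lborel)"
    unfolding ennreal_suminf_cmult un by (intro nn_integral_cong) (auto split: split_indicator)
  also have "\<dots> = (\<Sum>j. \<integral>\<^sup>+u. ennreal ((1+s) * (sawtooth u * u powr (-2-s))) * indicator {real (Suc j)..<real (Suc (Suc j))} u \<partial>lborel)"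
    by (rule nn_integral_suminf) measurable
  also have "\<dots> = (\<Sum>j. ennreal (c j))" by (simp only: piece)
  also have "\<dots> = ennreal ((\<Sum>j. real (Suc j) powr (-1-s)) - 1 / s)"
    using csums c_nonneg by (simp add: suminf_ennreal2 sums_iff)
  finally have "(\<integral>\<^sup>+u. ennreal ((1+s) * (indicator {1..} u * (sawtooth u * u powr (-2-s)))) \<partial>lborel)
      = ennreal ((\<Sum>j. real (Suc j) powr (-1-s)) - 1 / s)" .
  moreover have "(\<integral>\<^sup>+u. ennreal ((1+s) * (indicator {1..} u * (sawtooth u * u powr (-2-s)))) \<partial>lborel) = ennreal (zeta_reg s)"
    unfolding zeta_reg_def using sawtooth_moment_integrable[of s 0] s
    by (subst nn_integral_eq_integral) (auto simp: sawtooth_bounds)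
  moreover have "0 \<le> (\<Sum>j. real (Suc j) powr (-1-s)) - 1 / s"
    using sums_le[OF c_nonneg sums_zero csums] by simp
  ultimately have "zeta_reg s = (\<Sum>j. real (Suc j) powr (-1-s)) - 1 / s"
    using zeta_reg_bounds(1)[of s] s by simp
  then show ?thesis using summable_sums[OF sm] by simp
qed

text \<open>The remainder is itself a power series with non-negative coefficients.\<close>

lemma exp_tail_mono:
  fixes a b :: real
  assumes "0 \<le> a" "a \<le> b"
  shows "0 \<le> exp a - (\<Sum>k<r. a ^ k / fact k)"
    and "exp a - (\<Sum>k<r. a ^ k / fact k) \<le> exp b - (\<Sum>k<r. b ^ k / fact k)"
proof -
  have ex: "(\<lambda>k. x ^ k / fact k) sums exp x" for x :: real
    using exp_converges[of x] by (simp add: field_simps)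
  have tail: "(\<lambda>k. x ^ (k + r) / fact (k + r)) sums (exp x - (\<Sum>k<r. x ^ k / fact k))" for x :: real
    by (rule sums_split_initial_segment[OF ex])
  show "0 \<le> exp a - (\<Sum>k<r. a ^ k / fact k)"
    using assms by (intro sums_le[OF _ sums_zero tail]) auto
  show "exp a - (\<Sum>k<r. a ^ k / fact k) \<le> exp b - (\<Sum>k<r. b ^ k / fact k)"
    using assms by (intro sums_le[OF _ tail tail]) (auto intro!: divide_right_mono power_mono)
qed

text \<open>Expanding \<open>u powr (-2-s)\<close> in powers of \<open>S - s\<close>: all terms are non-negative, so the error is largest
  for \<open>s = 0\<close>, where it can be summed explicitly.\<close>

lemma zeta_reg_poly_approx:
  assumes S: "0 < S"
  obtains Q :: "real poly" where "degree Q \<le> r"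
    "\<And>s. 0 \<le> s \<Longrightarrow> s \<le> S \<Longrightarrow> \<bar>zeta_reg s - poly Q s\<bar> \<le> (1 + S) * (S / (1 + S)) ^ r"
proof -
  \<comment> \<open>\<open>g k\<close> is the coefficient of (S - s)^k in the expansion of the
    integral in \<open>zeta_reg\<close> around s = S. The factor 1 + s kept in front of the sum in
    \<open>Q\<close> raises the degree from r - 1 to r.\<close>
  define g where "g k = (LINT u|lborel. indicator {1..} u * (sawtooth u * (u powr (-2-S) * ln u ^ k / fact k)))" for k
  define Q where "Q = [:1, 1:] * (\<Sum>k<r. smult (g k) ([:S, -1:] ^ k))"
  have "degree (\<Sum>k<r. smult (g k) ([:S, -1:] ^ k)) \<le> r - 1"
  proof (rule degree_sum_le)
    fix k assume "k \<in> {..<r}"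
    have "degree (smult (g k) ([:S, -1:] ^ k)) \<le> degree ([:S, -1:] ^ k)" by (rule degree_smult_le)
    also have "\<dots> \<le> degree [:S, -1:] * k" by (rule degree_power_le)
    also have "\<dots> \<le> r - 1" using \<open>k \<in> {..<r}\<close> by simp
    finally show "degree (smult (g k) ([:S, -1:] ^ k)) \<le> r - 1" .
  qed simp
  then have deg: "degree Q \<le> r"
  proof (cases "r = 0")
    case False
    have "degree Q \<le> degree [:1, 1::real:] + degree (\<Sum>k<r. smult (g k) ([:S, -1:] ^ k))"
      unfolding Q_def by (rule degree_mult_le)
    then show ?thesis using \<open>degree (\<Sum>k<r. smult (g k) ([:S, -1:] ^ k)) \<le> r - 1\<close> False by simp
  qed (simp add: Q_def)
  have "\<bar>zeta_reg s - poly Q s\<bar> \<le> (1 + S) * (S / (1 + S)) ^ r" if s: "0 \<le> s" "s \<le> S" for s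
  proof -
    \<comment> \<open>For y = S - s this is the Taylor remainder of u^(-2-s) = u^(-2-S) exp ((S - s)
      ln u).\<close>
    let ?R = "\<lambda>y u. indicator {1..} u * (u powr (-2-S) * (exp (y * ln u) - (\<Sum>k<r. (y * ln u) ^ k / fact k)))"
    have split: "?R (S - s) u = indicator {1..} u * u powr (-2-s)
        - (\<Sum>k<r. (S - s) ^ k * (indicator {1..} u * (u powr (-2-S) * ln u ^ k / fact k)))"
      if "s \<le> S" for s u
    proof (cases "u \<ge> 1")
      case True
      then have "u powr (-2-S) * exp ((S - s) * ln u) = u powr (-2-s)"
        by (simp add: powr_def exp_add[symmetric] algebra_simps)
      then show ?thesis
        unfolding right_diff_distrib[of "u powr (-2-S)"] power_mult_distrib sum_distrib_left
        using True by (simp add: mult_ac)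
    qed simp
    have int0: "has_bochner_integral lborel (\<lambda>u. indicator {1..} u * (u powr (-2-S) * ln u ^ k / fact k)) (1 / (1+S) ^ Suc k)" for k
    proof -
      have "-1 - (1 + S) = -2 - S" by simp
      then show ?thesis using has_bochner_integral_powr_ln[of "1+S" k] S by (simp only:)
    qed
    have int1: "has_bochner_integral lborel (\<lambda>u. indicator {1..} u * u powr (-2-(0::real))) 1"
      using has_bochner_integral_powr_ln[of 1 0] by simp
    \<comment> \<open>At s = 0 and with the sawtooth bounded by 1 the remainder integrates exactly:
      1 minus a partial geometric sum with ratio S / (1 + S).\<close>
    have "has_bochner_integral lborel (?R (S - 0)) (1 - (\<Sum>k<r. (S - 0) ^ k * (1 / (1+S) ^ Suc k)))"
      unfolding split[OF less_imp_le[OF S]]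
      by (intro has_bochner_integral_diff has_bochner_integral_sum has_bochner_integral_mult_right int0 int1)
    moreover have "1 - (\<Sum>k<r. (S - 0) ^ k * (1 / (1+S) ^ Suc k)) = (S / (1+S)) ^ r"
    proof (induction r)
      case (Suc r)
      have "1 - (\<Sum>k<Suc r. (S - 0) ^ k * (1 / (1+S) ^ Suc k)) = (S / (1+S)) ^ r - S ^ r * (1 / (1+S) ^ Suc r)"
        using Suc by simp
      also have "\<dots> = (S / (1+S)) ^ Suc r"
      proof -
        define x where "x = 1 + S"
        then have "x * S ^ r = S ^ r + S * S ^ r" "x \<noteq> 0" using S by (auto simp: algebra_simps)
        then show ?thesis unfolding x_def[symmetric] by (simp add: power_divide field_simps)
      qed
      finally show ?case .
    qed simp
    ultimately have intR: "has_bochner_integral lborel (?R S) ((S / (1+S)) ^ r)" by simp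
    have sw: "zeta_reg s - poly Q s = (1 + s) * (LINT u|lborel. sawtooth u * ?R (S - s) u)"
    proof -
      have a: "integrable lborel (\<lambda>u. indicator {1..} u * (sawtooth u * u powr (-2-s)))"
        using sawtooth_moment_integrable[of s 0] s by simp
      have b: "integrable lborel (\<lambda>u. indicator {1..} u * (sawtooth u * (u powr (-2-S) * ln u ^ k / fact k)))" for k
        using sawtooth_moment_integrable[of S k] S by simp
      have "(LINT u|lborel. sawtooth u * ?R (S - s) u)
          = (LINT u|lborel. indicator {1..} u * (sawtooth u * u powr (-2-s))
            - (\<Sum>k<r. (S - s) ^ k * (indicator {1..} u * (sawtooth u * (u powr (-2-S) * ln u ^ k / fact k)))))"
        unfolding split[OF s(2)]
        by (intro Bochner_Integration.integral_cong refl) (simp add: right_diff_distrib sum_distrib_left mult_ac)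
      also have "\<dots> = (LINT u|lborel. indicator {1..} u * (sawtooth u * u powr (-2-s))) - (\<Sum>k<r. (S - s) ^ k * g k)"
        unfolding g_def
        by (subst Bochner_Integration.integral_diff[OF a Bochner_Integration.integrable_sum[OF integrable_mult_right[OF b]]],
            subst Bochner_Integration.integral_sum[OF integrable_mult_right[OF b]], subst integral_mult_right_zero, rule refl)
      finally have e: "(LINT u|lborel. sawtooth u * ?R (S - s) u)
          = (LINT u|lborel. indicator {1..} u * (sawtooth u * u powr (-2-s))) - (\<Sum>k<r. (S - s) ^ k * g k)" .
      have "poly Q s = (1 + s) * (\<Sum>k<r. (S - s) ^ k * g k)"
        by (simp add: Q_def poly_sum mult.commute distrib_right)
      then show ?thesis unfolding e zeta_reg_def by (simp only: right_diff_distrib)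
    qed
    have nn: "0 \<le> ?R (S - s) u" and le: "?R (S - s) u \<le> ?R S u" for u
    proof -
      have "0 \<le> ?R (S - s) u \<and> ?R (S - s) u \<le> ?R S u"
      proof (cases "1 \<le> u")
        case True
        have y: "0 \<le> (S - s) * ln u" "(S - s) * ln u \<le> S * ln u"
          using s True by (auto intro!: mult_nonneg_nonneg mult_right_mono)
        show ?thesis
          using True by (intro conjI mult_nonneg_nonneg mult_left_mono exp_tail_mono[OF y]) auto
      qed simp
      then show "0 \<le> ?R (S - s) u" "?R (S - s) u \<le> ?R S u" by auto
    qed
    have "0 \<le> (LINT u|lborel. sawtooth u * ?R (S - s) u)"
      by (rule Bochner_Integration.integral_nonneg) (rule mult_nonneg_nonneg[OF sawtooth_bounds(1) nn])
    moreover have "(LINT u|lborel. sawtooth u * ?R (S - s) u) \<le> (LINT u|lborel. ?R S u)"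
    proof (rule integral_mono')
      show "integrable lborel (?R S)" using intR by (rule integrable.intros)
      show "sawtooth u * ?R (S - s) u \<le> ?R S u" for u
        using mult_left_le_one_le[OF nn[of u] sawtooth_bounds[of u]] le[of u] by linarith
      show "0 \<le> ?R S u" for u using nn[of u] le[of u] by linarith
    qed
    moreover have "(LINT u|lborel. ?R S u) = (S / (1+S)) ^ r"
      using intR by (rule has_bochner_integral_integral_eq)
    ultimately have "\<bar>LINT u|lborel. sawtooth u * ?R (S - s) u\<bar> \<le> (S / (1+S)) ^ r" by simp
    then have "(1 + s) * \<bar>LINT u|lborel. sawtooth u * ?R (S - s) u\<bar> \<le> (1 + S) * (S / (1+S)) ^ r"
      using s by (intro mult_mono) auto
    then show ?thesis unfolding sw using s by (simp add: abs_mult)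
  qed
  with deg show ?thesis using that by blast
qed

text \<open>The polynomial approximations converge uniformly.\<close>

lemma zeta_reg_continuous:
  assumes S: "0 < S"
  shows "continuous_on {0..S} zeta_reg"
proof -
  have "\<exists>Q. \<forall>s\<in>{0..S}. \<bar>zeta_reg s - poly Q s\<bar> \<le> (1 + S) * (S / (1 + S)) ^ r" for r
    using zeta_reg_poly_approx[OF S, of r] by (metis atLeastAtMost_iff)
  then obtain Q where Q: "\<And>r s. s \<in> {0..S} \<Longrightarrow> \<bar>zeta_reg s - poly (Q r) s\<bar> \<le> (1 + S) * (S / (1 + S)) ^ r"
    by metis
  have lim: "(\<lambda>r. (1 + S) * (S / (1 + S)) ^ r) \<longlonglongrightarrow> (1 + S) * 0"
    using S by (intro tendsto_mult_left LIMSEQ_power_zero) (simp add: divide_simps)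
  have "uniform_limit {0..S} (\<lambda>r. poly (Q r)) zeta_reg sequentially"
  proof (rule uniform_limitI)
    fix e :: real assume "0 < e"
    then have "\<forall>\<^sub>F r in sequentially. (1 + S) * (S / (1 + S)) ^ r < e"
      using order_tendstoD(2)[OF lim, of e] by simp
    then show "\<forall>\<^sub>F r in sequentially. \<forall>s\<in>{0..S}. dist (poly (Q r) s) (zeta_reg s) < e"
    proof eventually_elim
      case (elim r)
      show ?case
      proof
        fix s assume "s \<in> {0..S}"
        then show "dist (poly (Q r) s) (zeta_reg s) < e"
          using le_less_trans[OF Q[of s r] elim] by (simp add: dist_real_def abs_minus_commute)
      qed
    qed
  qed
  moreover have "\<forall>\<^sub>F r in sequentially. continuous_on {0..S} (poly (Q r))"
    by (intro always_eventually allI continuous_on_poly continuous_on_id)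
  ultimately show ?thesis
    by (intro uniform_limit_theorem[OF _ _ sequentially_bot])
qed

section \<open>Singular values of operators with smooth kernel\<close>

text \<open>Finds, among the combinations of \<open>n\<close> eigenvectors, a nonzero one satisfying
  r < n orthogonality conditions. Gaussian elimination by induction on the number of
  equations.\<close>

lemma homogeneous_system_nontrivial:
  fixes m :: "nat \<Rightarrow> 'i \<Rightarrow> 'f::field"
  assumes "finite I" "r < card I"
  shows "\<exists>c. (\<exists>i\<in>I. c i \<noteq> 0) \<and> (\<forall>k<r. (\<Sum>i\<in>I. c i * m k i) = 0)"
  using assms
proof (induction r arbitrary: I m)
  case 0
  then obtain i where "i \<in> I" by (metis card_gt_0_iff ex_in_conv)
  then show ?case by (intro exI[of _ "\<lambda>_. 1"]) auto
next
  case (Suc r)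
  show ?case
  proof (cases "\<exists>j\<in>I. m r j \<noteq> 0")
    case False
    obtain c where "\<exists>i\<in>I. c i \<noteq> 0" "\<forall>k<r. (\<Sum>i\<in>I. c i * m k i) = 0"
      using Suc.IH[of I m] Suc.prems by auto
    moreover have "(\<Sum>i\<in>I. c i * m r i) = 0" using False by (intro sum.neutral) auto
    ultimately show ?thesis by (intro exI[of _ c]) (auto simp: less_Suc_eq)
  next
    case True
    then obtain j where j: "j \<in> I" "m r j \<noteq> 0" by blast
    define I' where "I' = I - {j}"
    \<comment> \<open>Equation \<open>r\<close> eliminates the unknown \<open>j\<close> from the
      others; \<open>d\<close> below restores the value of that unknown which equation
      \<open>r\<close> forces.\<close>
    define m' where "m' k i = m k i - m k j * (m r i / m r j)" for k i
    have I': "finite I'" "r < card I'" using Suc.prems j by (auto simp: I'_def)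
    obtain c where c: "\<exists>i\<in>I'. c i \<noteq> 0" "\<forall>k<r. (\<Sum>i\<in>I'. c i * m' k i) = 0"
      using Suc.IH[OF I', of m'] by blast
    define d where "d = c(j := - (\<Sum>i\<in>I'. c i * (m r i / m r j)))"
    have sum: "(\<Sum>i\<in>I. d i * m k i) = (\<Sum>i\<in>I'. c i * m' k i)" for k
    proof -
      have "(\<Sum>i\<in>I. d i * m k i) = d j * m k j + (\<Sum>i\<in>I'. d i * m k i)"
        unfolding I'_def using Suc.prems(1) j(1) by (rule sum.remove)
      also have "(\<Sum>i\<in>I'. d i * m k i) = (\<Sum>i\<in>I'. c i * m k i)"
        by (intro sum.cong) (auto simp: d_def I'_def)
      also have "d j * m k j + \<dots> = (\<Sum>i\<in>I'. c i * m' k i)"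
        by (simp add: d_def m'_def sum_distrib_left sum_distrib_right sum_subtractf right_diff_distrib mult_ac)
      finally show ?thesis .
    qed
    have "m' r i = 0" for i using j by (simp add: m'_def)
    then have "\<forall>k<Suc r. (\<Sum>i\<in>I. d i * m k i) = 0"
      using c(2) by (auto simp: sum less_Suc_eq)
    moreover have "\<exists>i\<in>I. d i \<noteq> 0" using c(1) by (auto simp: d_def I'_def)
    ultimately show ?thesis by blast
  qed
qed

text \<open>The min-max argument: some nonzero combination \<open>f\<close> of the eigenvectors is
  orthogonal to all \<phi>_i. The images of the eigenvectors stay orthogonal, so |K f| >= \<sigma>
  |f|, while \<open>small\<close> bounds |K f| from above.\<close>

lemma eigenvalue_bound:
  assumes K: "L2_selfadjoint M K"
    and e: "L2_orthonormal M n e"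
    and \<tau>: "\<And>i. i < n \<Longrightarrow> \<sigma> \<le> \<tau> i"
      "\<And>i. i < n \<Longrightarrow> AE x in M. L2_adjoint M K (K (e i)) x = complex_of_real ((\<tau> i)\<^sup>2) * e i x"
    and \<sigma>: "0 < \<sigma>" and r: "r < n"
    and \<phi>: "\<And>i. i < r \<Longrightarrow> \<phi> i \<in> L2 M"
    and small: "\<And>f. f \<in> L2 M \<Longrightarrow> (\<And>i. i < r \<Longrightarrow> L2_inner M f (\<phi> i) = 0) \<Longrightarrow> L2_norm M (K f) \<le> b * L2_norm M f"
  shows "\<sigma> \<le> b"
proof -
  define A where "A = L2_adjoint M K"
  have bK: "L2_bounded_op M K" using K by (simp add: L2_selfadjoint_def)
  have KL: "K f \<in> L2 M" if "f \<in> L2 M" for f using bK that by (simp add: L2_bounded_op_def)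
  \<comment> \<open>The chosen adjoint has the defining property because \<open>K\<close> itself is
    a witness.\<close>
  have "\<exists>S. L2_bounded_op M S \<and> (\<forall>f\<in>L2 M. \<forall>g\<in>L2 M. L2_inner M (K f) g = L2_inner M f (S g))"
    using K by (intro exI[of _ K]) (auto simp: L2_selfadjoint_def)
  then have "L2_bounded_op M A \<and> (\<forall>f\<in>L2 M. \<forall>g\<in>L2 M. L2_inner M (K f) g = L2_inner M f (A g))"
    unfolding A_def L2_adjoint_def by (rule someI_ex)
  then have AL: "\<And>f. f \<in> L2 M \<Longrightarrow> A f \<in> L2 M"
    and adj: "\<And>f g. f \<in> L2 M \<Longrightarrow> g \<in> L2 M \<Longrightarrow> L2_inner M (K f) g = L2_inner M f (A g)"
    by (auto simp: L2_bounded_op_def)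
  have eL: "e i \<in> L2 M" if "i < n" for i using e that by (simp add: L2_orthonormal_def)
  have on: "L2_inner M (e i) (e j) = (if i = j then 1 else 0)" if "i < n" "j < n" for i j
    using e that by (simp add: L2_orthonormal_def)
  obtain c where c: "\<exists>i\<in>{..<n}. c i \<noteq> 0" "\<forall>k<r. (\<Sum>i<n. c i * L2_inner M (e i) (\<phi> k)) = 0"
    using homogeneous_system_nontrivial[of "{..<n}" r "\<lambda>k i. L2_inner M (e i) (\<phi> k)"] r by auto
  define f where "f = (\<lambda>x. \<Sum>i<n. c i * e i x)"
  have fL: "f \<in> L2 M" unfolding f_def using eL by (intro L2_sum) auto
  have f_inner: "L2_inner M f g = (\<Sum>i<n. c i * L2_inner M (e i) g)" if "g \<in> L2 M" for g
    unfolding f_def using eL that by (intro L2_inner_sum) auto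
  have KeKe: "L2_inner M (K (e j)) (K (e i)) = (if i = j then complex_of_real ((\<tau> i)\<^sup>2) else 0)"
    if "i < n" "j < n" for i j
  proof -
    have "L2_inner M (K (e j)) (K (e i)) = L2_inner M (e j) (A (K (e i)))"
      using that by (intro adj eL KL)
    also have "\<dots> = L2_inner M (e j) (\<lambda>x. complex_of_real ((\<tau> i)\<^sup>2) * e i x)"
      using that \<tau>(2)[of i] by (intro L2_inner_cong_AE) (auto simp: A_def[symmetric] intro: eL AL KL L2_scale)
    also have "\<dots> = complex_of_real ((\<tau> i)\<^sup>2) * L2_inner M (e j) (e i)"
      using that by (simp add: L2_inner_scale eL)
    finally show ?thesis using that by (simp add: on)
  qed
  have Kf: "L2_inner M (K f) g = (\<Sum>i<n. c i * L2_inner M (K (e i)) g)" if "g \<in> L2 M" for g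
    using that by (simp add: adj fL f_inner AL eL)
  have "complex_of_real ((L2_norm M (K f))\<^sup>2) = L2_inner M (K f) (K f)" by (simp add: L2_inner_self)
  also have "\<dots> = (\<Sum>i<n. c i * cnj (L2_inner M (K f) (K (e i))))"
    by (simp add: Kf KL fL L2_inner_commute[of M "K (e _)" "K f"])
  also have "\<dots> = (\<Sum>i<n. complex_of_real ((cmod (c i))\<^sup>2 * (\<tau> i)\<^sup>2))"
  proof (intro sum.cong refl)
    fix i assume i: "i \<in> {..<n}"
    have "L2_inner M (K f) (K (e i)) = (\<Sum>j<n. c j * (if i = j then complex_of_real ((\<tau> i)\<^sup>2) else 0))"
      using i by (simp add: Kf KL eL KeKe)
    also have "\<dots> = c i * complex_of_real ((\<tau> i)\<^sup>2)"
      using i by (subst sum.remove[of _ i]) (auto intro!: sum.neutral)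
    finally show "c i * cnj (L2_inner M (K f) (K (e i))) = complex_of_real ((cmod (c i))\<^sup>2 * (\<tau> i)\<^sup>2)"
      by (simp add: complex_norm_square[symmetric] mult.assoc[symmetric] del: of_real_power)
  qed
  finally have nKf: "(L2_norm M (K f))\<^sup>2 = (\<Sum>i<n. (cmod (c i))\<^sup>2 * (\<tau> i)\<^sup>2)"
    by (simp only: of_real_sum[symmetric] of_real_eq_iff)
  have "complex_of_real ((L2_norm M f)\<^sup>2) = (\<Sum>i<n. c i * cnj (L2_inner M f (e i)))"
    unfolding L2_inner_self[symmetric] f_inner[OF fL] by (simp add: L2_inner_commute[of M "e _" f])
  also have "\<dots> = (\<Sum>i<n. complex_of_real ((cmod (c i))\<^sup>2))"
  proof (intro sum.cong refl)
    fix i assume i: "i \<in> {..<n}"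
    have "L2_inner M f (e i) = (\<Sum>j<n. c j * (if j = i then 1 else 0))"
      using i by (simp add: f_inner eL on)
    also have "\<dots> = c i" using i by (subst sum.remove[of _ i]) (auto intro!: sum.neutral)
    finally show "c i * cnj (L2_inner M f (e i)) = complex_of_real ((cmod (c i))\<^sup>2)"
      by (simp only: complex_norm_square)
  qed
  finally have nf: "(L2_norm M f)\<^sup>2 = (\<Sum>i<n. (cmod (c i))\<^sup>2)"
    by (simp only: of_real_sum[symmetric] of_real_eq_iff)
  have pos: "0 < (L2_norm M f)\<^sup>2"
    unfolding nf using c(1) by (auto intro!: sum_pos2)
  have "\<sigma>\<^sup>2 * (L2_norm M f)\<^sup>2 \<le> (L2_norm M (K f))\<^sup>2"
    unfolding nf nKf sum_distrib_left
  proof (intro sum_mono)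
    fix i assume "i \<in> {..<n}"
    then have "\<sigma>\<^sup>2 \<le> (\<tau> i)\<^sup>2" using \<tau>(1)[of i] \<sigma> by (intro power_mono) auto
    then show "\<sigma>\<^sup>2 * (cmod (c i))\<^sup>2 \<le> (cmod (c i))\<^sup>2 * (\<tau> i)\<^sup>2"
      by (subst mult.commute) (intro mult_left_mono, auto)
  qed
  then have "(\<sigma> * L2_norm M f)\<^sup>2 \<le> (L2_norm M (K f))\<^sup>2" by (simp add: power_mult_distrib)
  then have "\<sigma> * L2_norm M f \<le> L2_norm M (K f)" by (rule power2_le_imp_le) simp
  also have "\<dots> \<le> b * L2_norm M f"
    using c(2) by (intro small fL) (simp add: f_inner \<phi>)
  finally have "\<sigma> * L2_norm M f \<le> b * L2_norm M f" .
  moreover have "0 < L2_norm M f" using pos by (simp add: less_le)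
  ultimately show ?thesis by simp
qed

text \<open>Geometric decay of the singular values, with ratio q^p < 1 after taking p-th powers, is
  summable for every p > 0.\<close>

lemma schatten0I:
  assumes K: "L2_selfadjoint M K" and compact: "L2_compact_op M K"
    and q: "0 < q" "q < 1" and b: "0 < b"
    and approx: "\<And>r. \<exists>\<phi>. (\<forall>i\<le>r. \<phi> i \<in> L2 M) \<and>
      (\<forall>f\<in>L2 M. (\<forall>i\<le>r. L2_inner M f (\<phi> i) = 0) \<longrightarrow> L2_norm M (K f) \<le> b * q ^ r * L2_norm M f)"
  shows "K \<in> schatten0 M"
proof -
  \<comment> \<open>The conditions i <= r are r + 1 in number, so they bound the singular value with
    index r + 2. The least upper bound includes the default value 0, for which the estimate is
    trivial.\<close>
  have sv: "0 \<le> singular_value M K (Suc (Suc r))" "singular_value M K (Suc (Suc r)) \<le> b * q ^ r" for r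
  proof -
    let ?X = "{\<sigma>. \<sigma> > 0 \<and> (\<exists>e \<tau>. L2_orthonormal M (Suc (Suc r)) e \<and> (\<forall>i<Suc (Suc r). \<tau> i \<ge> \<sigma> \<and>
      (AE x in M. L2_adjoint M K (K (e i)) x = complex_of_real ((\<tau> i)\<^sup>2) * e i x)))}"
    have le: "\<sigma> \<le> b * q ^ r" if "\<sigma> \<in> {0} \<union> ?X" for \<sigma>
    proof (cases "\<sigma> = 0")
      case True
      then show ?thesis using b q by simp
    next
      case False
      with that obtain e \<tau> where "0 < \<sigma>" "L2_orthonormal M (Suc (Suc r)) e"
        "\<And>i. i < Suc (Suc r) \<Longrightarrow> \<sigma> \<le> \<tau> i"
        "\<And>i. i < Suc (Suc r) \<Longrightarrow> AE x in M. L2_adjoint M K (K (e i)) x = complex_of_real ((\<tau> i)\<^sup>2) * e i x"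
        by blast
      moreover obtain \<phi> where "\<And>i. i < Suc r \<Longrightarrow> \<phi> i \<in> L2 M"
        "\<And>f. f \<in> L2 M \<Longrightarrow> (\<And>i. i < Suc r \<Longrightarrow> L2_inner M f (\<phi> i) = 0) \<Longrightarrow> L2_norm M (K f) \<le> b * q ^ r * L2_norm M f"
        using approx[of r] unfolding less_Suc_eq_le by blast
      ultimately show ?thesis
        using eigenvalue_bound[OF K, of "Suc (Suc r)" e \<sigma> \<tau> "Suc r" \<phi> "b * q ^ r"] by blast
    qed
    have bdd: "bdd_above ({0} \<union> ?X)" using le by (rule bdd_aboveI)
    show "0 \<le> singular_value M K (Suc (Suc r))"
      unfolding singular_value_def by (rule cSup_upper[OF _ bdd]) simp
    show "singular_value M K (Suc (Suc r)) \<le> b * q ^ r"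
      unfolding singular_value_def by (rule cSup_least[OF _ le]) auto
  qed
  have "K \<in> schatten M p" if p: "0 < p" for p
  proof -
    have "summable (\<lambda>r. singular_value M K (Suc (Suc r)) powr p)"
    proof (rule summable_comparison_test')
      show "summable (\<lambda>r. b powr p * (q powr p) ^ r)"
        using q p by (intro summable_mult summable_geometric) (use powr_less_mono2[of p q 1] in simp)
      fix r
      have "singular_value M K (Suc (Suc r)) powr p \<le> (b * q ^ r) powr p"
        using p sv by (intro powr_mono2) auto
      also have "\<dots> = b powr p * (q powr p) ^ r"
        using b q by (simp add: powr_mult powr_realpow[symmetric] powr_powr mult.commute)
      finally show "norm (singular_value M K (Suc (Suc r)) powr p) \<le> b powr p * (q powr p) ^ r" by simp
    qed
    \<comment> \<open>The first singular value is not estimated; a single term does not affect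
      summability.\<close>
    then have "summable (\<lambda>n. singular_value M K (Suc n) powr p)"
      by (subst (asm) summable_Suc_iff[of "\<lambda>n. singular_value M K (Suc n) powr p"])
    then show ?thesis using compact by (simp add: schatten_def)
  qed
  then show ?thesis by (auto simp: schatten0_def)
qed

section \<open>Kernels of the form v(x) h(x+y) v(y)\<close>

lemma L2_dominated:
  assumes g: "g \<in> L2 M" and [measurable]: "f \<in> borel_measurable M"
    and le: "\<And>x. x \<in> space M \<Longrightarrow> cmod (f x) \<le> c * cmod (g x)" and c: "0 \<le> c"
  shows "f \<in> L2 M" "L2_norm M f \<le> c * L2_norm M g"
proof -
  have [measurable]: "g \<in> borel_measurable M" using g by (rule L2_measurable)
  have "(\<integral>\<^sup>+x. ennreal ((cmod (f x))\<^sup>2) \<partial>M) \<le> (\<integral>\<^sup>+x. ennreal (c\<^sup>2) * ennreal ((cmod (g x))\<^sup>2) \<partial>M)"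
    using power_mono[OF le norm_ge_zero, of _ 2]
    by (intro nn_integral_mono) (simp add: ennreal_mult[symmetric] power_mult_distrib)
  also have "\<dots> = ennreal ((c * L2_norm M g)\<^sup>2)"
    by (subst nn_integral_cmult) (auto simp: L2_norm_nn[OF g, symmetric] ennreal_mult[symmetric] power_mult_distrib)
  finally have "(\<integral>\<^sup>+x. ennreal ((cmod (f x))\<^sup>2) \<partial>M) \<le> ennreal ((c * L2_norm M g)\<^sup>2)" .
  from L2_norm_le_nn[OF _ this] c show "f \<in> L2 M" "L2_norm M f \<le> c * L2_norm M g" by auto
qed

text \<open>If \<open>f\<close> is orthogonal to y^i v(y) for i <= r, then replacing
  \<open>h\<close> by a polynomial of degree at most \<open>r\<close> gives 0 at every
  \<open>x\<close>, so only the approximation error contributes. Compactness, which the Schatten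
  class demands separately, comes from Arzela-Ascoli.\<close>

lemma smooth_kernel_schatten0:
  fixes v h :: "real \<Rightarrow> real" and R :: real
  defines "M \<equiv> ray_measure 0"
  assumes R: "0 < R"
    and v_meas [measurable]: "v \<in> borel_measurable borel" and v_nonneg: "\<And>x. 0 \<le> v x"
    and v_L2: "(\<lambda>x. complex_of_real (v x)) \<in> L2 M" and v_supp: "\<And>x. R < x \<Longrightarrow> v x = 0"
    and h_meas [measurable]: "h \<in> borel_measurable borel" and h_cont: "continuous_on {0..2*R} h"
    and q: "0 < q" "q < 1" and b: "0 < b"
    and h_poly: "\<And>r. \<exists>Q :: real poly. degree Q \<le> r \<and> (\<forall>s\<in>{0..2*R}. \<bar>h s - poly Q s\<bar> \<le> b * q ^ r)"
    and K: "L2_selfadjoint M K"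
    and K_eq: "\<And>f x. f \<in> L2 M \<Longrightarrow> 0 < x \<Longrightarrow>
      K f x = complex_of_real (v x) * (LINT y|M. complex_of_real (h (x + y) * v y) * f y)"
  shows "K \<in> schatten0 M"
proof -
  have sp: "space M = {0<..}" by (simp add: M_def space_restrict_space)
  have measM: "f \<in> borel_measurable M" if "f \<in> borel_measurable borel" for f :: "real \<Rightarrow> complex"
    unfolding M_def using that by (intro measurable_restrict_space1) simp
  define nv where "nv = L2_norm M (\<lambda>x. complex_of_real (v x))"
  have nv0: "0 \<le> nv" by (simp add: nv_def)
  have pairing: "cmod (LINT y|M. complex_of_real (k y * v y) * f y) \<le> c * nv * L2_norm M f"
    "integrable M (\<lambda>y. complex_of_real (k y * v y) * f y)"
    if f: "f \<in> L2 M" and [measurable]: "k \<in> borel_measurable borel" and c: "0 \<le> c"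
      and le: "\<And>y. 0 < y \<Longrightarrow> y \<le> R \<Longrightarrow> \<bar>k y\<bar> \<le> c" for f k c
  proof -
    let ?g = "\<lambda>y. complex_of_real (k y * v y)"
    have gle: "cmod (?g y) \<le> c * cmod (complex_of_real (v y))" if "y \<in> space M" for y
    proof (cases "y \<le> R")
      case True
      then show ?thesis using le[of y] that v_nonneg[of y] by (simp add: sp norm_mult abs_mult mult_right_mono)
    qed (simp add: v_supp)
    have gm: "?g \<in> borel_measurable M" by (rule measM) measurable
    have g: "?g \<in> L2 M" "L2_norm M ?g \<le> c * nv"
      unfolding nv_def by (rule L2_dominated[OF v_L2 gm gle c], assumption)+
    show "integrable M (\<lambda>y. complex_of_real (k y * v y) * f y)"
      using g(1) f by (rule L2_prod_integrable)
    have "(LINT y|M. ?g y * f y) = L2_inner M f ?g"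
      unfolding L2_inner_def by (simp add: mult.commute)
    then have "cmod (LINT y|M. ?g y * f y) \<le> L2_norm M f * L2_norm M ?g"
      using L2_Cauchy_Schwarz[OF f g(1)] by simp
    also have "\<dots> \<le> L2_norm M f * (c * nv)" using g(2) by (intro mult_left_mono) auto
    finally show "cmod (LINT y|M. ?g y * f y) \<le> c * nv * L2_norm M f" by (simp add: mult_ac)
  qed
  have bK: "L2_bounded_op M K" using K by (simp add: L2_selfadjoint_def)
  have KL: "K f \<in> L2 M" if "f \<in> L2 M" for f using bK that by (simp add: L2_bounded_op_def)
  \<comment> \<open>\<open>K f\<close> without the outer factor \<open>v\<close>. It is continuous
    on [0, R] even where \<open>v\<close> is not, so uniform estimates apply to it.\<close>
  define F where "F f x = (LINT y|M. complex_of_real (h (x + y) * v y) * f y)" for f x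
  have K_le: "L2_norm M (\<lambda>x. K f x - K g x) \<le> c * nv"
    if f: "f \<in> L2 M" and g: "g \<in> L2 M" and c: "0 \<le> c" and le: "\<And>x. x \<in> {0..R} \<Longrightarrow> cmod (F f x - F g x) \<le> c" for f g c
    unfolding nv_def
  proof (rule L2_dominated(2)[OF v_L2 _ _ c])
    show "(\<lambda>x. K f x - K g x) \<in> borel_measurable M"
      using L2_diff[OF KL[OF f] KL[OF g]] by (rule L2_measurable)
    fix x assume "x \<in> space M"
    then have x: "0 < x" by (simp add: sp)
    have eq: "cmod (K f x - K g x) = v x * cmod (F f x - F g x)"
      using K_eq[OF f x] K_eq[OF g x] v_nonneg[of x]
      by (simp add: F_def norm_mult flip: right_diff_distrib)
    show "cmod (K f x - K g x) \<le> c * cmod (complex_of_real (v x))"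
    proof (cases "x \<le> R")
      case True
      then show ?thesis
        unfolding eq using mult_left_mono[OF le[of x] v_nonneg[of x]] x v_nonneg[of x] by (simp add: mult.commute)
    qed (simp add: eq v_supp)
  qed
  have "bounded (h ` {0..2*R})" using h_cont by (intro compact_imp_bounded compact_continuous_image) auto
  then obtain B where B: "\<And>s. s \<in> {0..2*R} \<Longrightarrow> \<bar>h s\<bar> \<le> B" and B0: "0 < B"
    unfolding bounded_pos ball_simps real_norm_def by metis
  have compact: "L2_compact_op M K"
    unfolding L2_compact_op_def
  proof (intro conjI bK allI impI)
    fix f :: "nat \<Rightarrow> real \<Rightarrow> complex"
    assume "\<forall>n. f n \<in> L2 M \<and> L2_norm M (f n) \<le> 1"
    then have f: "\<And>n. f n \<in> L2 M" "\<And>n. L2_norm M (f n) \<le> 1" by auto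
    have le1: "c * nv * L2_norm M (f n) \<le> c * nv" if "0 \<le> c" for c n
      using f(2)[of n] that nv0 by (simp add: mult_left_le)
    have ucont: "uniformly_continuous_on {0..2*R} h"
      using h_cont by (intro compact_uniformly_continuous) auto
    \<comment> \<open>The images of the unit ball are bounded by \<open>B * nv\<close> and
      equicontinuous by the uniform continuity of \<open>h\<close>.\<close>
    obtain g k where "continuous_on {0..R} g" and k: "strict_mono (k :: nat \<Rightarrow> nat)"
      and lim: "\<And>e. 0 < e \<Longrightarrow> \<exists>N. \<forall>n x. n \<ge> N \<and> x \<in> {0..R} \<longrightarrow> norm (F (f (k n)) x - g x) < e"
    proof (rule Arzela_Ascoli[of "{0..R}" "\<lambda>n. F (f n)" "B * nv"])
      show "compact {0..R}" by simp
      show "norm (F (f n) x) \<le> B * nv" if "x \<in> {0..R}" for n x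
      proof -
        have "norm (F (f n) x) \<le> B * nv * L2_norm M (f n)"
          unfolding F_def using that B B0 by (intro pairing(1) f) auto
        also have "\<dots> \<le> B * nv" using B0 by (intro le1) simp
        finally show ?thesis .
      qed
      fix x e :: real assume x: "x \<in> {0..R}" and e: "0 < e"
      \<comment> \<open>The summand 1 guards against \<open>nv = 0\<close>.\<close>
      define e' where "e' = e / (nv + 1)"
      have e': "0 < e'" using e nv0 by (simp add: e'_def)
      obtain d where d: "0 < d" "\<And>s t. s \<in> {0..2*R} \<Longrightarrow> t \<in> {0..2*R} \<Longrightarrow> \<bar>t - s\<bar> < d \<Longrightarrow> \<bar>h t - h s\<bar> < e'"
        using ucont e' unfolding uniformly_continuous_on_def dist_real_def by metis
      show "\<exists>d>0. \<forall>n y. y \<in> {0..R} \<and> norm (x - y) < d \<longrightarrow> norm (F (f n) x - F (f n) y) < e"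
      proof (intro exI[of _ d] conjI d(1) allI impI)
        fix n y assume y: "y \<in> {0..R} \<and> norm (x - y) < d"
        have "F (f n) x - F (f n) y = (LINT z|M. complex_of_real ((h (x + z) - h (y + z)) * v z) * f n z)"
        proof -
          have "integrable M (\<lambda>z. complex_of_real (h (t + z) * v z) * f n z)" if "t \<in> {0..R}" for t
            using that B B0 by (intro pairing(2)[OF f(1), of _ B]) auto
          then show ?thesis
            unfolding F_def using x y
            by (subst Bochner_Integration.integral_diff[symmetric])
              (auto intro: Bochner_Integration.integral_cong simp: left_diff_distrib)
        qed
        also have "norm \<dots> \<le> e' * nv * L2_norm M (f n)"
        proof (intro pairing(1) f)
          fix z assume "0 < z" "z \<le> R"
          then show "\<bar>h (x + z) - h (y + z)\<bar> \<le> e'"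
            using x y by (intro less_imp_le d(2)) auto
        qed (use e' in auto)
        also have "\<dots> \<le> e' * nv" using e' by (intro le1) simp
        also have "\<dots> < e" using e nv0 by (simp add: e'_def divide_simps)
        finally show "norm (F (f n) x - F (f n) y) < e" .
      qed
    qed blast
    have "\<exists>u\<in>L2 M. (\<lambda>n. L2_norm M (\<lambda>x. K (f (k n)) x - u x)) \<longlonglongrightarrow> 0"
    proof (rule L2_complete)
      show "K (f (k n)) \<in> L2 M" for n by (intro KL f)
      fix e :: real assume e: "0 < e"
      define e' where "e' = e / (2 * (nv + 1))"
      have e': "0 < e'" using e nv0 by (simp add: e'_def)
      obtain N where N: "\<And>n x. n \<ge> N \<Longrightarrow> x \<in> {0..R} \<Longrightarrow> norm (F (f (k n)) x - g x) < e'"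
        using lim[OF e'] by auto
      show "\<exists>N. \<forall>m\<ge>N. \<forall>n\<ge>N. L2_norm M (\<lambda>x. K (f (k m)) x - K (f (k n)) x) < e"
      proof (intro exI[of _ N] allI impI)
        fix m n assume mn: "N \<le> m" "N \<le> n"
        have "L2_norm M (\<lambda>x. K (f (k m)) x - K (f (k n)) x) \<le> (2 * e') * nv"
        proof (intro K_le f)
          fix x assume x: "x \<in> {0..R}"
          show "cmod (F (f (k m)) x - F (f (k n)) x) \<le> 2 * e'"
            using norm_diff_triangle_less[OF N[OF mn(1) x], of "F (f (k n)) x" e'] N[OF mn(2) x]
            by (simp add: norm_minus_commute)
        qed (use e' in simp)
        also have "\<dots> < e" using e nv0 by (simp add: e'_def divide_simps)
        finally show "L2_norm M (\<lambda>x. K (f (k m)) x - K (f (k n)) x) < e" .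
      qed
    qed
    then show "\<exists>g\<in>L2 M. \<exists>r. strict_mono r \<and> (\<lambda>n. L2_norm M (\<lambda>x. K (f (r n)) x - g x)) \<longlonglongrightarrow> 0"
      using k by blast
  qed
  show ?thesis
  proof (rule schatten0I[OF K compact q])
    \<comment> \<open>One factor \<open>nv\<close> comes from the pairing and one from the outer
      \<open>v\<close>; the summand 1 keeps the constant positive when \<open>v\<close> vanishes
      almost everywhere.\<close>
    show "0 < b * (nv * nv + 1)" using b nv0 by (simp add: add_nonneg_pos)
    fix r
    obtain Q :: "real poly" where Q: "degree Q \<le> r" "\<And>s. s \<in> {0..2*R} \<Longrightarrow> \<bar>h s - poly Q s\<bar> \<le> b * q ^ r"
      using h_poly[of r] by blast
    let ?\<phi> = "\<lambda>i y. complex_of_real (y ^ i * v y)"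
    show "\<exists>\<phi>. (\<forall>i\<le>r. \<phi> i \<in> L2 M) \<and> (\<forall>f\<in>L2 M. (\<forall>i\<le>r. L2_inner M f (\<phi> i) = 0) \<longrightarrow>
        L2_norm M (K f) \<le> b * (nv * nv + 1) * q ^ r * L2_norm M f)"
    proof (intro exI[of _ ?\<phi>] conjI allI impI ballI)
      fix i
      show "?\<phi> i \<in> L2 M"
      proof (rule L2_dominated(1)[OF v_L2])
        show "?\<phi> i \<in> borel_measurable M" by (intro measM) measurable
        show "0 \<le> R ^ i" using R by simp
        fix y assume "y \<in> space M"
        then show "cmod (?\<phi> i y) \<le> R ^ i * cmod (complex_of_real (v y))"
          using v_nonneg[of y] v_supp[of y] by (cases "y \<le> R")
            (auto simp: sp norm_mult norm_power intro!: mult_right_mono power_mono)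
      qed
    next
      fix f assume f: "f \<in> L2 M" and orth: "\<forall>i\<le>r. L2_inner M f (?\<phi> i) = 0"
      have pw: "(LINT y|M. complex_of_real (y ^ i * v y) * f y) = 0" if "i \<le> r" for i
        using orth that unfolding L2_inner_def by (simp add: mult.commute)
      have ipw: "integrable M (\<lambda>y. complex_of_real (y ^ i * v y) * f y)" for i
        using R by (intro pairing(2)[OF f, of _ "R ^ i"]) (auto simp: abs_mult power_abs intro!: power_mono)
      \<comment> \<open>Subtracting the value at the zero function, which is 0, allows the estimate
        \<open>K_le\<close> for differences to be reused.\<close>
      have "cmod (F f x - F (\<lambda>_. 0) x) \<le> b * q ^ r * nv * L2_norm M f" if x: "x \<in> {0..R}" for x
      proof -
        \<comment> \<open>Q(x + y) as a polynomial in \<open>y\<close>; the shift does not raise the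
          degree.\<close>
        define P where "P = pcompose Q [:x, 1:]"
        have dP: "degree P \<le> r"
          unfolding P_def using Q(1) by (simp add: degree_pcompose)
        have P: "poly Q (x + y) = (\<Sum>i\<le>r. coeff P i * y ^ i)" for y
        proof -
          have "poly Q (x + y) = poly P y" by (simp add: P_def poly_pcompose)
          also have "\<dots> = (\<Sum>i\<le>r. coeff P i * y ^ i)"
            unfolding poly_altdef using dP
            by (intro sum.mono_neutral_left) (auto simp: coeff_eq_0 not_le)
          finally show ?thesis .
        qed
        have P': "complex_of_real (poly Q (x + y) * v y) * f y
            = (\<Sum>i\<le>r. complex_of_real (coeff P i) * (complex_of_real (y ^ i * v y) * f y))" for y
          unfolding P by (simp add: sum_distrib_left sum_distrib_right mult_ac)
        have "(LINT y|M. complex_of_real (poly Q (x + y) * v y) * f y)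
            = (LINT y|M. (\<Sum>i\<le>r. complex_of_real (coeff P i) * (complex_of_real (y ^ i * v y) * f y)))"
          by (simp only: P')
        also have "\<dots> = (\<Sum>i\<le>r. complex_of_real (coeff P i) * (LINT y|M. complex_of_real (y ^ i * v y) * f y))"
          by (subst Bochner_Integration.integral_sum[OF integrable_mult_right[OF ipw]],
              subst integral_mult_right_zero, rule refl)
        also have "\<dots> = 0" using pw by (intro sum.neutral) simp
        finally have poly0: "(LINT y|M. complex_of_real (poly Q (x + y) * v y) * f y) = 0" .
        have ip: "integrable M (\<lambda>y. complex_of_real (poly Q (x + y) * v y) * f y)"
          unfolding P' by (intro Bochner_Integration.integrable_sum integrable_mult_right ipw)
        have ih: "integrable M (\<lambda>y. complex_of_real (h (x + y) * v y) * f y)"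
          using x B B0 by (intro pairing(2)[OF f, of _ B]) auto
        have "F f x - F (\<lambda>_. 0) x = (LINT y|M. complex_of_real (h (x + y) * v y) * f y)
            - (LINT y|M. complex_of_real (poly Q (x + y) * v y) * f y)"
          unfolding poly0 by (simp add: F_def)
        also have "\<dots> = (LINT y|M. complex_of_real ((h (x + y) - poly Q (x + y)) * v y) * f y)"
          by (subst Bochner_Integration.integral_diff[OF ih ip, symmetric])
            (intro Bochner_Integration.integral_cong refl, simp add: algebra_simps)
        also have "cmod \<dots> \<le> b * q ^ r * nv * L2_norm M f"
        proof (rule pairing(1)[OF f])
          show "(\<lambda>y. h (x + y) - poly Q (x + y)) \<in> borel_measurable borel"
          proof -
            have [measurable]: "poly Q \<in> borel_measurable borel"
              by (intro borel_measurable_continuous_onI continuous_on_poly continuous_on_id)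
            show ?thesis by measurable
          qed
          show "0 \<le> b * q ^ r" using b q by simp
          fix y assume "0 < y" "y \<le> R"
          then show "\<bar>h (x + y) - poly Q (x + y)\<bar> \<le> b * q ^ r" using x by (intro Q(2)) auto
        qed
        finally show ?thesis .
      qed
      then have "L2_norm M (\<lambda>x. K f x - K (\<lambda>_. 0) x) \<le> (b * q ^ r * nv * L2_norm M f) * nv"
        using b q nv0 by (intro K_le f) auto
      moreover have "L2_norm M (\<lambda>x. K f x - K (\<lambda>_. 0) x) = L2_norm M (K f)"
      proof (rule L2_norm_cong_AE)
        show "AE x in M. K f x - K (\<lambda>_. 0) x = K f x"
          using K_eq[OF L2_zero] by (intro AE_I2) (simp add: sp)
      qed (intro L2_diff KL f L2_zero)+
      ultimately have "L2_norm M (K f) \<le> b * (nv * nv) * q ^ r * L2_norm M f" by (simp add: mult_ac)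
      also have "\<dots> \<le> b * (nv * nv + 1) * q ^ r * L2_norm M f"
        using b q by (intro mult_right_mono mult_left_mono) auto
      finally show "L2_norm M (K f) \<le> b * (nv * nv + 1) * q ^ r * L2_norm M f" .
    qed
  qed
qed

section \<open>Factorisation of Helson operators\<close>

lemma sigma_finite_ray: "sigma_finite_measure (ray_measure c)"
  by (intro sigma_finite_measure_restrict_space) (auto intro: lborel.sigma_finite_measure_axioms)

lemma space_ray [simp]: "space (ray_measure c) = {c<..}"
  by (simp add: space_restrict_space)

lemma nn_integral_ray: "(\<integral>\<^sup>+x. f x \<partial>ray_measure c) = (\<integral>\<^sup>+x. f x * indicator {c<..} x \<partial>lborel)"
  by (rule nn_integral_restrict_space) simp

lemma measurable_ray: "f \<in> borel_measurable borel \<Longrightarrow> f \<in> borel_measurable (ray_measure c)"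
  by (intro measurable_restrict_space1) simp

text \<open>The power -1/2 is an eigenfunction of the kernel 1/(l+m), with eigenvalue pi.
  Substituting m = l x^2 leads to the arctangent.\<close>

lemma nn_integral_Carleman_kernel:
  fixes l :: real
  assumes l: "0 < l"
  shows "(\<integral>\<^sup>+m. ennreal (m powr (-1/2) / (l + m)) * indicator {0<..} m \<partial>lborel) = ennreal (pi * l powr (-1/2))"
proof -
  define F where "F m = 2 * arctan (sqrt (m / l)) / sqrt l" for m
  let ?f = "\<lambda>m. m powr (-1/2) / (l + m)"
  have der: "(F has_real_derivative ?f m) (at m)" if m: "0 < m" for m
  proof -
    have "(F has_real_derivative (2 * (inverse (1 + (sqrt (m / l))\<^sup>2) * ((inverse (sqrt (m / l)) / 2) * (1 / l))) / sqrt l)) (at m)"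
    proof -
      have 1: "((\<lambda>m. m / l) has_real_derivative 1 / l) (at m)"
        using l by (auto intro!: derivative_eq_intros)
      have "0 < m / l" using m l by simp
      from DERIV_chain2[OF DERIV_arctan DERIV_chain2[OF DERIV_real_sqrt[OF this] 1]]
      show ?thesis unfolding F_def by (intro DERIV_cdivide DERIV_cmult)
    qed
    also have "2 * (inverse (1 + (sqrt (m / l))\<^sup>2) * ((inverse (sqrt (m / l)) / 2) * (1 / l))) / sqrt l = ?f m"
    proof -
      have "(sqrt (m / l))\<^sup>2 = m / l" using m l by simp
      moreover have "sqrt (m / l) * sqrt l = sqrt m" using m l by (simp add: real_sqrt_divide)
      moreover have "m powr (-1/2) = 1 / sqrt m"
        using m by (simp add: powr_minus_divide powr_half_sqrt)
      moreover have "2 * (inverse (1 + m / l) * ((inverse X / 2) * (1 / l))) / Y = (1 / (X * Y)) / (l + m)"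
        for X Y :: real using m l by (simp add: divide_simps)
      ultimately show ?thesis by simp
    qed
    finally show ?thesis .
  qed
  have lim0: "((F \<circ> real_of_ereal) \<longlongrightarrow> 0) (at_right (ereal 0))"
    unfolding ereal_tendsto_simps
  proof -
    have "isCont (\<lambda>m. 2 * arctan (sqrt (m / l)) / sqrt l) 0"
      using l by (intro continuous_intros) auto
    then have "((\<lambda>m. 2 * arctan (sqrt (m / l)) / sqrt l) \<longlongrightarrow> 0) (at 0)"
      by (simp add: isCont_def)
    then show "(F \<longlongrightarrow> 0) (at_right 0)"
      unfolding F_def by (rule filterlim_mono[OF _ order_refl at_le]) simp
  qed
  have lim1: "((F \<circ> real_of_ereal) \<longlongrightarrow> 2 * (pi/2) / sqrt l) (at_left \<infinity>)"
    unfolding F_def ereal_tendsto_simps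
  proof (intro tendsto_intros filterlim_compose[OF tendsto_arctan_at_top])
    have "filterlim (\<lambda>m. 1 / l * m) at_top at_top"
      using l by (intro filterlim_tendsto_pos_mult_at_top[OF tendsto_const _ filterlim_ident]) simp
    then show "filterlim (\<lambda>m. sqrt (m / l)) at_top at_top"
      using filterlim_compose[OF sqrt_at_top] by simp
  qed (use l in auto)
  have cont: "isCont ?f x" if "0 < x" for x
    using l that by (intro continuous_intros) auto
  have "set_integrable lborel (einterval 0 \<infinity>) ?f" "(LBINT x=0..\<infinity>. ?f x) = 2 * (pi/2) / sqrt l - 0"
    using interval_integral_FTC_nonneg[of 0 \<infinity> F ?f, OF _ _ _ _ lim0[folded zero_ereal_def] lim1] der cont l
    by auto
  then have i: "integrable lborel (\<lambda>m. indicator {0<..} m *\<^sub>R ?f m)"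
    "(LINT m|lborel. indicator {0<..} m *\<^sub>R ?f m) = pi / sqrt l"
    by (simp_all add: interval_lebesgue_integral_def set_integrable_def set_lebesgue_integral_def einterval_def greaterThan_def)
  have "(\<integral>\<^sup>+m. ennreal (?f m) * indicator {0<..} m \<partial>lborel) = (\<integral>\<^sup>+m. ennreal (indicator {0<..} m *\<^sub>R ?f m) \<partial>lborel)"
    by (intro nn_integral_cong) (auto split: split_indicator)
  also have "\<dots> = ennreal (pi / sqrt l)"
    using i l by (subst nn_integral_eq_integral) (auto split: split_indicator)
  also have "pi / sqrt l = pi * l powr (-1/2)"
    using l by (simp add: powr_minus_divide powr_half_sqrt)
  finally show ?thesis .
qed

text \<open>\<open>M\<close> and \<open>\<tau>\<close> are the counting measure and the inclusion of \<open>\<nat>\<close>, or Lebesgue measure on \<open>(1,\<infinity>)\<close> and the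
  identity; \<open>v\<close> is the square root of the weight.\<close>

locale helson_factor = sigma_finite_measure M for M :: "'a measure" +
  fixes \<tau> :: "'a \<Rightarrow> real" and v :: "real \<Rightarrow> real" and R V C0 :: real and k :: "real \<Rightarrow> real"
  assumes \<tau>_meas [measurable]: "\<tau> \<in> borel_measurable M"
    and \<tau>_ge: "\<And>x. x \<in> space M \<Longrightarrow> 1 \<le> \<tau> x"
    and v_meas [measurable]: "v \<in> borel_measurable borel"
    and v_nonneg: "\<And>l. 0 \<le> v l" and v_le: "\<And>l. v l \<le> V" and v_supp: "\<And>l. R < l \<Longrightarrow> v l = 0"
    and RV: "0 < R" "0 < V" "0 \<le> C0"
    and moment: "\<And>s. 0 < s \<Longrightarrow> (\<integral>\<^sup>+x. ennreal (\<tau> x powr (-1-s)) \<partial>M) = ennreal (k s)"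
    and k_nonneg: "\<And>s. 0 < s \<Longrightarrow> 0 \<le> k s"
    and k_le: "\<And>s. 0 < s \<Longrightarrow> s \<le> 2 * R \<Longrightarrow> k s \<le> C0 / s"
begin

definition \<kappa> :: "'a \<Rightarrow> real \<Rightarrow> real" where
  "\<kappa> x l = v l * \<tau> x powr (-1/2-l)"

lemma \<kappa>_meas_ray: "(\<lambda>(x, l). \<kappa> x l) \<in> borel_measurable (M \<Otimes>\<^sub>M ray_measure 0)"
proof -
  have [measurable]: "v \<in> borel_measurable (ray_measure 0)" "(\<lambda>l. l) \<in> borel_measurable (ray_measure 0)"
    by (auto intro: measurable_ray)
  show ?thesis unfolding \<kappa>_def by measurable
qed

lemma \<kappa>_nonneg: "0 \<le> \<kappa> x l"
  by (simp add: \<kappa>_def v_nonneg)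

lemma \<tau>_powr_mult: "\<tau> x powr (-1/2-l) * \<tau> x powr (-1/2-m) = \<tau> x powr (-1-(l+m))"
  by (simp add: powr_add[symmetric] algebra_simps)

lemma v_L2: "(\<lambda>l. complex_of_real (v l)) \<in> L2 (ray_measure 0)"
proof -
  have "(\<integral>\<^sup>+l. ennreal ((cmod (complex_of_real (v l)))\<^sup>2) \<partial>ray_measure 0)
      \<le> (\<integral>\<^sup>+l. ennreal (V\<^sup>2) * indicator {0<..R} l \<partial>lborel)"
    unfolding nn_integral_ray
    using v_supp v_nonneg v_le
    by (intro nn_integral_mono) (auto split: split_indicator intro!: ennreal_leI power_mono simp: not_le)
  also have "\<dots> < \<infinity>" using RV by (simp add: nn_integral_cmult_indicator ennreal_mult_less_top)
  finally show ?thesis unfolding L2_iff_nn by (auto intro: measurable_ray)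
qed

text \<open>The Schur weight on the side of \<open>M\<close>: the kernel applied to m powr (-1/2),
  with \<open>v\<close> replaced by \<open>V\<close> on (0, R]. Using \<open>V\<close> keeps the
  weight positive where \<open>v\<close> vanishes, and Schur's test divides by it.\<close>

definition pe :: "'a \<Rightarrow> ennreal" where
  "pe x = (\<integral>\<^sup>+m. ennreal (\<tau> x powr (-1/2-m) * (V * m powr (-1/2))) * indicator {0<..R} m \<partial>lborel)"

lemma pe_meas [measurable]: "pe \<in> borel_measurable M"
  unfolding pe_def by measurable

lemma pe_finite:
  assumes "x \<in> space M"
  shows "pe x < \<infinity>"
proof -
  have "pe x \<le> (\<integral>\<^sup>+m. ennreal (2 * R * V) * (ennreal (m powr (-1/2) / (R + m)) * indicator {0<..} m) \<partial>lborel)"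
    unfolding pe_def
  proof (rule nn_integral_mono)
    fix m :: real
    show "ennreal (\<tau> x powr (-1/2-m) * (V * m powr (-1/2))) * indicator {0<..R} m
        \<le> ennreal (2 * R * V) * (ennreal (m powr (-1/2) / (R + m)) * indicator {0<..} m)"
    proof (cases "0 < m \<and> m \<le> R")
      case True
      have "\<tau> x powr (-1/2-m) \<le> 1"
        using \<tau>_ge[OF assms] True powr_mono[of "-1/2-m" 0 "\<tau> x"] by simp
      then have "\<tau> x powr (-1/2-m) * (V * m powr (-1/2)) \<le> 1 * (V * m powr (-1/2))"
        using RV by (intro mult_right_mono) auto
      \<comment> \<open>On (0, R] the inserted factor is at least 1; it produces a Carleman integral
        with l = R.\<close>
      also have "\<dots> \<le> (2 * R / (R + m)) * (V * m powr (-1/2))"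
        using RV True by (intro mult_right_mono) auto
      also have "\<dots> = 2 * R * V * (m powr (-1/2) / (R + m))" by simp
      finally show ?thesis using RV True by (simp add: ennreal_mult[symmetric])
    qed (auto split: split_indicator)
  qed
  also have "\<dots> = ennreal (2 * R * V) * ennreal (pi * R powr (-1/2))"
    by (subst nn_integral_cmult, measurable) (simp only: nn_integral_Carleman_kernel[OF RV(1)])
  also have "\<dots> < \<infinity>" by (simp add: ennreal_mult_less_top)
  finally show ?thesis .
qed

lemma pe_pos:
  assumes "x \<in> space M"
  shows "0 < pe x"
proof -
  define c where "c = \<tau> x powr (-1/2-R) * (V * R powr (-1/2))"
  have c: "0 < c" using \<tau>_ge[OF assms] RV by (simp add: c_def)
  have "0 < ennreal c * ennreal R" using c RV by (simp add: ennreal_zero_less_mult_iff)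
  also have "\<dots> = (\<integral>\<^sup>+m. ennreal c * indicator {0<..R} m \<partial>lborel)"
    using RV by (simp add: nn_integral_cmult_indicator)
  also have "\<dots> \<le> pe x"
    unfolding pe_def
  proof (rule nn_integral_mono)
    fix m :: real
    show "ennreal c * indicator {0<..R} m \<le> ennreal (\<tau> x powr (-1/2-m) * (V * m powr (-1/2))) * indicator {0<..R} m"
    proof (cases "0 < m \<and> m \<le> R")
      case True
      have "c \<le> \<tau> x powr (-1/2-m) * (V * m powr (-1/2))"
        unfolding c_def using \<tau>_ge[OF assms] RV True
        by (intro mult_mono mult_left_mono powr_mono powr_mono2') auto
      then show ?thesis using True by (simp add: ennreal_leI)
    qed (auto split: split_indicator)
  qed
  finally show ?thesis .
qed

lemma schur_row:
  assumes x: "x \<in> space M"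
  shows "(\<integral>\<^sup>+l. ennreal (\<kappa> x l * l powr (-1/2)) \<partial>ray_measure 0) \<le> pe x"
  unfolding nn_integral_ray pe_def
proof (rule nn_integral_mono)
  fix l :: real
  show "ennreal (\<kappa> x l * l powr (-1/2)) * indicator {0<..} l
      \<le> ennreal (\<tau> x powr (-1/2-l) * (V * l powr (-1/2))) * indicator {0<..R} l"
  proof (cases "0 < l \<and> l \<le> R")
    case True
    have "\<kappa> x l * l powr (-1/2) \<le> (V * \<tau> x powr (-1/2-l)) * l powr (-1/2)"
      unfolding \<kappa>_def using v_le[of l] by (intro mult_right_mono) auto
    then show ?thesis using True by (simp add: ennreal_leI mult_ac)
  next
    case False
    then have "l \<le> 0 \<or> v l = 0" using v_supp[of l] by linarith
    then show ?thesis by (auto simp: \<kappa>_def split: split_indicator)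
  qed
qed

text \<open>Exchanging the integrals produces the moment k(l + m). For l and m at most
  \<open>R\<close> the bound C0 / (l + m) applies and leaves the Carleman integral.\<close>

lemma schur_col:
  assumes l: "0 < l"
  shows "(\<integral>\<^sup>+x. ennreal (\<kappa> x l) * pe x \<partial>M) \<le> ennreal (V * V * C0 * pi * l powr (-1/2))"
proof (cases "l \<le> R")
  case False
  then show ?thesis by (simp add: \<kappa>_def v_supp)
next
  case True
  interpret P: pair_sigma_finite M lborel ..
  have "(\<integral>\<^sup>+x. ennreal (\<kappa> x l) * pe x \<partial>M)
      = (\<integral>\<^sup>+x. (\<integral>\<^sup>+m. ennreal (\<kappa> x l) * (ennreal (\<tau> x powr (-1/2-m) * (V * m powr (-1/2))) * indicator {0<..R} m) \<partial>lborel) \<partial>M)"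
    unfolding pe_def by (intro nn_integral_cong nn_integral_cmult[symmetric]) measurable
  also have "\<dots> = (\<integral>\<^sup>+x. (\<integral>\<^sup>+m. ennreal (v l * (V * m powr (-1/2)) * \<tau> x powr (-1-(l+m))) * indicator {0<..R} m \<partial>lborel) \<partial>M)"
  proof (intro nn_integral_cong)
    fix x m
    have "\<kappa> x l * (\<tau> x powr (-1/2-m) * (V * m powr (-1/2))) = v l * (V * m powr (-1/2)) * (\<tau> x powr (-1/2-l) * \<tau> x powr (-1/2-m))"
      by (simp add: \<kappa>_def mult_ac)
    moreover have "0 \<le> \<tau> x powr (-1/2-m) * (V * m powr (-1/2))" using RV by simp
    ultimately have "ennreal (\<kappa> x l) * ennreal (\<tau> x powr (-1/2-m) * (V * m powr (-1/2)))
        = ennreal (v l * (V * m powr (-1/2)) * \<tau> x powr (-1-(l+m)))"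
      by (simp only: \<tau>_powr_mult ennreal_mult[OF \<kappa>_nonneg, symmetric])
    then show "ennreal (\<kappa> x l) * (ennreal (\<tau> x powr (-1/2-m) * (V * m powr (-1/2))) * indicator {0<..R} m)
        = ennreal (v l * (V * m powr (-1/2)) * \<tau> x powr (-1-(l+m))) * indicator {0<..R} m"
      by (simp only: mult.assoc[symmetric])
  qed
  also have "\<dots> = (\<integral>\<^sup>+m. (\<integral>\<^sup>+x. ennreal (v l * (V * m powr (-1/2)) * \<tau> x powr (-1-(l+m))) * indicator {0<..R} m \<partial>M) \<partial>lborel)"
    by (rule P.Fubini'[symmetric]) measurable
  also have "\<dots> \<le> (\<integral>\<^sup>+m. ennreal (V * V * C0) * (ennreal (m powr (-1/2) / (l + m)) * indicator {0<..} m) \<partial>lborel)"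
  proof (rule nn_integral_mono)
    fix m :: real
    show "(\<integral>\<^sup>+x. ennreal (v l * (V * m powr (-1/2)) * \<tau> x powr (-1-(l+m))) * indicator {0<..R} m \<partial>M)
        \<le> ennreal (V * V * C0) * (ennreal (m powr (-1/2) / (l + m)) * indicator {0<..} m)"
    proof (cases "0 < m \<and> m \<le> R")
      case m: True
      have nn: "0 \<le> v l * (V * m powr (-1/2))" using RV v_nonneg by simp
      have "(\<integral>\<^sup>+x. ennreal (v l * (V * m powr (-1/2)) * \<tau> x powr (-1-(l+m))) * indicator {0<..R} m \<partial>M)
          = (\<integral>\<^sup>+x. ennreal (v l * (V * m powr (-1/2))) * ennreal (\<tau> x powr (-1-(l+m))) \<partial>M)"
        using m nn by (intro nn_integral_cong) (simp add: ennreal_mult)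
      also have "\<dots> = ennreal (v l * (V * m powr (-1/2))) * ennreal (k (l + m))"
        using l m by (subst nn_integral_cmult) (auto simp: moment)
      also have "\<dots> = ennreal (v l * (V * m powr (-1/2)) * k (l + m))"
        using nn k_nonneg[of "l+m"] l m by (simp add: ennreal_mult)
      also have "\<dots> \<le> ennreal (V * (V * m powr (-1/2)) * (C0 / (l + m)))"
        using v_le[of l] v_nonneg[of l] k_le[of "l+m"] k_nonneg[of "l+m"] RV l m \<open>l \<le> R\<close>
        by (intro ennreal_leI mult_mono mult_right_mono) auto
      also have "V * (V * m powr (-1/2)) * (C0 / (l + m)) = (V * V * C0) * (m powr (-1/2) / (l + m))"
        by simp
      finally show ?thesis using m l RV by (simp add: ennreal_mult[symmetric])
    qed (auto split: split_indicator)
  qed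
  also have "\<dots> = ennreal (V * V * C0) * ennreal (pi * l powr (-1/2))"
    by (subst nn_integral_cmult, measurable) (simp only: nn_integral_Carleman_kernel[OF l])
  also have "\<dots> = ennreal (V * V * C0 * pi * l powr (-1/2))"
    using RV by (simp add: ennreal_mult[symmetric] mult_ac)
  finally show ?thesis .
qed

text \<open>The column bound requires \<open>V * V * C0 * pi\<close>, the row bound requires 1; the
  sum serves for both and is positive.\<close>

definition C :: real where
  "C = 1 + V * V * C0 * pi"

lemma kernel_op: "kernel_operator M (ray_measure 0) \<kappa> C"
proof -
  have psf: "pair_sigma_finite M (ray_measure 0)"
    by (intro pair_sigma_finite.intro sigma_finite_measure_axioms sigma_finite_ray)
  have psf': "pair_sigma_finite (ray_measure 0) M"
    by (intro pair_sigma_finite.intro sigma_finite_measure_axioms sigma_finite_ray)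
  have C1: "1 \<le> C" "V * V * C0 * pi \<le> C" using RV by (simp_all add: C_def)
  define p where "p x = enn2real (pe x)" for x
  have p_meas [measurable]: "p \<in> borel_measurable M" unfolding p_def by measurable
  have p_pos: "0 < p x" if "x \<in> space M" for x
    unfolding p_def enn2real_positive_iff using pe_pos[OF that] pe_finite[OF that] by (auto simp: top.not_eq_extremum)
  have p_eq: "ennreal (p x) = pe x" if "x \<in> space M" for x
    unfolding p_def using pe_finite[OF that] by simp
  let ?q = "\<lambda>l::real. l powr (-1/2)"
  have q_meas: "?q \<in> borel_measurable (ray_measure 0)" by (rule measurable_ray) measurable
  have row: "(\<integral>\<^sup>+l. ennreal (\<kappa> x l * ?q l) \<partial>ray_measure 0) \<le> ennreal (C * p x)" if x: "x \<in> space M" for x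
  proof -
    have "(\<integral>\<^sup>+l. ennreal (\<kappa> x l * ?q l) \<partial>ray_measure 0) \<le> ennreal (p x)"
      using schur_row[OF x] by (simp add: p_eq x)
    also have "\<dots> \<le> ennreal (C * p x)"
      using C1 p_pos[OF x] by (intro ennreal_leI) simp
    finally show ?thesis .
  qed
  have col: "(\<integral>\<^sup>+x. ennreal (\<kappa> x l * p x) \<partial>M) \<le> ennreal (C * ?q l)" if l: "l \<in> space (ray_measure 0)" for l
  proof -
    have "(\<integral>\<^sup>+x. ennreal (\<kappa> x l * p x) \<partial>M) = (\<integral>\<^sup>+x. ennreal (\<kappa> x l) * pe x \<partial>M)"
      using p_pos by (intro nn_integral_cong) (simp add: ennreal_mult \<kappa>_nonneg p_eq less_imp_le)
    also have "\<dots> \<le> ennreal (V * V * C0 * pi * l powr (-1/2))" using l by (intro schur_col) simp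
    also have "\<dots> \<le> ennreal (C * ?q l)" using C1 by (intro ennreal_leI mult_right_mono) auto
    finally show ?thesis .
  qed
  have swap: "(\<lambda>(l, x). \<kappa> x l) \<in> borel_measurable (ray_measure 0 \<Otimes>\<^sub>M M)"
    using measurable_pair_swap[OF \<kappa>_meas_ray] by (simp add: split_def)
  show ?thesis
  proof (intro kernel_operator.intro psf kernel_operator_axioms.intro)
    show "(\<lambda>(x, l). \<kappa> x l) \<in> borel_measurable (M \<Otimes>\<^sub>M ray_measure 0)" by (rule \<kappa>_meas_ray)
    show "0 \<le> \<kappa> x l" for x l by (rule \<kappa>_nonneg)
    show "0 < C" using C1 by simp
    show "(\<integral>\<^sup>+x. (\<integral>\<^sup>+l. ennreal (\<kappa> x l) * G l \<partial>ray_measure 0)\<^sup>2 \<partial>M) \<le> ennreal (C\<^sup>2) * (\<integral>\<^sup>+l. (G l)\<^sup>2 \<partial>ray_measure 0)"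
      if "G \<in> borel_measurable (ray_measure 0)" for G
      using C1 p_pos
      by (intro Schur_test[OF psf \<kappa>_meas_ray p_meas q_meas that] \<kappa>_nonneg row col) (auto intro: less_imp_le)
    show "(\<integral>\<^sup>+l. (\<integral>\<^sup>+x. ennreal (\<kappa> x l) * G x \<partial>M)\<^sup>2 \<partial>ray_measure 0) \<le> ennreal (C\<^sup>2) * (\<integral>\<^sup>+x. (G x)\<^sup>2 \<partial>M)"
      if "G \<in> borel_measurable M" for G
      using C1 p_pos
      by (intro Schur_test[OF psf' swap q_meas p_meas that] \<kappa>_nonneg row col) auto
    show "(\<lambda>l. complex_of_real (\<kappa> x l)) \<in> L2 (ray_measure 0)" if x: "x \<in> space M" for x
    proof (rule L2_dominated(1)[OF v_L2, of _ 1])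
      show "(\<lambda>l. complex_of_real (\<kappa> x l)) \<in> borel_measurable (ray_measure 0)"
        unfolding \<kappa>_def by (rule measurable_ray) measurable
      fix l :: real assume "l \<in> space (ray_measure 0)"
      then have "\<tau> x powr (-1/2-l) \<le> 1" using \<tau>_ge[OF x] powr_mono[of "-1/2-l" 0 "\<tau> x"] by simp
      then show "cmod (complex_of_real (\<kappa> x l)) \<le> 1 * cmod (complex_of_real (v l))"
        using v_nonneg[of l] unfolding \<kappa>_def norm_of_real by (simp add: abs_mult mult_left_le)
    qed simp
    show "(\<lambda>x. complex_of_real (\<kappa> x l)) \<in> L2 M" if l: "l \<in> space (ray_measure 0)" for l
    proof -
      have "(\<integral>\<^sup>+x. ennreal ((cmod (complex_of_real (\<kappa> x l)))\<^sup>2) \<partial>M) = (\<integral>\<^sup>+x. ennreal ((v l)\<^sup>2) * ennreal (\<tau> x powr (-1-(l+l))) \<partial>M)"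
        unfolding norm_of_real power2_abs \<kappa>_def power_mult_distrib \<tau>_powr_mult[symmetric]
        by (simp add: ennreal_mult[symmetric] power2_eq_square)
      also have "\<dots> = ennreal ((v l)\<^sup>2) * ennreal (k (l + l))"
        using l by (subst nn_integral_cmult) (auto simp: moment)
      also have "\<dots> < \<infinity>" by (simp add: ennreal_mult_less_top)
      finally show ?thesis unfolding L2_iff_nn \<kappa>_def by simp
    qed
  qed
qed

text \<open>The kernel of the operator in L^2(0, infinity).\<close>

lemma \<kappa>_gram_ray:
  assumes "0 < l" "0 < m"
  shows "(LINT x|M. \<kappa> x l * \<kappa> x m) = v l * v m * k (l + m)"
proof -
  have "(LINT x|M. \<tau> x powr (-1-(l+m))) = k (l + m)"
    using moment[of "l+m"] k_nonneg[of "l+m"] assms by (subst integral_eq_nn_integral) auto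
  then have "v l * v m * k (l + m) = (LINT x|M. v l * v m * \<tau> x powr (-1-(l+m)))" by simp
  also have "\<dots> = (LINT x|M. \<kappa> x l * \<kappa> x m)"
    unfolding \<kappa>_def \<tau>_powr_mult[symmetric] by (simp add: mult_ac)
  finally show ?thesis by simp
qed

text \<open>The kernel of the Helson operator: with v^2 = w the right side is its symbol at the
  product of the two variables.\<close>

lemma \<kappa>_gram:
  assumes "x \<in> space M" "y \<in> space M"
  shows "(LINT l|ray_measure 0. \<kappa> x l * \<kappa> y l)
    = (LINT l|ray_measure 0. (\<tau> x * \<tau> y) powr (-1/2-l) * (v l)\<^sup>2)"
proof (rule Bochner_Integration.integral_cong[OF refl])
  fix l
  have "(\<tau> x * \<tau> y) powr (-1/2-l) = \<tau> x powr (-1/2-l) * \<tau> y powr (-1/2-l)"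
    by (rule powr_mult)
  then show "\<kappa> x l * \<kappa> y l = (\<tau> x * \<tau> y) powr (-1/2-l) * (v l)\<^sup>2"
    by (simp add: \<kappa>_def power2_eq_square mult_ac)
qed

end

section \<open>The two moment functions and the reduction to a Borel weight\<close>

lemma nat_moment:
  assumes s: "0 < s"
  shows "(\<integral>\<^sup>+j. ennreal (real j powr (-1-s)) \<partial>ell2_measure) = ennreal (1 / s + zeta_reg s)"
proof -
  have bij: "bij_betw Suc UNIV {1..}"
    by (rule bij_betwI[of _ _ _ "\<lambda>n. n - 1"]) auto
  have "(\<integral>\<^sup>+j. ennreal (real j powr (-1-s)) \<partial>ell2_measure) = (\<Sum>j. ennreal (real (Suc j) powr (-1-s)))"
    by (simp only: nn_integral_bij_count_space[OF bij, symmetric] nn_integral_count_space_nat)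
  also have "\<dots> = ennreal (1 / s + zeta_reg s)"
    using zeta_eq[OF s] by (auto simp only: sums_iff suminf_ennreal2 powr_ge_zero)
  finally show ?thesis .
qed

lemma ray_moment:
  assumes s: "0 < s"
  shows "(\<integral>\<^sup>+t. ennreal (t powr (-1-s)) \<partial>ray_measure 1) = ennreal (1 / s)"
proof -
  have i: "has_bochner_integral lborel (\<lambda>t. indicator {1..} t * t powr (-1-s)) (1 / s)"
    using has_bochner_integral_powr_ln[OF s, of 0] by simp
  have "(\<integral>\<^sup>+t. ennreal (t powr (-1-s)) \<partial>ray_measure 1) = (\<integral>\<^sup>+t. ennreal (indicator {1..} t * t powr (-1-s)) \<partial>lborel)"
    unfolding nn_integral_ray
    by (rule nn_integral_cong_AE, use AE_lborel_singleton[of 1] in eventually_elim) (auto split: split_indicator)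
  also have "\<dots> = ennreal (1 / s)"
    using i by (subst nn_integral_eq_integral) (auto simp: has_bochner_integral_iff)
  finally show ?thesis .
qed

lemma L2_selfadjoint_diff:
  assumes A: "L2_selfadjoint M A" and B: "L2_selfadjoint M B"
  shows "L2_selfadjoint M (\<lambda>f x. A f x - B f x)"
proof -
  have AL: "\<And>f. f \<in> L2 M \<Longrightarrow> A f \<in> L2 M" and BL: "\<And>f. f \<in> L2 M \<Longrightarrow> B f \<in> L2 M"
    using A B by (auto simp: L2_selfadjoint_def L2_bounded_op_def)
  obtain a b where a: "\<And>f. f \<in> L2 M \<Longrightarrow> L2_norm M (A f) \<le> a * L2_norm M f"
    and b: "\<And>f. f \<in> L2 M \<Longrightarrow> L2_norm M (B f) \<le> b * L2_norm M f"
    using A B unfolding L2_selfadjoint_def L2_bounded_op_def by blast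
  show ?thesis
    unfolding L2_selfadjoint_def L2_bounded_op_def L2_linear_on_def
  proof (intro conjI ballI allI exI[of _ "a + b"])
    fix f g c d assume fg: "f \<in> L2 M" "g \<in> L2 M"
    have "AE x in M. A (\<lambda>y. c * f y + d * g y) x = c * A f x + d * A g x"
      "AE x in M. B (\<lambda>y. c * f y + d * g y) x = c * B f x + d * B g x"
      using A B fg unfolding L2_selfadjoint_def L2_bounded_op_def L2_linear_on_def by auto
    then show "AE x in M. A (\<lambda>y. c * f y + d * g y) x - B (\<lambda>y. c * f y + d * g y) x
        = c * (A f x - B f x) + d * (A g x - B g x)"
      by eventually_elim (simp add: algebra_simps)
  next
    fix f g assume fg: "f \<in> L2 M" "g \<in> L2 M"
    then show "L2_inner M (\<lambda>x. A f x - B f x) g = L2_inner M f (\<lambda>x. A g x - B g x)"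
      using A B by (simp add: L2_inner_diff AL BL L2_selfadjoint_def)
  next
    fix f assume f: "f \<in> L2 M"
    show "(\<lambda>x. A f x - B f x) \<in> L2 M" using f by (intro L2_diff AL BL)
    have "L2_norm M (\<lambda>x. A f x - B f x) \<le> L2_norm M (A f) + L2_norm M (B f)"
      using L2_norm_triangle_diff[OF AL[OF f] L2_zero BL[OF f]] L2_norm_minus_commute[of M "\<lambda>x. 0" "B f"] by simp
    then show "L2_norm M (\<lambda>x. A f x - B f x) \<le> (a + b) * L2_norm M f"
      using a[OF f] b[OF f] by (simp add: distrib_right)
  qed
qed

lemma zeta_reg_measurable: "zeta_reg \<in> borel_measurable borel"
  unfolding zeta_reg_def[abs_def] by measurable

text \<open>The weight is only Lebesgue measurable, while \<open>ray_measure\<close> carries Borel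
  sets. Passing to a Borel function costs a null set on which sign, bound and support may fail, so
  these are enforced afterwards at every point.\<close>

lemma Borel_weight:
  fixes w :: "real \<Rightarrow> real"
  assumes w_measurable: "w \<in> borel_measurable (lebesgue_on {0<..})"
    and w_nonneg: "\<And>x. x > 0 \<Longrightarrow> w x \<ge> 0"
    and w_bounded: "bounded (w ` {0<..})"
    and w_support: "bounded {x. x > 0 \<and> w x \<noteq> 0}"
  obtains v R V where "v \<in> borel_measurable borel" "\<And>x. 0 \<le> v x" "\<And>x. v x \<le> V" "\<And>x. R < x \<Longrightarrow> v x = 0"
    "0 < R" "0 < V" "AE x in lborel. 0 < x \<longrightarrow> w x = (v x)\<^sup>2"
proof -
  obtain B where B: "0 < B" "\<And>x. 0 < x \<Longrightarrow> w x \<le> B"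
    using w_bounded unfolding bounded_pos by (metis abs_le_D1 greaterThan_iff imageI real_norm_def)
  obtain R where R: "0 < R" "\<And>x. 0 < x \<Longrightarrow> w x \<noteq> 0 \<Longrightarrow> x \<le> R"
    using w_support unfolding bounded_pos by (metis (mono_tags, lifting) abs_le_D1 mem_Collect_eq real_norm_def)
  have "(\<lambda>x. if x \<in> {0<..} then w x else 0) \<in> borel_measurable lebesgue"
    using w_measurable by (rule borel_measurable_if_I) simp
  then obtain g where g [measurable]: "g \<in> borel_measurable lborel"
    and AE: "AE x in lborel. (if x \<in> {0<..} then w x else 0) = g x"
    using completion_ex_borel_measurable_real by blast
  have [measurable]: "g \<in> borel_measurable borel" using g by simp
  \<comment> \<open>Clipping to [0, B] and cutting at \<open>R\<close> changes nothing where
    \<open>g\<close> equals \<open>w\<close>.\<close>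
  define v where "v x = (if x \<le> R then sqrt (max 0 (min B (g x))) else 0)" for x
  show ?thesis
  proof (rule that[of v "sqrt B" R])
    show "v \<in> borel_measurable borel" unfolding v_def[abs_def] by measurable
    show "0 \<le> v x" for x by (simp add: v_def)
    show "v x \<le> sqrt B" for x using B by (simp add: v_def)
    show "AE x in lborel. 0 < x \<longrightarrow> w x = (v x)\<^sup>2"
      using AE
    proof (eventually_elim, intro impI)
      fix x :: real assume *: "(if x \<in> {0<..} then w x else 0) = g x" and x: "0 < x"
      then have "g x = w x" by simp
      then have "max 0 (min B (g x)) = w x" using B(2)[OF x] w_nonneg[OF x] by simp
      moreover have "w x = 0" if "R < x" using R(2)[OF x] that by force
      ultimately show "w x = (v x)\<^sup>2" using w_nonneg[OF x] by (auto simp: v_def)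
    qed
  qed (use B R in \<open>auto simp: v_def\<close>)
qed

theorem theorem2p1:
  fixes w :: "real \<Rightarrow> real" and aa :: "real \<Rightarrow> complex" and a :: "nat \<Rightarrow> complex"
  assumes w_measurable: "w \<in> borel_measurable (lebesgue_on {0<..})"
    and w_nonneg: "\<And>x. x > 0 \<Longrightarrow> w x \<ge> 0"
    and w_bounded: "bounded (w ` {0<..})"
    and w_support: "bounded {x. x > 0 \<and> w x \<noteq> 0}"
    and aa: "\<And>t. t \<ge> 1 \<Longrightarrow>
      aa t = complex_of_real (LINT x:{0<..}|lebesgue. t powr (- 1 / 2 - x) * w x)"
    and a: "\<And>j. j \<ge> 1 \<Longrightarrow> a j = aa (real j)"
  shows "L2_nonneg ell2_measure (helson_matrix a)
    \<and> L2_nonneg (ray_measure 1) (integral_helson aa)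
    \<and> (\<exists>A B. L2_selfadjoint (ray_measure 0) A \<and> L2_selfadjoint (ray_measure 0) B
        \<and> unitarily_equiv_mod_ker ell2_measure (helson_matrix a) (ray_measure 0) A
        \<and> unitarily_equiv_mod_ker (ray_measure 1) (integral_helson aa) (ray_measure 0) B
        \<and> (\<lambda>f x. A f x - B f x) \<in> schatten0 (ray_measure 0))"
proof -
  obtain v R V where v_meas [measurable]: "v \<in> borel_measurable borel" and v: "\<And>x. 0 \<le> v x" "\<And>x. v x \<le> V"
      "\<And>x. R < x \<Longrightarrow> v x = 0"
    and RV: "0 < R" "0 < V" and wv: "AE x in lborel. 0 < x \<longrightarrow> w x = (v x)\<^sup>2"
    by (rule Borel_weight[OF w_measurable w_nonneg w_bounded w_support]) auto
  have aa_eq: "aa t = complex_of_real (LINT l|ray_measure 0. t powr (-1/2-l) * (v l)\<^sup>2)" if t: "1 \<le> t" for t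
  proof -
    have w1: "(\<lambda>x. if x \<in> {0<..} then w x else 0) \<in> borel_measurable lebesgue"
      using w_measurable by (rule borel_measurable_if_I) simp
    have p1: "(\<lambda>x. t powr (-1/2-x)) \<in> borel_measurable lebesgue"
      by (intro measurable_completion) measurable
    have m1: "(\<lambda>x. indicator {0<..} x *\<^sub>R (t powr (-1/2-x) * w x)) \<in> borel_measurable lebesgue"
    proof -
      have "(\<lambda>x. t powr (-1/2-x) * (if x \<in> {0<..} then w x else 0)) \<in> borel_measurable lebesgue"
        using p1 w1 by (rule borel_measurable_times)
      also have "(\<lambda>x. t powr (-1/2-x) * (if x \<in> {0<..} then w x else 0)) = (\<lambda>x. indicator {0<..} x *\<^sub>R (t powr (-1/2-x) * w x))"
        by (rule ext) (simp add: indicator_def)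
      finally show ?thesis .
    qed
    have m2: "(\<lambda>x. indicator {0<..} x *\<^sub>R (t powr (-1/2-x) * (v x)\<^sup>2)) \<in> borel_measurable lborel"
      by measurable
    have "(LINT x:{0<..}|lebesgue. t powr (-1/2-x) * w x) = (LINT x|lebesgue. indicator {0<..} x *\<^sub>R (t powr (-1/2-x) * (v x)\<^sup>2))"
      unfolding set_lebesgue_integral_def
    proof (rule integral_cong_AE[OF m1 measurable_completion[OF m2]])
      show "AE x in lebesgue. indicator {0<..} x *\<^sub>R (t powr (-1/2-x) * w x) = indicator {0<..} x *\<^sub>R (t powr (-1/2-x) * (v x)\<^sup>2)"
        using AE_completion[OF wv] by eventually_elim (simp split: split_indicator)
    qed
    also have "\<dots> = (LINT x|lborel. indicator {0<..} x *\<^sub>R (t powr (-1/2-x) * (v x)\<^sup>2))"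
      by (rule integral_completion[OF m2])
    also have "\<dots> = (LINT l|ray_measure 0. t powr (-1/2-l) * (v l)\<^sup>2)"
      by (rule integral_restrict_space[symmetric]) simp
    finally show ?thesis using aa[OF t] by simp
  qed
  interpret N: helson_factor ell2_measure real v R V "1 + 2 * R" "\<lambda>s. 1 / s + zeta_reg s"
  proof (intro helson_factor.intro helson_factor_axioms.intro sigma_finite_measure_count_space v_meas v RV nat_moment)
    show "0 \<le> 1 / s + zeta_reg s" if "0 < s" for s using zeta_reg_bounds[of s] that by simp
    \<comment> \<open>From \<open>zeta_reg\<close> <= 1 <= 2R / s on this range, which is where the
      constant 1 + 2R comes from.\<close>
    show "1 / s + zeta_reg s \<le> (1 + 2 * R) / s" if "0 < s" "s \<le> 2 * R" for s
    proof -
      have "1 \<le> 2 * R / s" using that by simp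
      with zeta_reg_bounds(2)[of s] that have "1 / s + zeta_reg s \<le> 1 / s + 2 * R / s" by linarith
      then show ?thesis by (simp only: add_divide_distrib)
    qed
  qed (use RV in auto)
  interpret I: helson_factor "ray_measure 1" "\<lambda>t. t" v R V 1 "\<lambda>s. 1 / s"
  proof (intro helson_factor.intro helson_factor_axioms.intro sigma_finite_ray v_meas v RV ray_moment)
    show "(\<lambda>t. t) \<in> borel_measurable (ray_measure 1)" by (intro measurable_ray) simp
  qed auto
  interpret KN: kernel_operator ell2_measure "ray_measure 0" N.\<kappa> N.C by (rule N.kernel_op)
  interpret KN': kernel_operator "ray_measure 0" ell2_measure "\<lambda>l x. N.\<kappa> x l" N.C by (rule KN.flip)
  interpret KI: kernel_operator "ray_measure 1" "ray_measure 0" I.\<kappa> I.C by (rule I.kernel_op)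
  interpret KI': kernel_operator "ray_measure 0" "ray_measure 1" "\<lambda>l x. I.\<kappa> x l" I.C by (rule KI.flip)
  have helson: "helson_matrix a f j = KN.T (KN'.T f) j" if f: "f \<in> L2 ell2_measure" and j: "j \<in> space ell2_measure" for f j
  proof -
    have eq: "a (j * k) = complex_of_real (LINT l|ray_measure 0. N.\<kappa> j l * N.\<kappa> k l)" if k: "k \<in> {1..}" for k
    proof -
      have jk: "1 \<le> j * k" using j k by (simp add: Suc_le_eq)
      have "1 \<le> real j * real k" using jk by (metis of_nat_1 of_nat_le_iff of_nat_mult)
      moreover have "j \<in> space ell2_measure" "k \<in> space ell2_measure" using j k by auto
      ultimately show ?thesis using a[OF jk] by (simp add: aa_eq N.\<kappa>_gram)
    qed
    \<comment> \<open>Absolute summability identifies the unordered sum of the matrix with the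
      integral over counting measure.\<close>
    have int: "integrable ell2_measure (\<lambda>k. a (j * k) * f k)"
      using KN.gram_kernel_integrable[OF f j] by (rule Bochner_Integration.integrable_cong[THEN iffD1, rotated 2]) (auto simp: eq)
    have "helson_matrix a f j = (LINT k|ell2_measure. a (j * k) * f k)"
      unfolding helson_matrix_def
      using infsetsum_infsum[of "\<lambda>k. a (j * k) * f k" "{1..}"] int
      by (simp add: abs_summable_on_def infsetsum_def)
    also have "\<dots> = (LINT k|ell2_measure. complex_of_real (LINT l|ray_measure 0. N.\<kappa> j l * N.\<kappa> k l) * f k)"
      by (intro Bochner_Integration.integral_cong) (auto simp: eq)
    also have "\<dots> = KN.T (KN'.T f) j" by (rule KN.gram_kernel[OF f j, symmetric])
    finally show ?thesis .
  qed
  have int_helson: "integral_helson aa f t = KI.T (KI'.T f) t" if f: "f \<in> L2 (ray_measure 1)" and t: "t \<in> space (ray_measure 1)" for f t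
  proof -
    have eq: "aa (t * s) = complex_of_real (LINT l|ray_measure 0. I.\<kappa> t l * I.\<kappa> s l)" if s: "s \<in> space (ray_measure 1)" for s
    proof -
      have "1 \<le> t * s" using t s mult_mono[of 1 t 1 s] by simp
      then show ?thesis by (simp only: aa_eq I.\<kappa>_gram[OF t s])
    qed
    have "integral_helson aa f t = (LINT s|ray_measure 1. aa (t * s) * f s)"
      unfolding integral_helson_def set_lebesgue_integral_def by (rule integral_restrict_space[symmetric]) simp
    also have "\<dots> = (LINT s|ray_measure 1. complex_of_real (LINT l|ray_measure 0. I.\<kappa> t l * I.\<kappa> s l) * f s)"
      by (intro Bochner_Integration.integral_cong refl) (simp only: eq)
    also have "\<dots> = KI.T (KI'.T f) t" by (rule KI.gram_kernel[OF f t, symmetric])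
    finally show ?thesis .
  qed
  define A where "A f = KN'.T (KN.T f)" for f
  define B where "B f = KI'.T (KI.T f)" for f
  have sa: "L2_selfadjoint (ray_measure 0) A" "L2_selfadjoint (ray_measure 0) B"
    unfolding A_def[abs_def] B_def[abs_def] by (rule KN'.gram_selfadjoint KI'.gram_selfadjoint, rule refl)+
  \<comment> \<open>Both kernels contain v(x) v(y) / (x + y), so only the regular part of zeta
    survives.\<close>
  have diff: "A f x - B f x = complex_of_real (v x) * (LINT y|ray_measure 0. complex_of_real (zeta_reg (x + y) * v y) * f y)"
    if f: "f \<in> L2 (ray_measure 0)" and x: "0 < x" for f x
  proof -
    have xs: "x \<in> space (ray_measure 0)" using x by simp
    have "A f x - B f x = (LINT y|ray_measure 0. complex_of_real (LINT j|ell2_measure. N.\<kappa> j x * N.\<kappa> j y) * f y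
        - complex_of_real (LINT t|ray_measure 1. I.\<kappa> t x * I.\<kappa> t y) * f y)"
      unfolding A_def B_def KN'.gram_kernel[OF f xs] KI'.gram_kernel[OF f xs]
      by (rule Bochner_Integration.integral_diff[symmetric, OF KN'.gram_kernel_integrable[OF f xs] KI'.gram_kernel_integrable[OF f xs]])
    also have "\<dots> = (LINT y|ray_measure 0. complex_of_real (v x) * (complex_of_real (zeta_reg (x + y) * v y) * f y))"
    proof (rule Bochner_Integration.integral_cong[OF refl])
      fix y :: real assume "y \<in> space (ray_measure 0)"
      then have y: "0 < y" by simp
      show "complex_of_real (LINT j|ell2_measure. N.\<kappa> j x * N.\<kappa> j y) * f y
          - complex_of_real (LINT t|ray_measure 1. I.\<kappa> t x * I.\<kappa> t y) * f y
          = complex_of_real (v x) * (complex_of_real (zeta_reg (x + y) * v y) * f y)"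
        unfolding N.\<kappa>_gram_ray[OF x y] I.\<kappa>_gram_ray[OF x y] by (simp add: algebra_simps)
    qed
    finally show ?thesis by simp
  qed
  have "(\<lambda>f x. A f x - B f x) \<in> schatten0 (ray_measure 0)"
  \<comment> \<open>The ratio and the constant are those of the polynomial approximation with S =
    2R.\<close>
  proof (rule smooth_kernel_schatten0[where h = zeta_reg and q = "2 * R / (1 + 2 * R)" and b = "1 + 2 * R"])
    show "A f x - B f x = complex_of_real (v x) * (LINT y|ray_measure 0. complex_of_real (zeta_reg (x + y) * v y) * f y)"
      if "f \<in> L2 (ray_measure 0)" "0 < x" for f x
      using that by (rule diff)
    show "L2_selfadjoint (ray_measure 0) (\<lambda>f x. A f x - B f x)"
      by (rule L2_selfadjoint_diff[OF sa])
    show "continuous_on {0..2 * R} zeta_reg" using RV by (intro zeta_reg_continuous) simp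
    fix r
    show "\<exists>Q. degree Q \<le> r \<and> (\<forall>s\<in>{0..2 * R}. \<bar>zeta_reg s - poly Q s\<bar> \<le> (1 + 2 * R) * (2 * R / (1 + 2 * R)) ^ r)"
      using zeta_reg_poly_approx[of "2 * R" r] RV by (metis atLeastAtMost_iff mult_pos_pos zero_less_numeral)
  qed (use RV v in \<open>auto intro: N.v_L2 zeta_reg_measurable\<close>)
  moreover have "unitarily_equiv_mod_ker ell2_measure (helson_matrix a) (ray_measure 0) A"
    by (rule KN.gram_unitarily_equiv) (simp_all only: helson A_def)
  moreover have "unitarily_equiv_mod_ker (ray_measure 1) (integral_helson aa) (ray_measure 0) B"
    by (rule KI.gram_unitarily_equiv) (simp_all only: int_helson B_def)
  moreover have "L2_nonneg ell2_measure (helson_matrix a)"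
    by (rule KN.gram_nonneg) (rule helson)
  moreover have "L2_nonneg (ray_measure 1) (integral_helson aa)"
    by (rule KI.gram_nonneg) (rule int_helson)
  ultimately show ?thesis using sa by blast
qed

end
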